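(* Let $\Omega\subset\mathbb{R}^n$ be a domain satisfying the cone condition with $0\in\Omega$, let $m\in\mathbb{N}_0$, $1<p<\infty$, $1\le r\le\infty$, and $\alpha_1,\alpha_2\in\mathbb{R}$ with $(\alpha_2,p,r)\in V_{\alpha_2,p,r}$, $\alpha_2\ge\alpha_1$, $m-\frac np<\alpha_2<n-\frac np$, $m-\alpha_2+\alpha_1>0$, and let $q$ be given by $\frac nq=\frac np-m+\alpha_2-\alpha_1>0$. Then $\dot K_{p,m}^{\alpha_2,r}(\Omega)\hookrightarrow\dot K_q^{\alpha_1,r}(\Omega)$ (continuous embedding).
   Context: For $k\in\mathbb{Z}$ let $C_k=\{x\in\mathbb{R}^n: 2^{k-1}\le |x|<2^k\}$ and $\chi_k$ its characteristic function. For $\alpha\in\mathbb{R}$, $1\le p,q\le\infty$ and $\Omega$ open, $\|f\|_{\dot K_p^{\alpha,q}(\Omega)}=\big(\sum_{k\in\mathbb{Z}}2^{k\alpha q}\|f\chi_{C_k\cap\Omega}\|_{L^p}^q\big)^{1/q}$ (usual modification if $q=\infty$), and $\dot K_p^{\alpha,q}(\Omega)$ is the set of functions on $\Omega$ (locally $L^p$ away from $0$) with finite norm. $V_{\alpha,p,q}$ is the set of $(\alpha,p,q)\in\mathbb{R}\times[1,\infty]^2$ with either $\alpha<n-\frac np$; or $\alpha=n-\frac np$ and $q=1$; or $\alpha=0$, $p=q=\infty$. For $(\alpha,p,q)\in V_{\alpha,p,q}$ and $m\in\mathbb{N}_0$, the Herz–Sobolev space $\dot K_{p,m}^{\alpha,q}(\Omega)$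 is the set of $f\in\dot K_p^{\alpha,q}(\Omega)$ whose weak derivatives satisfy $D^\beta f\in\dot K_p^{\alpha,q}(\Omega)$ for $|\beta|\le m$, with norm $\|f\|_{\dot K_{p,m}^{\alpha,q}(\Omega)}=\big(\sum_{k\in\mathbb{Z}}2^{k\alpha q}\big(\sum_{|\beta|\le m}\|(D^\beta f)\chi_{C_k\cap\Omega}\|_{L^p}^p\big)^{q/p}\big)^{1/q}$ (sup over $k$ if $q=\infty$). A finite cone with vertex $0$ of height $\varrho>0$, axis direction $v\ne0$ and aperture $\kappa\in(0,\pi)$ is $\{x: x=0 \text{ or } 0<|x|\le\varrho,\ \angle(x,v)\le\kappa/2\}$. A domain (open connected set) $\Omega$ satisfies the cone condition if there is a finite cone $C$ such that every $x\in\Omega$ is the vertex of a finite cone $C_x\subset\Omega$ congruent to $C$ (obtained from $C$ by a rigid motion). *)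

theory Defs
  imports "HOL-Analysis.Analysis"
begin

text \<open>Positive real power of an extended nonnegative real (exponent a > 0 intended).\<close>
definition enn_rpow :: "ennreal \<Rightarrow> real \<Rightarrow> ennreal" where
  "enn_rpow x a = (if x = \<infinity> then \<infinity> else ennreal (enn2real x powr a))"

definition lp_norm :: "ennreal \<Rightarrow> (real^'n \<Rightarrow> real) \<Rightarrow> ennreal" where
  "lp_norm p f =
     (if p = \<infinity> then Inf {c. AE x in lebesgue. ennreal \<bar>f x\<bar> \<le> c}
      else enn_rpow (\<integral>\<^sup>+ x. ennreal (\<bar>f x\<bar> powr enn2real p) \<partial>lebesgue) (1 / enn2real p))"

definition annulus :: "int \<Rightarrow> (real^'n) set" where
  "annulus k = {x. 2 powr (real_of_int k - 1) \<le> norm x \<and> norm x < 2 powr (real_of_int k)}"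

definition herz_norm :: "real \<Rightarrow> ennreal \<Rightarrow> ennreal \<Rightarrow> (real^'n) set \<Rightarrow> (real^'n \<Rightarrow> real) \<Rightarrow> ennreal" where
  "herz_norm \<alpha> p q \<Omega> f =
     (let a = (\<lambda>k::int. ennreal (2 powr (real_of_int k * \<alpha>)) *
                        lp_norm p (\<lambda>x. indicator (annulus k \<inter> \<Omega>) x * f x))
      in if q = \<infinity> then (SUP k. a k)
         else enn_rpow (\<integral>\<^sup>+ k. enn_rpow (a k) (enn2real q) \<partial>count_space UNIV) (1 / enn2real q))"

definition herz_space :: "real \<Rightarrow> ennreal \<Rightarrow> ennreal \<Rightarrow> (real^'n) set \<Rightarrow> (real^'n \<Rightarrow> real) set" where
  "herz_space \<alpha> p q \<Omega> = {f. set_borel_measurable lebesgue \<Omega> f \<and> herz_norm \<alpha> p q \<Omega> f < \<infinity>}"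

definition inv_exp :: "ennreal \<Rightarrow> real" where
  "inv_exp p = (if p = \<infinity> then 0 else 1 / enn2real p)"

definition in_V :: "nat \<Rightarrow> real \<Rightarrow> ennreal \<Rightarrow> ennreal \<Rightarrow> bool" where
  "in_V n \<alpha> p q \<longleftrightarrow> 1 \<le> p \<and> 1 \<le> q \<and>
     (\<alpha> < real n - real n * inv_exp p \<or>
      (\<alpha> = real n - real n * inv_exp p \<and> q = 1) \<or>
      (\<alpha> = 0 \<and> p = \<infinity> \<and> q = \<infinity>))"

definition pd :: "'n \<Rightarrow> (real^'n \<Rightarrow> real) \<Rightarrow> (real^'n \<Rightarrow> real)" where
  "pd i \<phi> = (\<lambda>x. frechet_derivative \<phi> (at x) (axis i 1))"

primrec iter_pd :: "'n list \<Rightarrow> (real^'n \<Rightarrow> real) \<Rightarrow> (real^'n \<Rightarrow> real)" where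
  "iter_pd [] \<phi> = \<phi>"
| "iter_pd (i # ds) \<phi> = pd i (iter_pd ds \<phi>)"

definition smooth_fun :: "(real^'n \<Rightarrow> real) \<Rightarrow> bool" where
  "smooth_fun \<phi> \<longleftrightarrow> (\<forall>ds x. iter_pd ds \<phi> differentiable (at x))"

definition test_fun :: "(real^'n) set \<Rightarrow> (real^'n \<Rightarrow> real) \<Rightarrow> bool" where
  "test_fun \<Omega> \<phi> \<longleftrightarrow> smooth_fun \<phi> \<and> compact (closure {x. \<phi> x \<noteq> 0}) \<and> closure {x. \<phi> x \<noteq> 0} \<subseteq> \<Omega>"

definition mi_abs :: "('n::finite \<Rightarrow> nat) \<Rightarrow> nat" where
  "mi_abs \<beta> = sum \<beta> UNIV"

text \<open>g is the weak derivative D^beta f on Omega. D^beta phi is computed as an iterated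
  partial derivative along any list of directions with multiplicities beta.\<close>
definition weak_deriv :: "(real^'n) set \<Rightarrow> ('n \<Rightarrow> nat) \<Rightarrow> (real^'n \<Rightarrow> real) \<Rightarrow> (real^'n \<Rightarrow> real) \<Rightarrow> bool" where
  "weak_deriv \<Omega> \<beta> f g \<longleftrightarrow>
     (\<forall>\<phi>. test_fun \<Omega> \<phi> \<longrightarrow> (\<forall>ds. (\<forall>i. count_list ds i = \<beta> i) \<longrightarrow>
        set_integrable lebesgue \<Omega> (\<lambda>x. f x * iter_pd ds \<phi> x) \<and>
        set_integrable lebesgue \<Omega> (\<lambda>x. g x * \<phi> x) \<and>
        (\<integral>x\<in>\<Omega>. f x * iter_pd ds \<phi> x \<partial>lebesgue) = (-1) ^ mi_abs \<beta> * (\<integral>x\<in>\<Omega>. g x * \<phi> x \<partial>lebesgue)))"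

text \<open>A chosen weak derivative (unique a.e. when it exists); D^0 f = f.\<close>
definition wderiv :: "(real^'n) set \<Rightarrow> ('n \<Rightarrow> nat) \<Rightarrow> (real^'n \<Rightarrow> real) \<Rightarrow> (real^'n \<Rightarrow> real)" where
  "wderiv \<Omega> \<beta> f = (if \<beta> = (\<lambda>_. 0) then f else (SOME g. weak_deriv \<Omega> \<beta> f g))"

definition herz_sobolev_space :: "real \<Rightarrow> ennreal \<Rightarrow> ennreal \<Rightarrow> nat \<Rightarrow> (real^'n) set \<Rightarrow> (real^'n \<Rightarrow> real) set" where
  "herz_sobolev_space \<alpha> p q m \<Omega> =
     {f \<in> herz_space \<alpha> p q \<Omega>. \<forall>\<beta>. mi_abs \<beta> \<le> m \<longrightarrow> \<beta> \<noteq> (\<lambda>_. 0) \<longrightarrow>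
        (\<exists>g. weak_deriv \<Omega> \<beta> f g \<and> g \<in> herz_space \<alpha> p q \<Omega>)}"

definition herz_sobolev_norm :: "real \<Rightarrow> ennreal \<Rightarrow> ennreal \<Rightarrow> nat \<Rightarrow> (real^'n) set \<Rightarrow> (real^'n \<Rightarrow> real) \<Rightarrow> ennreal" where
  "herz_sobolev_norm \<alpha> p q m \<Omega> f =
     (let B = {\<beta>::'n \<Rightarrow> nat. mi_abs \<beta> \<le> m};
          nk = (\<lambda>k \<beta>. lp_norm p (\<lambda>x. indicator (annulus k \<inter> \<Omega>) x * wderiv \<Omega> \<beta> f x));
          inner = (\<lambda>k. if p = \<infinity> then (SUP \<beta>\<in>B. nk k \<beta>)
                        else enn_rpow (\<Sum>\<beta>\<in>B. enn_rpow (nk k \<beta>) (enn2real p)) (1 / enn2real p));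
          a = (\<lambda>k::int. ennreal (2 powr (real_of_int k * \<alpha>)) * inner k)
      in if q = \<infinity> then (SUP k. a k)
         else enn_rpow (\<integral>\<^sup>+ k. enn_rpow (a k) (enn2real q) \<partial>count_space UNIV) (1 / enn2real q))"

definition fin_cone :: "real \<Rightarrow> real^'n \<Rightarrow> real \<Rightarrow> (real^'n) set" where
  "fin_cone \<rho> v \<kappa> = {x. x = 0 \<or> (0 < norm x \<and> norm x \<le> \<rho> \<and>
       arccos ((x \<bullet> v) / (norm x * norm v)) \<le> \<kappa> / 2)}"

definition cone_condition :: "(real^'n) set \<Rightarrow> bool" where
  "cone_condition \<Omega> \<longleftrightarrow> (\<exists>\<rho> (v::real^'n) \<kappa>. 0 < \<rho> \<and> v \<noteq> 0 \<and> 0 < \<kappa> \<and> \<kappa> < pi \<and>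
     (\<forall>x\<in>\<Omega>. \<exists>T::real^'n \<Rightarrow> real^'n. orthogonal_transformation T \<and> (\<lambda>y. x + T y) ` fin_cone \<rho> v \<kappa> \<subseteq> \<Omega>))"

end

theory Submission
  imports Defs
begin

text \<open>
  It suffices to gain one derivative at a time, losing \<open>(\<alpha>\<^sub>2 - \<alpha>\<^sub>1) / m\<close> in the weight and
  \<open>\<sigma> = (m - \<alpha>\<^sub>2 + \<alpha>\<^sub>1) / m \<in> (0, 1]\<close> in \<open>n / p\<close> at every step. If \<open>x + t y \<in> \<Omega> - {0}\<close> for
  \<open>0 \<le> t \<le> 1\<close> and all \<open>y\<close> in a ball, then averaging
  \<open>f(x) = f(x + t y) - \<integral>\<^sub>0\<^sup>t y \<bullet> \<nabla>f(x + \<tau> y) d\<tau>\<close> over \<open>t\<close> and \<open>y\<close> bounds \<open>\<bar>f(x)\<bar>\<close> by an integral of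
  \<open>\<bar>f\<bar> + \<bar>\<nabla>f\<bar>\<close> over a cone; for weak derivatives this identity is tested against smooth functions.
  The cone comes from the cone condition away from the origin and points outwards near the origin, so
  that \<open>\<bar>x + t y\<bar>\<close> is comparable to \<open>max \<bar>x\<bar> t\<close>. For \<open>x\<close> in the annulus \<open>k\<close>, the part of the cone in
  annuli near \<open>k\<close> is controlled by the Hardy-Littlewood-Sobolev inequality, and the part in an annulus
  \<open>j > k + 1\<close> has \<open>t \<approx> 2\<^sup>j\<close> and is bounded pointwise; \<open>m - n/p < \<alpha>\<^sub>2\<close> makes the
  contributions decay geometrically in \<open>j - k\<close>, so that they sum in \<open>\<ell>\<^sup>r\<close>.
\<close>

section \<open>Powers of extended nonnegative reals and sequence norms\<close>

text \<open>The Herz norm controls a function in L^p on each annulus separately, so integrability of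
  f and its derivatives is extracted only on compact sets that miss the origin. This forces the
  cones to avoid 0 and the weak identity to be tested in \<open>\<Omega> - {0}\<close>.

  The splitting of the exponents rests on one invariant. If stage j has exponent s_j with n / s_j =
  n / p - j \<sigma> and weight \<open>\<alpha>\<^sub>2 - j * (1 - \<sigma>)\<close>, then weight +
  n / s_j drops by exactly 1 per stage and equals \<open>\<alpha>\<^sub>2 + n / p - j\<close>. Its
  value after a stage is the rate of geometric decay in that stage, and it stays positive up to j =
  m.

  A single derivative yields a kernel of order 1. For t < \<open>2 powr j / c\<close> it is
  dominated by the kernel of order \<sigma> at the price of a factor of size 2 to the power j (1 -
  \<sigma>), which the change of weight absorbs; this is where \<sigma> \<le> 1 enters.

  Constants are never tracked. Hence finite sums are bounded through their largest term in place of
  Minkowski's inequality, and Hoelder's inequality is replaced by truncation at a level.\<close>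

lemma enn_rpow_ennreal: "0 \<le> x \<Longrightarrow> enn_rpow (ennreal x) a = ennreal (x powr a)"
  by (simp add: enn_rpow_def)

lemma enn_rpow_top_0 [simp]: "enn_rpow top a = top" "enn_rpow 0 a = 0"
  by (auto simp: enn_rpow_def)

lemma enn_rpow_mono: "0 < a \<Longrightarrow> x \<le> y \<Longrightarrow> enn_rpow x a \<le> enn_rpow y a"
  by (cases x; cases y) (auto simp: enn_rpow_ennreal powr_mono2 top_unique)

lemma enn_rpow_rpow: "0 < a \<Longrightarrow> 0 < b \<Longrightarrow> enn_rpow (enn_rpow x a) b = enn_rpow x (a * b)"
  by (cases x) (auto simp: enn_rpow_ennreal powr_powr)

lemma enn_rpow_one: "enn_rpow x 1 = x"
  by (cases x) (auto simp: enn_rpow_ennreal)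

lemma enn_rpow_cancel: "0 < a \<Longrightarrow> enn_rpow (enn_rpow x a) (1 / a) = x"
  "0 < a \<Longrightarrow> enn_rpow (enn_rpow x (1 / a)) a = x"
  by (simp_all add: enn_rpow_rpow enn_rpow_one)

lemma enn_rpow_mult:
  assumes "0 < a"
  shows "enn_rpow (x * y) a = enn_rpow x a * enn_rpow y a"
proof (cases "x = 0 \<or> y = 0")
  case False
  then show ?thesis using assms
    by (cases x; cases y)
      (auto simp: enn_rpow_ennreal powr_mult ennreal_mult_top ennreal_top_mult ennreal_mult[symmetric])
qed auto

lemma enn_rpow_eq_0_iff: "enn_rpow x a = 0 \<longleftrightarrow> x = 0"
  by (cases x) (auto simp: enn_rpow_ennreal)

lemma enn_rpow_less_top_iff: "enn_rpow x a < top \<longleftrightarrow> x < top"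
  by (cases x) (auto simp: enn_rpow_ennreal)

lemma enn_rpow_measurable [measurable (raw)]:
  assumes [measurable]: "f \<in> borel_measurable M"
  shows "(\<lambda>x. enn_rpow (f x) a) \<in> borel_measurable M"
  unfolding enn_rpow_def by measurable

lemma enn_rpow_le_cmult:
  assumes "0 < a" "0 \<le> c" "x \<le> ennreal c * y"
  shows "enn_rpow x a \<le> ennreal (c powr a) * enn_rpow y a"
  using enn_rpow_mono[OF assms(1,3)] assms by (simp add: enn_rpow_mult enn_rpow_ennreal)

text \<open>Bounding the sum by the number of terms times the largest one works for every exponent a
  > 0 at once, below and above 1. It stands in for Minkowski's inequality in
  \<open>seq_norm_sum_le\<close> and \<open>lnorm_sum_le\<close>.\<close>

lemma enn_rpow_sum_le:
  assumes "finite I" "0 < a"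
  shows "enn_rpow (\<Sum>i\<in>I. x i) a \<le> ennreal (real (card I) powr a) * (\<Sum>i\<in>I. enn_rpow (x i) a)"
proof (cases "I = {}")
  case False
  then obtain j where j: "j \<in> I" "\<And>i. i \<in> I \<Longrightarrow> x i \<le> x j"
    using finite_has_maximal[of "x ` I"] assms
    by (metis (no_types, lifting) finite_imageI imageE image_eqI image_is_empty linorder_le_cases)
  have "(\<Sum>i\<in>I. x i) \<le> ennreal (real (card I)) * x j"
    using sum_bounded_above[of I x "x j"] j by (simp add: ennreal_of_nat_eq_real_of_nat)
  then have "enn_rpow (\<Sum>i\<in>I. x i) a \<le> ennreal (real (card I) powr a) * enn_rpow (x j) a"
    by (intro enn_rpow_le_cmult assms) auto
  also have "\<dots> \<le> ennreal (real (card I) powr a) * (\<Sum>i\<in>I. enn_rpow (x i) a)"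
    using j assms by (intro mult_left_mono member_le_sum) auto
  finally show ?thesis .
qed simp

text \<open>The outer layer of \<open>herz_norm\<close> and \<open>herz_sobolev_norm\<close>, with
  the same case split, so that both unfold to it.\<close>

definition seq_norm :: "ennreal \<Rightarrow> (int \<Rightarrow> ennreal) \<Rightarrow> ennreal" where
  "seq_norm r a = (if r = \<infinity> then (SUP k. a k)
     else enn_rpow (\<integral>\<^sup>+ k. enn_rpow (a k) (enn2real r) \<partial>count_space UNIV) (1 / enn2real r))"

lemma enn2real_pos: "1 \<le> r \<Longrightarrow> r \<noteq> \<infinity> \<Longrightarrow> 0 < enn2real r"
  by (cases r) (auto simp: ennreal_1[symmetric] simp del: ennreal_1)

lemma seq_norm_mono:
  assumes "1 \<le> r" "\<And>k. a k \<le> b k"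
  shows "seq_norm r a \<le> seq_norm r b"
  using assms(2) enn2real_pos[OF assms(1)]
  by (auto simp: seq_norm_def intro!: SUP_mono' enn_rpow_mono nn_integral_mono)

lemma seq_norm_cmult:
  assumes "1 \<le> r"
  shows "seq_norm r (\<lambda>k. c * a k) = c * seq_norm r a"
  using enn2real_pos[OF assms]
  by (auto simp: seq_norm_def SUP_mult_left_ennreal enn_rpow_mult nn_integral_cmult enn_rpow_cancel)

lemma seq_norm_sum_le:
  assumes "1 \<le> r" "finite I"
  shows "\<exists>C\<ge>0. \<forall>a. seq_norm r (\<lambda>k. \<Sum>i\<in>I. a i k) \<le> ennreal C * (\<Sum>i\<in>I. seq_norm r (a i))"
proof (cases "r = \<infinity>")
  case True
  have "(SUP k. \<Sum>i\<in>I. a i k) \<le> (\<Sum>i\<in>I. SUP k. a i k)" for a :: "'a \<Rightarrow> int \<Rightarrow> ennreal"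
    by (intro SUP_least sum_mono SUP_upper) simp
  then show ?thesis using True by (intro exI[of _ 1]) (auto simp: seq_norm_def)
next
  case False
  define s where "s = enn2real r"
  have s: "0 < s" "0 < 1 / s" using enn2real_pos[OF assms(1) False] by (auto simp: s_def)
  define C where "C = (real (card I) powr s) powr (1/s) * real (card I) powr (1/s)"
  have "seq_norm r (\<lambda>k. \<Sum>i\<in>I. a i k) \<le> ennreal C * (\<Sum>i\<in>I. seq_norm r (a i))" for a :: "'a \<Rightarrow> int \<Rightarrow> ennreal"
  proof -
    have "(\<integral>\<^sup>+ k. enn_rpow (\<Sum>i\<in>I. a i k) s \<partial>count_space UNIV)
      \<le> (\<integral>\<^sup>+ k. ennreal (real (card I) powr s) * (\<Sum>i\<in>I. enn_rpow (a i k) s) \<partial>count_space UNIV)"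
      by (intro nn_integral_mono enn_rpow_sum_le s assms)
    also have "\<dots> = ennreal (real (card I) powr s) * (\<Sum>i\<in>I. \<integral>\<^sup>+ k. enn_rpow (a i k) s \<partial>count_space UNIV)"
      by (simp add: nn_integral_cmult nn_integral_sum)
    finally have "enn_rpow (\<integral>\<^sup>+ k. enn_rpow (\<Sum>i\<in>I. a i k) s \<partial>count_space UNIV) (1/s)
      \<le> ennreal ((real (card I) powr s) powr (1/s)) * enn_rpow (\<Sum>i\<in>I. \<integral>\<^sup>+ k. enn_rpow (a i k) s \<partial>count_space UNIV) (1/s)"
      by (rule enn_rpow_le_cmult[OF s(2) powr_ge_zero])
    also have "\<dots> \<le> ennreal ((real (card I) powr s) powr (1/s)) * (ennreal (real (card I) powr (1/s)) *
        (\<Sum>i\<in>I. enn_rpow (\<integral>\<^sup>+ k. enn_rpow (a i k) s \<partial>count_space UNIV) (1/s)))"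
      by (intro mult_left_mono enn_rpow_sum_le s assms) auto
    also have "\<dots> = ennreal C * (\<Sum>i\<in>I. seq_norm r (a i))"
      using False by (simp add: C_def ennreal_mult mult.assoc seq_norm_def s_def)
    finally show ?thesis using False by (simp add: seq_norm_def s_def)
  qed
  then show ?thesis by (intro exI[of _ C]) (auto simp: C_def)
qed

text \<open>Needed twice: to pull one half of the weight out as a supremum in the discrete
  convolution, and to pass from a finite Herz norm to finite norms on the single annuli.\<close>

lemma le_seq_norm:
  assumes "1 \<le> r"
  shows "a k \<le> seq_norm r a"
proof (cases "r = \<infinity>")
  case False
  define s where "s = enn2real r"
  have s: "0 < s" "0 < 1 / s" using enn2real_pos[OF assms(1) False] by (auto simp: s_def)
  have "enn_rpow (a k) s = (\<integral>\<^sup>+ j. enn_rpow (a j) s * indicator {k} j \<partial>count_space UNIV)"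
    by (subst nn_integral_indicator_singleton) auto
  also have "\<dots> \<le> (\<integral>\<^sup>+ k. enn_rpow (a k) s \<partial>count_space UNIV)"
    by (intro nn_integral_mono) (auto simp: indicator_def)
  finally show ?thesis
    using enn_rpow_mono[OF s(2)] False s by (force simp: seq_norm_def enn_rpow_cancel s_def[symmetric])
qed (auto simp: seq_norm_def intro!: SUP_upper)

text \<open>Counting measure on the integers is sigma-finite, and over a countable index set
  measurability of each slice gives joint measurability, so Tonelli applies.\<close>

lemma nn_integral_count_space_int_swap:
  assumes "\<And>j::int. f j \<in> borel_measurable M" "sigma_finite_measure M"
  shows "(\<integral>\<^sup>+ x. (\<integral>\<^sup>+ j. f j x \<partial>count_space UNIV) \<partial>M) = (\<integral>\<^sup>+ j. (\<integral>\<^sup>+ x. f j x \<partial>M) \<partial>count_space UNIV)"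
proof -
  interpret M: sigma_finite_measure M by fact
  interpret Z: sigma_finite_measure "count_space (UNIV :: int set)"
    by (rule sigma_finite_measure_count_space_countable) simp
  interpret pair_sigma_finite "count_space (UNIV :: int set)" M ..
  have [measurable]: "(\<lambda>(j, x). f j x) \<in> borel_measurable (count_space UNIV \<Otimes>\<^sub>M M)"
    using assms(1) by (intro measurable_pair_measure_countable1) auto
  show ?thesis
    by (subst Fubini') auto
qed

lemma nn_integral_two_powr_abs_less_top:
  assumes "0 < \<theta>"
  shows "(\<integral>\<^sup>+ d. ennreal (2 powr (- \<theta> * \<bar>real_of_int d\<bar>)) \<partial>count_space UNIV) < top"
proof -
  let ?f = "\<lambda>d::int. ennreal (2 powr (- \<theta> * \<bar>real_of_int d\<bar>))"
  have geom: "(\<integral>\<^sup>+ n. ennreal (2 powr (- \<theta> * real n)) \<partial>count_space UNIV) < top"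
  proof -
    have "(\<lambda>n. 2 powr (- \<theta> * real n)) = (\<lambda>n. (2 powr (- \<theta>)) ^ n)"
      by (simp add: powr_realpow[symmetric] powr_powr)
    moreover have "summable (\<lambda>n. (2 powr (- \<theta>)) ^ n :: real)"
      using assms by (intro summable_geometric) (simp add: powr_less_one)
    ultimately have "summable (\<lambda>n. 2 powr (- \<theta> * real n))" by simp
    then show ?thesis
      by (subst nn_integral_count_space_nat) (simp add: suminf_ennreal2 top.not_eq_extremum[symmetric])
  qed
  \<comment> \<open>The two half lines overlap at 0, which is harmless for an upper bound.\<close>
  have "(\<integral>\<^sup>+ d. ?f d \<partial>count_space UNIV)
     \<le> (\<integral>\<^sup>+ d. ?f d * indicator (range int) d + ?f d * indicator (range (\<lambda>n. - int n)) d \<partial>count_space UNIV)"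
  proof (intro nn_integral_mono)
    fix d :: int
    have "d \<in> range int \<or> d \<in> range (\<lambda>n. - int n)"
      by (cases d rule: int_cases2) auto
    then show "?f d \<le> ?f d * indicator (range int) d + ?f d * indicator (range (\<lambda>n. - int n)) d"
      by (auto simp: indicator_def)
  qed
  also have "\<dots> = (\<integral>\<^sup>+ d. ?f d \<partial>count_space (range int)) + (\<integral>\<^sup>+ d. ?f d \<partial>count_space (range (\<lambda>n. - int n)))"
    by (subst nn_integral_add) (auto simp: nn_integral_count_space_indicator)
  also have "\<dots> = (\<integral>\<^sup>+ n. ennreal (2 powr (- \<theta> * real n)) \<partial>count_space UNIV) + (\<integral>\<^sup>+ n. ennreal (2 powr (- \<theta> * real n)) \<partial>count_space UNIV)"
    by (subst (1 2) nn_integral_bij_count_space[symmetric, OF inj_on_imp_bij_betw]) (auto simp: inj_on_def)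
  also have "\<dots> < top" using geom by simp
  finally show ?thesis .
qed

text \<open>Splitting the weight as \<open>2 powr - \<theta> \<bar>d\<bar> = (2 powr - \<theta> \<bar>d\<bar> / 2)\<^sup>2\<close> and bounding one half by a
  supremum, which is at most the r-norm, replaces the convexity argument in Young's inequality.\<close>
lemma seq_norm_convolution_le:
  assumes "1 \<le> r" "0 < \<theta>"
  shows "\<exists>C\<ge>0. \<forall>a. seq_norm r (\<lambda>k. \<integral>\<^sup>+ j. ennreal (2 powr (- \<theta> * \<bar>real_of_int (j - k)\<bar>)) * a j \<partial>count_space UNIV)
     \<le> ennreal C * seq_norm r a"
proof -
  define w where "w \<theta> d = ennreal (2 powr (- \<theta> * \<bar>real_of_int d\<bar>))" for \<theta> d
  define W where "W \<theta> = (\<integral>\<^sup>+ d. w \<theta> d \<partial>count_space UNIV)" for \<theta>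
  have W: "W \<theta> < top" if "0 < \<theta>" for \<theta>
    using nn_integral_two_powr_abs_less_top[OF that] by (simp add: W_def w_def)
  have W_shift: "(\<integral>\<^sup>+ j. w \<theta> (j - k) \<partial>count_space UNIV) = W \<theta>" for \<theta> k
    unfolding W_def
    by (rule nn_integral_bij_count_space[of "\<lambda>j. j - k" UNIV UNIV "w \<theta>"]) (rule bij_betw_byWitness[of _ "\<lambda>j. j + k"], auto)
  have W_shift': "(\<integral>\<^sup>+ k. w \<theta> (j - k) \<partial>count_space UNIV) = W \<theta>" for \<theta> j
    unfolding W_def
    by (rule nn_integral_bij_count_space[of "\<lambda>k. j - k" UNIV UNIV "w \<theta>"]) (rule bij_betw_byWitness[of _ "\<lambda>k. j - k"], auto)
  show ?thesis
  proof (cases "r = \<infinity>")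
    case True
    have "(SUP k. \<integral>\<^sup>+ j. w \<theta> (j - k) * a j \<partial>count_space UNIV) \<le> W \<theta> * (SUP k. a k)" for a
    proof (rule SUP_least)
      fix k
      have "(\<integral>\<^sup>+ j. w \<theta> (j - k) * a j \<partial>count_space UNIV) \<le> (\<integral>\<^sup>+ j. w \<theta> (j - k) * (SUP k. a k) \<partial>count_space UNIV)"
        by (intro nn_integral_mono mult_left_mono SUP_upper) auto
      also have "\<dots> = W \<theta> * (SUP k. a k)"
        by (simp add: nn_integral_multc W_shift)
      finally show "(\<integral>\<^sup>+ j. w \<theta> (j - k) * a j \<partial>count_space UNIV) \<le> W \<theta> * (SUP k. a k)" .
    qed
    then show ?thesis using True W[OF assms(2)]
      by (intro exI[of _ "enn2real (W \<theta>)"]) (auto simp: seq_norm_def w_def)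
  next
    case False
    define s where "s = enn2real r"
    have s: "0 < s" "0 < 1 / s" using enn2real_pos[OF assms(1) False] by (auto simp: s_def)
    define h where "h = \<theta> / 2"
    have h: "0 < h" "0 < h * s" using assms s by (auto simp: h_def)
    have ww: "w \<theta> d = w h d * w h d" for d
      by (simp add: w_def h_def ennreal_mult[symmetric] powr_add[symmetric])
    have ws: "enn_rpow (w h d) s = w (h * s) d" for d
      by (simp add: w_def enn_rpow_ennreal powr_powr mult_ac)
    \<comment> \<open>The first factor is the mass of the half weight kept in the inner sum, raised
      to s. The second is the mass of the s-th power of the other half, after the two sums are
      interchanged.\<close>
    define C where "C = enn2real (W h) powr s * enn2real (W (h * s))"
    have main: "(\<integral>\<^sup>+ k. enn_rpow (\<integral>\<^sup>+ j. w \<theta> (j - k) * a j \<partial>count_space UNIV) s \<partial>count_space UNIV)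
       \<le> ennreal C * (\<integral>\<^sup>+ k. enn_rpow (a k) s \<partial>count_space UNIV)" for a
    proof -
      have pt: "enn_rpow (\<integral>\<^sup>+ j. w \<theta> (j - k) * a j \<partial>count_space UNIV) s
        \<le> ennreal (enn2real (W h) powr s) * (\<integral>\<^sup>+ j. w (h * s) (j - k) * enn_rpow (a j) s \<partial>count_space UNIV)" (is "_ \<le> _ * ?S") for k
      proof -
        \<comment> \<open>Each term is at most the r-norm of the whole sequence, and
          \<open>?S\<close> is the s-th power of that norm.\<close>
        have le: "w h (j - k) * a j \<le> enn_rpow ?S (1 / s)" for j
          using le_seq_norm[OF assms(1), of "\<lambda>j. w h (j - k) * a j" j] False s
          by (simp add: seq_norm_def s_def[symmetric] enn_rpow_mult ws)
        have "(\<integral>\<^sup>+ j. w \<theta> (j - k) * a j \<partial>count_space UNIV) \<le> (\<integral>\<^sup>+ j. w h (j - k) * enn_rpow ?S (1 / s) \<partial>count_space UNIV)"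
          unfolding ww mult.assoc by (intro nn_integral_mono mult_left_mono le) auto
        also have "\<dots> = W h * enn_rpow ?S (1 / s)"
          by (subst nn_integral_multc) (auto simp: W_shift)
        finally have "enn_rpow (\<integral>\<^sup>+ j. w \<theta> (j - k) * a j \<partial>count_space UNIV) s \<le> enn_rpow (W h) s * ?S"
          using enn_rpow_mono[OF s(1)] s by (force simp: enn_rpow_mult enn_rpow_cancel)
        moreover have "enn_rpow (W h) s = ennreal (enn2real (W h) powr s)"
          using W[OF h(1)] by (simp add: enn_rpow_def)
        ultimately show ?thesis by simp
      qed
      have "(\<integral>\<^sup>+ k. enn_rpow (\<integral>\<^sup>+ j. w \<theta> (j - k) * a j \<partial>count_space UNIV) s \<partial>count_space UNIV)
        \<le> (\<integral>\<^sup>+ k. ennreal (enn2real (W h) powr s) * (\<integral>\<^sup>+ j. w (h * s) (j - k) * enn_rpow (a j) s \<partial>count_space UNIV) \<partial>count_space UNIV)"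
        by (intro nn_integral_mono pt)
      also have "\<dots> = ennreal (enn2real (W h) powr s) * (\<integral>\<^sup>+ k. (\<integral>\<^sup>+ j. w (h * s) (j - k) * enn_rpow (a j) s \<partial>count_space UNIV) \<partial>count_space UNIV)"
        by (simp add: nn_integral_cmult)
      also have "(\<integral>\<^sup>+ k. (\<integral>\<^sup>+ j. w (h * s) (j - k) * enn_rpow (a j) s \<partial>count_space UNIV) \<partial>count_space UNIV)
         = (\<integral>\<^sup>+ j. (\<integral>\<^sup>+ k. w (h * s) (j - k) * enn_rpow (a j) s \<partial>count_space UNIV) \<partial>count_space UNIV)"
        by (rule nn_integral_count_space_int_swap) (auto intro: sigma_finite_measure_count_space_countable)
      also have "\<dots> = W (h * s) * (\<integral>\<^sup>+ j. enn_rpow (a j) s \<partial>count_space UNIV)"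
        by (simp add: nn_integral_multc nn_integral_cmult W_shift')
      finally show ?thesis using W[OF h(2)] by (simp add: C_def ennreal_mult mult.assoc)
    qed
    have "seq_norm r (\<lambda>k. \<integral>\<^sup>+ j. w \<theta> (j - k) * a j \<partial>count_space UNIV) \<le> ennreal (C powr (1 / s)) * seq_norm r a" for a
      using enn_rpow_mono[OF s(2) main[of a]] False s
      by (simp add: seq_norm_def s_def[symmetric] enn_rpow_mult enn_rpow_ennreal C_def)
    then show ?thesis by (intro exI[of _ "C powr (1 / s)"]) (auto simp: w_def)
  qed
qed

section \<open>The Hardy-Littlewood-Sobolev inequality\<close>

lemma nn_integral_lborel_translate:
  fixes c :: "'a::euclidean_space"
  assumes [measurable]: "f \<in> borel_measurable borel"
  shows "(\<integral>\<^sup>+x. f (x + c) \<partial>lborel) = (\<integral>\<^sup>+x. f x \<partial>lborel)"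
proof -
  have "(\<integral>\<^sup>+x. f x \<partial>lborel) = (\<integral>\<^sup>+x. f x \<partial>distr lborel borel ((+) c))"
    by (simp add: lborel_distr_plus)
  also have "\<dots> = (\<integral>\<^sup>+x. f (x + c) \<partial>lborel)"
    by (subst nn_integral_distr) (auto simp: add.commute)
  finally show ?thesis ..
qed

lemma nn_integral_lborel_dilate:
  fixes x :: "'a::euclidean_space"
  assumes [measurable]: "f \<in> borel_measurable borel" and "0 < t"
  shows "(\<integral>\<^sup>+y. f (x + t *\<^sub>R y) \<partial>lborel) = ennreal (t powr - real DIM('a)) * (\<integral>\<^sup>+y. f y \<partial>lborel)"
proof -
  have "(\<integral>\<^sup>+y. f y \<partial>lborel) = ennreal (t ^ DIM('a)) * (\<integral>\<^sup>+y. f (x + t *\<^sub>R y) \<partial>lborel)"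
    using assms(2) by (subst lborel_affine[of t x]) (auto simp: nn_integral_density nn_integral_distr nn_integral_cmult)
  then show ?thesis
    using assms(2)
    by (simp add: mult.assoc[symmetric] ennreal_mult[symmetric] powr_realpow[symmetric] powr_add[symmetric])
qed

lemma nn_integral_powr_lessThan:
  assumes "- 1 < e" "0 \<le> c"
  shows "(\<integral>\<^sup>+t. ennreal (t powr e) * indicator {0<..<c} t \<partial>lborel) = ennreal (c powr (e + 1) / (e + 1))"
proof -
  have "(\<integral>\<^sup>+t. ennreal (t powr e) * indicator {0<..<c} t \<partial>lborel) = (\<integral>\<^sup>+t. ennreal (t powr e) * indicator {0..c} t \<partial>lborel)"
    using AE_lborel_singleton[of 0] AE_lborel_singleton[of c]
    by (intro nn_integral_cong_AE) (auto simp: indicator_def)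
  then show ?thesis
    using nn_integral_has_integral_lebesgue'[OF _ has_integral_powr_from_0[OF assms]] by simp
qed

lemma nn_integral_powr_atLeast:
  assumes "e < - 1" "0 < c"
  shows "(\<integral>\<^sup>+t. ennreal (t powr e) * indicator {c..} t \<partial>lborel) = ennreal (- (c powr (e + 1)) / (e + 1))"
  using nn_integral_has_integral_lebesgue'[OF _ has_integral_powr_to_inf[OF assms]] by simp

lemma nn_integral_layer_cake:
  assumes "0 < e"
  shows "(\<integral>\<^sup>+\<tau>. ennreal (\<tau> powr (e - 1)) * indicator {\<tau>. 0 < \<tau> \<and> ennreal \<tau> < X} \<tau> \<partial>lborel) = enn_rpow X e / ennreal e"
proof (cases X)
  case (real x)
  then have "{\<tau>. 0 < \<tau> \<and> ennreal \<tau> < X} = {0<..<x}" by (auto simp: ennreal_less_iff)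
  then show ?thesis
    using real assms nn_integral_powr_lessThan[of "e - 1" x] by (simp add: enn_rpow_ennreal divide_ennreal)
next
  case top
  have "ennreal (x powr e / e) \<le> (\<integral>\<^sup>+\<tau>. ennreal (\<tau> powr (e - 1)) * indicator {0<..} \<tau> \<partial>lborel)" if "0 \<le> x" for x
    using nn_integral_powr_lessThan[of "e - 1" x] assms that
    by (auto simp: indicator_def intro!: nn_integral_mono elim!: ord_eq_le_trans[OF sym])
  \<comment> \<open>This x makes the lower bound \<open>x powr e / e\<close> equal to n, so the
    integral exceeds every natural number.\<close>
  from this[of "(real n * e) powr (1 / e)" for n]
  have "of_nat n \<le> (\<integral>\<^sup>+\<tau>. ennreal (\<tau> powr (e - 1)) * indicator {0<..} \<tau> \<partial>lborel)" for n
    using assms by (simp add: powr_powr ennreal_of_nat_eq_real_of_nat)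
  then have "(SUP n. of_nat n) \<le> (\<integral>\<^sup>+\<tau>. ennreal (\<tau> powr (e - 1)) * indicator {0<..} \<tau> \<partial>lborel)"
    by (rule SUP_least)
  then have "(\<integral>\<^sup>+\<tau>. ennreal (\<tau> powr (e - 1)) * indicator {0<..} \<tau> \<partial>lborel) = top"
    by (simp add: ennreal_SUP_of_nat_eq_top top_unique)
  then show ?thesis using top assms by (simp add: greaterThan_def ennreal_top_divide)
qed

section \<open>Integrals over balls\<close>

lemma cball_borel_measurable [measurable]: "cball (x :: 'a::euclidean_space) r \<in> sets borel"
  by (intro borel_closed closed_cball)

text \<open>For t > 0 this is \<open>t powr - n\<close> times the integral of g over the ball of
  radius t about x. Rescaling to the unit ball keeps t a plain parameter of the integrand, which
  makes joint measurability in t and x routine.\<close>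

definition ball_integral :: "real \<Rightarrow> ('a::euclidean_space \<Rightarrow> ennreal) \<Rightarrow> 'a \<Rightarrow> ennreal" where
  "ball_integral t g x = (\<integral>\<^sup>+y. g (x + t *\<^sub>R y) * indicator (cball 0 1) y \<partial>lborel)"

lemma ball_integral_measurable [measurable (raw)]:
  assumes [measurable]: "g \<in> borel_measurable borel" "u \<in> borel_measurable M" "v \<in> borel_measurable M"
  shows "(\<lambda>x. ball_integral (u x) g (v x)) \<in> borel_measurable M"
  unfolding ball_integral_def by measurable

lemma ball_integral_mono: "(\<And>y. f y \<le> g y) \<Longrightarrow> ball_integral t f x \<le> ball_integral t g x"
  by (auto simp: ball_integral_def intro!: nn_integral_mono mult_right_mono)

lemma ball_integral_add:
  assumes [measurable]: "f \<in> borel_measurable borel" "g \<in> borel_measurable borel"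
  shows "ball_integral t (\<lambda>y. f y + g y) x = ball_integral t f x + ball_integral t g x"
  by (simp add: ball_integral_def distrib_right nn_integral_add)

lemma ball_integral_cmult:
  assumes [measurable]: "f \<in> borel_measurable borel"
  shows "ball_integral t (\<lambda>y. c * f y) x = c * ball_integral t f x"
  by (simp add: ball_integral_def mult.assoc nn_integral_cmult)

lemma ball_integral_const:
  "ball_integral t (\<lambda>y. c) (x::'a::euclidean_space) = c * ennreal (measure lborel (cball (0::'a) 1))"
proof -
  have "emeasure lborel (cball (0::'a) 1) = ennreal (measure lborel (cball (0::'a) 1))"
    using emeasure_lborel_cball_finite[of "0::'a" 1] by (intro emeasure_eq_ennreal_measure) auto
  then show ?thesis by (simp add: ball_integral_def nn_integral_cmult_indicator)
qed

text \<open>Tonelli and translation invariance. The value does not depend on t; it serves as the L^1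
  endpoint of the potential estimate.\<close>

lemma nn_integral_ball_integral:
  assumes [measurable]: "(g :: 'a::euclidean_space \<Rightarrow> ennreal) \<in> borel_measurable borel"
  shows "(\<integral>\<^sup>+x. ball_integral t g x \<partial>lborel) = ennreal (measure lborel (cball (0::'a) 1)) * (\<integral>\<^sup>+x. g x \<partial>lborel)"
proof -
  have "(\<integral>\<^sup>+x. ball_integral t g x \<partial>lborel) = (\<integral>\<^sup>+y. (\<integral>\<^sup>+x. g (x + t *\<^sub>R y) * indicator (cball 0 1) y \<partial>lborel) \<partial>lborel)"
    unfolding ball_integral_def by (rule lborel_pair.Fubini') measurable
  also have "\<dots> = (\<integral>\<^sup>+y. (\<integral>\<^sup>+x. g x \<partial>lborel) * indicator (cball (0::'a) 1) y \<partial>lborel)"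
    by (simp add: nn_integral_multc nn_integral_lborel_translate)
  also have "\<dots> = ball_integral 0 (\<lambda>_. \<integral>\<^sup>+x. g x \<partial>lborel) (0::'a)"
    by (simp add: ball_integral_def)
  finally show ?thesis by (simp only: ball_integral_const mult.commute)
qed

text \<open>In place of Hoelder's inequality, g is compared with a level l: where g > l one has
  \<open>g \<le> l powr (1 - p) * g powr p\<close>. The level \<open>t powr - (n / p)\<close>
  balances the two contributions after integration over the ball.\<close>

lemma ball_integral_le:
  fixes g :: "'a::euclidean_space \<Rightarrow> ennreal"
  assumes [measurable]: "g \<in> borel_measurable borel" and "1 < p" "0 < t" and le: "(\<integral>\<^sup>+x. enn_rpow (g x) p \<partial>lborel) \<le> 1"
  shows "ball_integral t g x \<le> ennreal ((measure lborel (cball (0::'a) 1) + 1) * t powr - (DIM('a) / p))"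
proof -
  define l where "l = t powr - (DIM('a) / p)"
  have l: "0 < l" using assms by (simp add: l_def)
  have pt: "g z \<le> ennreal l + ennreal (l powr (1 - p)) * enn_rpow (g z) p" for z
  proof (cases "g z")
    case (real r)
    show ?thesis
    proof (cases "r \<le> l")
      case False
      have "r = r powr (1 - p) * r powr p" using False l by (simp add: powr_add[symmetric])
      also have "\<dots> \<le> l powr (1 - p) * r powr p"
        using False l assms by (intro mult_right_mono powr_mono2') auto
      finally have "r \<le> l + l powr (1 - p) * r powr p" using l by simp
      then show ?thesis using real l by (simp add: enn_rpow_ennreal ennreal_mult[symmetric] ennreal_plus[symmetric] del: ennreal_plus)
    qed (use real in \<open>auto intro: order_trans[OF ennreal_leI]\<close>)
  qed (use l in \<open>simp add: ennreal_mult_top\<close>)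
  have "ball_integral t g x \<le> ball_integral t (\<lambda>z. ennreal l + ennreal (l powr (1 - p)) * enn_rpow (g z) p) x"
    by (intro ball_integral_mono pt)
  also have "\<dots> = ennreal l * measure lborel (cball (0::'a) 1) + ennreal (l powr (1 - p)) * ball_integral t (\<lambda>z. enn_rpow (g z) p) x"
    by (simp add: ball_integral_add ball_integral_cmult ball_integral_const)
  also have "ball_integral t (\<lambda>z. enn_rpow (g z) p) x \<le> (\<integral>\<^sup>+y. enn_rpow (g (x + t *\<^sub>R y)) p \<partial>lborel)"
    unfolding ball_integral_def by (intro nn_integral_mono) (auto simp: indicator_def)
  also have "\<dots> = ennreal (t powr - real DIM('a)) * (\<integral>\<^sup>+y. enn_rpow (g y) p \<partial>lborel)"
    using assms by (intro nn_integral_lborel_dilate) auto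
  also have "\<dots> \<le> ennreal (t powr - real DIM('a)) * 1"
    by (intro mult_left_mono le) auto
  finally have "ball_integral t g x \<le> ennreal l * measure lborel (cball (0::'a) 1) + ennreal (l powr (1 - p)) * (ennreal (t powr - real DIM('a)) * 1)"
    by (simp add: add_left_mono mult_left_mono)
  also have "\<dots> = ennreal (l * measure lborel (cball (0::'a) 1) + l powr (1 - p) * t powr - real DIM('a))"
    using l by (simp add: ennreal_mult[symmetric] ennreal_plus[symmetric] del: ennreal_plus)
  also have "l powr (1 - p) * t powr - real DIM('a) = l"
  proof -
    have "- (DIM('a) / p) * (1 - p) + - real DIM('a) = - (DIM('a) / p)" using assms by (simp add: field_simps)
    then show ?thesis by (simp add: l_def powr_powr powr_add[symmetric])
  qed
  finally show ?thesis by (simp add: l_def algebra_simps)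
qed

text \<open>For 0 < \<sigma> < n this is a Riesz potential of order \<sigma> cut off at distance 1:
  interchanging the integrals produces a kernel comparable to
  \<open>norm z powr (\<sigma> - n)\<close> near 0. The radial form avoids the singular kernel and
  matches the cone averages, which also arise as integrals over t and y.\<close>

definition frac_integral :: "real \<Rightarrow> ('a::euclidean_space \<Rightarrow> ennreal) \<Rightarrow> 'a \<Rightarrow> ennreal" where
  "frac_integral \<sigma> g x = (\<integral>\<^sup>+t. ennreal (t powr (\<sigma> - 1)) * ball_integral t g x * indicator {0<..<1} t \<partial>lborel)"

lemma frac_integral_measurable [measurable (raw)]:
  assumes [measurable]: "g \<in> borel_measurable borel" "v \<in> borel_measurable M"
  shows "(\<lambda>x. frac_integral \<sigma> g (v x)) \<in> borel_measurable M"
  unfolding frac_integral_def by measurable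

lemma frac_integral_cmult:
  assumes [measurable]: "g \<in> borel_measurable borel"
  shows "frac_integral \<sigma> (\<lambda>y. c * g y) x = c * frac_integral \<sigma> g x"
proof -
  have "frac_integral \<sigma> (\<lambda>y. c * g y) x = (\<integral>\<^sup>+t. c * (ennreal (t powr (\<sigma> - 1)) * ball_integral t g x * indicator {0<..<1} t) \<partial>lborel)"
    unfolding frac_integral_def by (intro nn_integral_cong) (simp add: ball_integral_cmult mult_ac)
  then show ?thesis by (simp add: nn_integral_cmult frac_integral_def)
qed

text \<open>At level \<open>\<tau>\<close> the integral is cut at radius \<open>R = \<tau> powr (- q/n)\<close>, where the tail is controlled by
  the \<open>L\<^sup>p\<close> norm, and \<open>g\<close> at height \<open>s = \<tau> powr (q/p)\<close>. Both discarded parts are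
  \<open>O(\<tau>)\<close> in the supremum norm.\<close>
lemma frac_integral_le_truncated:
  fixes g :: "'a::euclidean_space \<Rightarrow> ennreal"
  assumes [measurable]: "g \<in> borel_measurable borel"
    and "1 < p" "0 < \<sigma>" "0 < q" and q: "DIM('a) / q = DIM('a) / p - \<sigma>" and "0 < \<tau>"
    and le: "(\<integral>\<^sup>+x. enn_rpow (g x) p \<partial>lborel) \<le> 1"
  defines "B \<equiv> measure lborel (cball (0::'a) 1)" and "R \<equiv> \<tau> powr - (q / DIM('a))"
  shows "frac_integral \<sigma> g x \<le> ennreal (((B + 1) / (DIM('a) / q) + B / \<sigma>) * \<tau>)
     + (\<integral>\<^sup>+t. ennreal (t powr (\<sigma> - 1)) * ball_integral t (\<lambda>y. g y * indicator {u. ennreal (\<tau> powr (q / p)) < u} (g y)) x * indicator {0<..<R} t \<partial>lborel)"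
    (is "_ \<le> _ + (\<integral>\<^sup>+t. ?h t \<partial>lborel)")
proof -
  define s where "s = \<tau> powr (q / p)"
  define e where "e = DIM('a) / q"
  define u where "u = (\<lambda>y. g y * indicator {u. ennreal s < u} (g y))"
  have [measurable]: "u \<in> borel_measurable borel" unfolding u_def by measurable
  have R: "0 < R" using \<open>0 < \<tau>\<close> by (simp add: R_def)
  have e: "0 < e" using \<open>0 < q\<close> by (simp add: e_def)
  have B: "0 \<le> B" by (simp add: B_def)
  have s: "0 \<le> s" by (simp add: s_def)
  \<comment> \<open>The identities that determine R and s: up to constants, the tail beyond R
    integrates to \<open>R powr - e / e\<close> and the bounded part of g to
    \<open>s * R powr \<sigma> / \<sigma>\<close>, and both have to be multiples of \<tau>.\<close>
  have "- (q / DIM('a)) * - e = 1" using \<open>0 < q\<close> by (simp add: e_def)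
  then have Re: "R powr - e = \<tau>" using \<open>0 < \<tau>\<close> by (simp only: R_def powr_powr powr_one)
  have "\<sigma> * q = q * DIM('a) / p - DIM('a)"
    using q \<open>0 < q\<close> \<open>1 < p\<close> by (simp add: field_simps)
  then have "q / p + - (q / DIM('a)) * \<sigma> = 1" using \<open>1 < p\<close> by (simp add: field_simps)
  then have Rs: "s * R powr \<sigma> = \<tau>"
    using assms(3-) by (simp add: R_def s_def powr_powr powr_add[symmetric])
  have pt: "ennreal (t powr (\<sigma> - 1)) * ball_integral t g x * indicator {0<..<1} t
     \<le> ennreal (B + 1) * (ennreal (t powr (- e - 1)) * indicator {R..} t)
       + ennreal (B * s) * (ennreal (t powr (\<sigma> - 1)) * indicator {0<..<R} t) + ?h t" for t
  proof (cases "0 < t")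
    case True
    show ?thesis
    proof (cases "R \<le> t")
      case R: True
      have "ball_integral t g x \<le> ennreal ((B + 1) * t powr - (DIM('a) / p))"
        unfolding B_def using assms True by (intro ball_integral_le) auto
      then have "ennreal (t powr (\<sigma> - 1)) * ball_integral t g x \<le> ennreal (t powr (\<sigma> - 1)) * ennreal ((B + 1) * t powr - (DIM('a) / p))"
        by (intro mult_left_mono) auto
      also have "\<dots> = ennreal (B + 1) * ennreal (t powr (- e - 1))"
      proof -
        have ex: "\<sigma> - 1 + - (DIM('a) / p) = - e - 1" using q by (simp add: e_def)
        have "t powr (\<sigma> - 1) * ((B + 1) * t powr - (DIM('a) / p)) = (B + 1) * t powr (- e - 1)"
          unfolding ex[symmetric] powr_add by simp
        then show ?thesis using B by (simp add: ennreal_mult[symmetric] del: ennreal_plus)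
      qed
      finally show ?thesis using R \<open>0 < R\<close> by (auto simp: indicator_def)
    next
      case False
      have "g y \<le> ennreal s + u y" for y by (auto simp: u_def indicator_def)
      then have "ball_integral t g x \<le> ball_integral t (\<lambda>y. ennreal s + u y) x"
        by (rule ball_integral_mono)
      also have "\<dots> = ennreal (B * s) + ball_integral t u x"
        using B s by (simp add: ball_integral_add ball_integral_const B_def ennreal_mult[symmetric] mult.commute)
      finally have "ennreal (t powr (\<sigma> - 1)) * ball_integral t g x \<le> ennreal (t powr (\<sigma> - 1)) * (ennreal (B * s) + ball_integral t u x)"
        by (intro mult_left_mono) auto
      then show ?thesis using False True by (auto simp: indicator_def u_def s_def distrib_left mult_ac)
    qed
  qed (auto simp: indicator_def)
  have "frac_integral \<sigma> g x \<le> (\<integral>\<^sup>+t. ennreal (B + 1) * (ennreal (t powr (- e - 1)) * indicator {R..} t)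
       + ennreal (B * s) * (ennreal (t powr (\<sigma> - 1)) * indicator {0<..<R} t) + ?h t \<partial>lborel)"
    unfolding frac_integral_def by (intro nn_integral_mono pt)
  also have "\<dots> = ennreal (B + 1) * (\<integral>\<^sup>+t. ennreal (t powr (- e - 1)) * indicator {R..} t \<partial>lborel)
       + ennreal (B * s) * (\<integral>\<^sup>+t. ennreal (t powr (\<sigma> - 1)) * indicator {0<..<R} t \<partial>lborel) + (\<integral>\<^sup>+t. ?h t \<partial>lborel)"
    by (subst nn_integral_add; (subst nn_integral_add)?) (auto simp: nn_integral_cmult)
  also have "(\<integral>\<^sup>+t. ennreal (t powr (- e - 1)) * indicator {R..} t \<partial>lborel) = ennreal (\<tau> / e)"
    using e R Re by (subst nn_integral_powr_atLeast) auto
  also have "(\<integral>\<^sup>+t. ennreal (t powr (\<sigma> - 1)) * indicator {0<..<R} t \<partial>lborel) = ennreal (R powr \<sigma> / \<sigma>)"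
    using R \<open>0 < \<sigma>\<close> by (subst nn_integral_powr_lessThan) auto
  also have "ennreal (B * s) * ennreal (R powr \<sigma> / \<sigma>) = ennreal (B / \<sigma> * \<tau>)"
    using B s Rs \<open>0 < \<sigma>\<close> by (simp add: ennreal_mult[symmetric] mult.assoc)
  also have "ennreal (B + 1) * ennreal (\<tau> / e) + ennreal (B / \<sigma> * \<tau>) = ennreal (((B + 1) / e + B / \<sigma>) * \<tau>)"
    using B s e \<open>0 < \<sigma>\<close> \<open>0 < \<tau>\<close> by (simp add: ennreal_mult[symmetric] ennreal_plus[symmetric] algebra_simps add_divide_distrib del: ennreal_plus)
  finally show ?thesis by (simp add: e_def)
qed

text \<open>An argument of Marcinkiewicz type. Where the potential exceeds M \<tau>, the parts
  discarded at level \<tau> cannot account for it, so the remaining part is at least \<tau>, and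
  Chebyshev's inequality bounds the level set by an L^1 norm. Integrating over \<tau> against
  \<open>\<tau> powr (q - 1)\<close> and interchanging the integrals leaves g times a power of g,
  with total exponent p.\<close>

lemma frac_integral_bounded_unit:
  fixes p q \<sigma> :: real
  assumes "1 < p" "0 < \<sigma>" "0 < q" and q: "DIM('a::euclidean_space) / q = DIM('a) / p - \<sigma>"
  shows "\<exists>C\<ge>0. \<forall>g :: 'a \<Rightarrow> ennreal. g \<in> borel_measurable borel \<longrightarrow> (\<integral>\<^sup>+x. enn_rpow (g x) p \<partial>lborel) \<le> 1 \<longrightarrow>
    (\<integral>\<^sup>+x. enn_rpow (frac_integral \<sigma> g x) q \<partial>lborel) \<le> ennreal C"
proof -
  define B where "B = measure lborel (cball (0::'a) 1)"
  define K where "K = (B + 1) / (DIM('a) / q) + B / \<sigma>"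
  define M where "M = K + 1"
  define e where "e = q - q / p"
  define R where "R \<tau> = \<tau> powr - (q / DIM('a))" for \<tau>
  define s where "s \<tau> = \<tau> powr (q / p)" for \<tau>
  have [measurable]: "R \<in> borel_measurable borel" "s \<in> borel_measurable borel"
    unfolding R_def s_def by measurable
  have B: "0 \<le> B" by (simp add: B_def)
  have K: "0 \<le> K" unfolding K_def using B \<open>0 < \<sigma>\<close> \<open>0 < q\<close> by (intro add_nonneg_nonneg divide_nonneg_nonneg) auto
  have M: "0 < M" using K by (simp add: M_def)
  have e: "0 < e" using assms by (simp add: e_def field_simps)
  have "\<sigma> * q = q * DIM('a) / p - DIM('a)"
    using q \<open>0 < q\<close> \<open>1 < p\<close> by (simp add: field_simps)
  then have ex: "- 1 + - (q / DIM('a)) * \<sigma> = - (q / p)" using \<open>1 < p\<close> by (simp add: field_simps)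
  define C where "C = M powr q * (q * (B / \<sigma>) / e)"
  have "(\<integral>\<^sup>+x. enn_rpow (frac_integral \<sigma> g x) q \<partial>lborel) \<le> ennreal C"
    if [measurable]: "g \<in> borel_measurable borel" and le: "(\<integral>\<^sup>+x. enn_rpow (g x) p \<partial>lborel) \<le> 1" for g :: "'a \<Rightarrow> ennreal"
  proof -
    define u where "u \<tau> = (\<lambda>y. g y * indicator {u. ennreal (s \<tau>) < u} (g y))" for \<tau>
    have [measurable]: "u \<tau> \<in> borel_measurable borel" for \<tau> unfolding u_def by measurable
    define h where "h \<tau> x = (\<integral>\<^sup>+t. ennreal (t powr (\<sigma> - 1)) * ball_integral t (u \<tau>) x * indicator {0<..<R \<tau>} t \<partial>lborel)" for \<tau> x
    \<comment> \<open>Tonelli needs joint measurability in \<tau> and x; written as conditionals,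
      the indicators expose their dependence on \<tau> to the measurability prover.\<close>
    have ind: "indicator {0<..<R \<tau>} t = (if 0 < t \<and> t < R \<tau> then 1 else 0 :: ennreal)"
      "indicator {u. ennreal (s \<tau>) < u} v = (if ennreal (s \<tau>) < v then 1 else 0 :: ennreal)" for \<tau> t v
      by (auto simp: indicator_def)
    have hm: "(\<lambda>z. h (fst z) (snd z)) \<in> borel_measurable (borel \<Otimes>\<^sub>M borel)"
      unfolding h_def u_def ball_integral_def ind by measurable
    have [measurable (raw)]: "(\<lambda>z. h (v z) (w z)) \<in> borel_measurable M"
      if "v \<in> borel_measurable M" "w \<in> borel_measurable M" for v w and M :: "'c measure"
      using measurable_compose[OF measurable_Pair[OF that] hm] by simp
    define X where "X x = frac_integral \<sigma> g x * ennreal (1 / M)" for x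
    have [measurable]: "X \<in> borel_measurable borel" unfolding X_def by measurable
    have FX: "frac_integral \<sigma> g x = ennreal M * X x" for x
    proof -
      have "ennreal M * X x = (ennreal M * ennreal (1 / M)) * frac_integral \<sigma> g x"
        by (simp only: X_def mult_ac)
      then show ?thesis using M by (simp add: ennreal_mult[symmetric])
    qed
    \<comment> \<open>Chebyshev's inequality in pointwise form: on the level set the right side is
      at least 1.\<close>
    have level: "indicator {\<tau>. 0 < \<tau> \<and> ennreal \<tau> < X x} \<tau> \<le> ennreal (1 / \<tau>) * h \<tau> x * indicator {0<..} \<tau>" for x \<tau>
    proof (cases "0 < \<tau> \<and> ennreal \<tau> < X x")
      case True
      then have "ennreal (M * \<tau>) \<le> frac_integral \<sigma> g x"
        unfolding FX using M by (auto simp: ennreal_mult intro!: mult_left_mono)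
      also have "\<dots> \<le> ennreal (K * \<tau>) + h \<tau> x"
        unfolding K_def B_def h_def u_def s_def R_def
        using frac_integral_le_truncated[of g p \<sigma> q \<tau> x] assms le True by simp
      finally have "ennreal (K * \<tau>) + ennreal \<tau> \<le> ennreal (K * \<tau>) + h \<tau> x"
        using True K by (simp add: M_def ennreal_plus[symmetric] algebra_simps del: ennreal_plus)
      then have "ennreal \<tau> \<le> h \<tau> x" by (simp add: ennreal_add_left_cancel_le)
      then have "ennreal (1 / \<tau>) * ennreal \<tau> \<le> ennreal (1 / \<tau>) * h \<tau> x" by (intro mult_left_mono) auto
      then show ?thesis using True by (simp add: ennreal_mult[symmetric] indicator_def)
    qed (auto simp: indicator_def)
    have int_h: "(\<integral>\<^sup>+x. h \<tau> x \<partial>lborel) = ennreal (B / \<sigma> * R \<tau> powr \<sigma>) * (\<integral>\<^sup>+y. u \<tau> y \<partial>lborel)" if "0 < \<tau>" for \<tau>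
    proof -
      have "(\<integral>\<^sup>+x. h \<tau> x \<partial>lborel) = (\<integral>\<^sup>+t. (\<integral>\<^sup>+x. ennreal (t powr (\<sigma> - 1)) * ball_integral t (u \<tau>) x * indicator {0<..<R \<tau>} t \<partial>lborel) \<partial>lborel)"
        unfolding h_def by (rule lborel_pair.Fubini') measurable
      also have "\<dots> = (\<integral>\<^sup>+t. (ennreal (t powr (\<sigma> - 1)) * indicator {0<..<R \<tau>} t) * (ennreal B * (\<integral>\<^sup>+y. u \<tau> y \<partial>lborel)) \<partial>lborel)"
        by (simp add: nn_integral_cmult nn_integral_multc nn_integral_ball_integral B_def mult_ac)
      also have "\<dots> = ennreal (R \<tau> powr \<sigma> / \<sigma>) * (ennreal B * (\<integral>\<^sup>+y. u \<tau> y \<partial>lborel))"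
        using \<open>0 < \<sigma>\<close> nn_integral_powr_lessThan[of "\<sigma> - 1" "R \<tau>"] by (subst nn_integral_multc) (auto simp: R_def)
      also have "\<dots> = ennreal (B / \<sigma> * R \<tau> powr \<sigma>) * (\<integral>\<^sup>+y. u \<tau> y \<partial>lborel)"
        using B \<open>0 < \<sigma>\<close> by (simp add: mult.assoc[symmetric] ennreal_mult[symmetric] mult_ac)
      finally show ?thesis .
    qed
    have rpowX: "enn_rpow (X x) q = ennreal q * (\<integral>\<^sup>+\<tau>. ennreal (\<tau> powr (q - 1)) * indicator {\<tau>. 0 < \<tau> \<and> ennreal \<tau> < X x} \<tau> \<partial>lborel)" for x
      using \<open>0 < q\<close> by (subst nn_integral_layer_cake)
        (auto simp: ennreal_times_divide mult_divide_eq_ennreal mult.commute[of "ennreal q"])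
    let ?H = "\<lambda>\<tau> x. ennreal (\<tau> powr (q - 1)) * (ennreal (1 / \<tau>) * h \<tau> x * indicator {0<..} \<tau>)"
    let ?Y = "\<lambda>\<tau> y. g y * (ennreal (\<tau> powr (e - 1)) * indicator {\<tau>. 0 < \<tau> \<and> ennreal \<tau> < enn_rpow (g y) (p / q)} \<tau>)"
    have "(\<integral>\<^sup>+x. enn_rpow (X x) q \<partial>lborel)
      \<le> (\<integral>\<^sup>+x. ennreal q * (\<integral>\<^sup>+\<tau>. ?H \<tau> x \<partial>lborel) \<partial>lborel)"
      unfolding rpowX by (intro nn_integral_mono mult_left_mono level) auto
    also have "\<dots> = ennreal q * (\<integral>\<^sup>+x. (\<integral>\<^sup>+\<tau>. ?H \<tau> x \<partial>lborel) \<partial>lborel)"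
      by (rule nn_integral_cmult) measurable
    also have "(\<integral>\<^sup>+x. (\<integral>\<^sup>+\<tau>. ?H \<tau> x \<partial>lborel) \<partial>lborel)
      = (\<integral>\<^sup>+\<tau>. (\<integral>\<^sup>+x. ?H \<tau> x \<partial>lborel) \<partial>lborel)"
      by (rule lborel_pair.Fubini') measurable
    also have "(\<integral>\<^sup>+\<tau>. (\<integral>\<^sup>+x. ?H \<tau> x \<partial>lborel) \<partial>lborel)
      = (\<integral>\<^sup>+\<tau>. ennreal (B / \<sigma>) * (\<integral>\<^sup>+y. ?Y \<tau> y \<partial>lborel) \<partial>lborel)"
    proof (rule nn_integral_cong)
      fix \<tau> :: real
      show "(\<integral>\<^sup>+x. ?H \<tau> x \<partial>lborel)
       = ennreal (B / \<sigma>) * (\<integral>\<^sup>+y. ?Y \<tau> y \<partial>lborel)"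
      proof (cases "0 < \<tau>")
        case True
        \<comment> \<open>The truncation height \<open>\<tau> powr (q / p)\<close> is inverted into
          a condition on \<tau>, so that the later integral over \<tau> is a layer cake formula for
          \<open>g powr (p / q)\<close>.\<close>
        have iff: "ennreal \<tau> < enn_rpow (g y) (p / q) \<longleftrightarrow> ennreal (s \<tau>) < g y" for y
        proof -
          have pq: "0 < p / q" "0 < q / p" using assms by auto
          have "s \<tau> powr (p / q) = \<tau>" using True assms by (simp add: s_def powr_powr)
          then have 1: "enn_rpow (ennreal (s \<tau>)) (p / q) = ennreal \<tau>" by (subst enn_rpow_ennreal) (auto simp: s_def)
          have 2: "enn_rpow (enn_rpow z (p / q)) (q / p) = z" for z
            using pq assms by (simp add: enn_rpow_rpow enn_rpow_one)
          show ?thesis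
            using enn_rpow_mono[OF pq(1)] enn_rpow_mono[OF pq(2)] 1 2 by (metis linorder_not_le)
        qed
        \<comment> \<open>The exponent collects q - 1 from the layer cake formula, -1 from
          Chebyshev's inequality and 1 - q / p from R; their sum is e - 1.\<close>
        have powers: "\<tau> powr (q - 1) * (1 / \<tau>) * R \<tau> powr \<sigma> = \<tau> powr (e - 1)"
        proof -
          have 1: "1 / \<tau> = \<tau> powr - 1" using True by (simp add: powr_minus_divide)
          have "- (q / DIM('a)) * \<sigma> = 1 - q / p" using ex by linarith
          then have 2: "R \<tau> powr \<sigma> = \<tau> powr (1 - q / p)" by (simp only: R_def powr_powr)
          have "e - 1 = q - 1 + - 1 + (1 - q / p)" by (simp add: e_def)
          then show ?thesis unfolding 1 2 by (simp only: powr_add)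
        qed
        have "(\<integral>\<^sup>+x. ?H \<tau> x \<partial>lborel)
          = ennreal (\<tau> powr (q - 1)) * (ennreal (1 / \<tau>) * (ennreal (B / \<sigma> * R \<tau> powr \<sigma>) * (\<integral>\<^sup>+y. u \<tau> y \<partial>lborel)))"
          using True by (simp add: nn_integral_cmult int_h)
        also have "\<dots> = ennreal (B / \<sigma>) * (ennreal (\<tau> powr (e - 1)) * (\<integral>\<^sup>+y. u \<tau> y \<partial>lborel))"
        proof -
          have "\<tau> powr (q - 1) * (1 / \<tau> * (B / \<sigma> * R \<tau> powr \<sigma>)) = B / \<sigma> * \<tau> powr (e - 1)"
            by (simp only: powers[symmetric] mult_ac)
          then have "ennreal (\<tau> powr (q - 1)) * (ennreal (1 / \<tau>) * ennreal (B / \<sigma> * R \<tau> powr \<sigma>)) = ennreal (B / \<sigma>) * ennreal (\<tau> powr (e - 1))"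
            using True B \<open>0 < \<sigma>\<close> by (simp only: ennreal_mult[symmetric] powr_ge_zero mult_nonneg_nonneg divide_nonneg_pos less_imp_le zero_le_one)
          then show ?thesis by (metis mult.assoc)
        qed
        also have "ennreal (\<tau> powr (e - 1)) * (\<integral>\<^sup>+y. u \<tau> y \<partial>lborel) = (\<integral>\<^sup>+y. ennreal (\<tau> powr (e - 1)) * u \<tau> y \<partial>lborel)"
          by (simp add: nn_integral_cmult)
        also have "\<dots> = (\<integral>\<^sup>+y. ?Y \<tau> y \<partial>lborel)"
          using True iff by (intro nn_integral_cong) (auto simp: u_def indicator_def mult_ac)
        finally show ?thesis .
      qed simp
    qed
    also have "\<dots> = ennreal (B / \<sigma>) * (\<integral>\<^sup>+\<tau>. (\<integral>\<^sup>+y. ?Y \<tau> y \<partial>lborel) \<partial>lborel)"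
      by (rule nn_integral_cmult) measurable
    also have "(\<integral>\<^sup>+\<tau>. (\<integral>\<^sup>+y. ?Y \<tau> y \<partial>lborel) \<partial>lborel)
      = (\<integral>\<^sup>+y. (\<integral>\<^sup>+\<tau>. ?Y \<tau> y \<partial>lborel) \<partial>lborel)"
      by (rule lborel_pair.Fubini') measurable
    also have "\<dots> = (\<integral>\<^sup>+y. enn_rpow (g y) p / ennreal e \<partial>lborel)"
    proof (rule nn_integral_cong)
      fix y
      have "p / q * e = p - 1" using assms by (simp add: e_def field_simps)
      then have "enn_rpow (enn_rpow (g y) (p / q)) e = enn_rpow (g y) (p - 1)"
        using assms e by (subst enn_rpow_rpow) auto
      moreover have "g y * enn_rpow (g y) (p - 1) = enn_rpow (g y) p"
        using assms by (cases "g y") (auto simp: enn_rpow_ennreal ennreal_mult[symmetric] powr_mult_base)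
      ultimately show "(\<integral>\<^sup>+\<tau>. ?Y \<tau> y \<partial>lborel) = enn_rpow (g y) p / ennreal e"
        using e by (subst nn_integral_cmult) (auto simp: nn_integral_layer_cake ennreal_times_divide)
    qed
    also have "\<dots> = (\<integral>\<^sup>+y. enn_rpow (g y) p \<partial>lborel) / ennreal e"
      by (simp add: nn_integral_divide)
    also have "\<dots> \<le> 1 / ennreal e" using le by (rule divide_right_mono_ennreal)
    finally have "(\<integral>\<^sup>+x. enn_rpow (X x) q \<partial>lborel) \<le> ennreal q * (ennreal (B / \<sigma>) * (1 / ennreal e))"
      by (simp add: mult_left_mono)
    then have "ennreal (M powr q) * (\<integral>\<^sup>+x. enn_rpow (X x) q \<partial>lborel) \<le> ennreal (M powr q) * (ennreal q * (ennreal (B / \<sigma>) * (1 / ennreal e)))"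
      by (intro mult_left_mono) auto
    also have "\<dots> = ennreal C"
    proof -
      have "1 / ennreal e = ennreal (1 / e)" using divide_ennreal[of 1 e] e by simp
      moreover have "ennreal C = ennreal (M powr q) * ennreal (q * (B / \<sigma> * (1 / e)))"
        using M e B assms by (subst ennreal_mult[symmetric]) (auto simp: C_def)
      moreover have "\<dots> = ennreal (M powr q) * (ennreal q * (ennreal (B / \<sigma>) * ennreal (1 / e)))"
        using ennreal_mult[of q "B / \<sigma> * (1 / e)"] ennreal_mult[of "B / \<sigma>" "1 / e"] e B assms by simp
      ultimately show ?thesis by simp
    qed
    finally show ?thesis
      using M \<open>0 < q\<close> by (simp add: FX enn_rpow_mult enn_rpow_ennreal nn_integral_cmult)
  qed
  moreover have "0 \<le> C" using M e B assms by (simp add: C_def)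
  ultimately show ?thesis by blast
qed

text \<open>Both sides are homogeneous of degree 1 in g, so the normalised case suffices. If the
  norm of g vanishes, every multiple of g is admissible in the normalised case, and the left side
  has to vanish too.\<close>

lemma frac_integral_bounded:
  fixes p q \<sigma> :: real
  assumes "1 < p" "0 < \<sigma>" "0 < q" and q: "DIM('a::euclidean_space) / q = DIM('a) / p - \<sigma>"
  shows "\<exists>C\<ge>0. \<forall>g :: 'a \<Rightarrow> ennreal. g \<in> borel_measurable borel \<longrightarrow>
    enn_rpow (\<integral>\<^sup>+x. enn_rpow (frac_integral \<sigma> g x) q \<partial>lborel) (1 / q) \<le> ennreal C * enn_rpow (\<integral>\<^sup>+x. enn_rpow (g x) p \<partial>lborel) (1 / p)"
proof -
  from frac_integral_bounded_unit[OF assms] obtain C where C: "0 \<le> C" and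
    unit: "\<And>g :: 'a \<Rightarrow> ennreal. g \<in> borel_measurable borel \<Longrightarrow> (\<integral>\<^sup>+x. enn_rpow (g x) p \<partial>lborel) \<le> 1 \<Longrightarrow>
    (\<integral>\<^sup>+x. enn_rpow (frac_integral \<sigma> g x) q \<partial>lborel) \<le> ennreal C" by blast
  \<comment> \<open>The summand 1 makes D positive, so that the right side is infinite whenever the
    norm of g is.\<close>
  define D where "D = C powr (1 / q) + 1"
  have D: "0 < D" "ennreal (C powr (1 / q)) \<le> ennreal D" by (auto simp: D_def add_nonneg_pos)
  have scaled: "ennreal c * enn_rpow (\<integral>\<^sup>+x. enn_rpow (frac_integral \<sigma> g x) q \<partial>lborel) (1 / q) \<le> ennreal D"
    if g: "g \<in> borel_measurable borel" and c: "0 \<le> c" "ennreal c * enn_rpow (\<integral>\<^sup>+x. enn_rpow (g x) p \<partial>lborel) (1 / p) \<le> 1" for c and g :: "'a \<Rightarrow> ennreal"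
  proof -
    note [measurable] = g
    have "enn_rpow (ennreal c * enn_rpow (\<integral>\<^sup>+x. enn_rpow (g x) p \<partial>lborel) (1 / p)) p \<le> enn_rpow 1 p"
      using assms by (intro enn_rpow_mono c) auto
    then have "(\<integral>\<^sup>+x. enn_rpow (ennreal c * g x) p \<partial>lborel) \<le> 1"
      using assms enn_rpow_ennreal[of 1 p] by (simp add: enn_rpow_mult enn_rpow_cancel nn_integral_cmult)
    then have "(\<integral>\<^sup>+x. enn_rpow (frac_integral \<sigma> (\<lambda>x. ennreal c * g x) x) q \<partial>lborel) \<le> ennreal C"
      by (intro unit) auto
    then have "enn_rpow (\<integral>\<^sup>+x. enn_rpow (frac_integral \<sigma> (\<lambda>x. ennreal c * g x) x) q \<partial>lborel) (1 / q) \<le> enn_rpow (ennreal C) (1 / q)"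
      using assms by (intro enn_rpow_mono) auto
    also have "\<dots> \<le> ennreal D" using C D by (simp add: enn_rpow_ennreal)
    finally show ?thesis
      using assms by (simp add: frac_integral_cmult enn_rpow_mult nn_integral_cmult enn_rpow_cancel)
  qed
  have "enn_rpow (\<integral>\<^sup>+x. enn_rpow (frac_integral \<sigma> g x) q \<partial>lborel) (1 / q) \<le> ennreal D * enn_rpow (\<integral>\<^sup>+x. enn_rpow (g x) p \<partial>lborel) (1 / p)" (is "?L \<le> _ * ?N")
    if g: "g \<in> borel_measurable borel" for g :: "'a \<Rightarrow> ennreal"
  proof (cases ?N)
    case (real N)
    show ?thesis
    proof (cases "N = 0")
      case True
      have nL: "of_nat n * ?L \<le> ennreal D" for n
        using scaled[OF g, of "real n"] real True by (simp add: ennreal_of_nat_eq_real_of_nat)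
      have "?L = 0"
      proof (cases ?L)
        case (real l)
        then have "real n * l \<le> D" for n
          using nL[of n] D
          by (simp add: ennreal_of_nat_eq_real_of_nat ennreal_mult[symmetric])
        then show ?thesis using real reals_Archimedean3[of l] by (metis ennreal_0 linorder_not_le order_le_less)
      next
        case top
        then show ?thesis using nL[of 1] by (simp add: top_unique)
      qed
      then show ?thesis by simp
    next
      case False
      then have "ennreal (1 / N) * ?L \<le> ennreal D"
        using real by (intro scaled[OF g]) (auto simp: ennreal_mult[symmetric] ennreal_1[symmetric] simp del: ennreal_1)
      then have "ennreal N * (ennreal (1 / N) * ?L) \<le> ennreal N * ennreal D" by (intro mult_left_mono) auto
      then show ?thesis using real False by (simp add: mult.assoc[symmetric] ennreal_mult[symmetric] mult.commute)
    qed
  qed (use D in \<open>simp add: ennreal_mult_top\<close>)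
  then show ?thesis using D by (intro exI[of _ D]) auto
qed

section \<open>Test functions\<close>

lemma pd_eqI: "(\<phi> has_derivative D) (at x) \<Longrightarrow> pd i \<phi> x = D (axis i 1)"
  by (simp add: pd_def frechet_derivative_at[symmetric])

lemma has_derivative_pd:
  fixes \<phi> :: "real^'n \<Rightarrow> real"
  assumes "\<phi> differentiable (at x)"
  shows "(\<phi> has_derivative (\<lambda>h. \<Sum>i\<in>UNIV. h $ i * pd i \<phi> x)) (at x)"
proof -
  have D: "(\<phi> has_derivative frechet_derivative \<phi> (at x)) (at x)"
    using assms frechet_derivative_works by blast
  interpret D: linear "frechet_derivative \<phi> (at x)"
    using D by (rule has_derivative_linear)
  have "frechet_derivative \<phi> (at x) h = (\<Sum>i\<in>UNIV. h $ i * pd i \<phi> x)" for h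
  proof -
    have "frechet_derivative \<phi> (at x) h = frechet_derivative \<phi> (at x) (\<Sum>i\<in>UNIV. (h $ i) *\<^sub>R axis i 1)"
      using basis_expansion[of h] by (simp add: scalar_mult_eq_scaleR)
    then show ?thesis by (simp add: D.sum D.scaleR pd_def)
  qed
  then show ?thesis using D by presburger
qed

lemma smooth_fun_differentiable: "smooth_fun \<phi> \<Longrightarrow> \<phi> differentiable (at x)"
  unfolding smooth_fun_def by (metis iter_pd.simps(1))

lemma iter_pd_append: "iter_pd (ds @ es) \<phi> = iter_pd ds (iter_pd es \<phi>)"
  by (induction ds) auto

lemma smooth_fun_pd: "smooth_fun \<phi> \<Longrightarrow> smooth_fun (pd i \<phi>)"
  using iter_pd_append[of _ "[i]" \<phi>] unfolding smooth_fun_def by (metis iter_pd.simps)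

lemma smooth_fun_continuous: "smooth_fun \<phi> \<Longrightarrow> continuous_on A \<phi>"
  by (meson continuous_at_imp_continuous_on differentiable_imp_continuous_within smooth_fun_differentiable)

lemma smooth_fun_borel_measurable [measurable_dest]: "smooth_fun \<phi> \<Longrightarrow> \<phi> \<in> borel_measurable borel"
  by (intro borel_measurable_continuous_onI smooth_fun_continuous)

lemma test_fun_smooth: "test_fun \<Omega> \<phi> \<Longrightarrow> smooth_fun \<phi>"
  by (simp add: test_fun_def)

lemma test_fun_mono: "test_fun \<Omega> \<phi> \<Longrightarrow> \<Omega> \<subseteq> \<Omega>' \<Longrightarrow> test_fun \<Omega>' \<phi>"
  by (auto simp: test_fun_def)

lemma test_fun_compact:
  assumes "smooth_fun \<phi>" "compact K" "\<And>x. \<phi> x \<noteq> 0 \<Longrightarrow> x \<in> K" "K \<subseteq> \<Omega>"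
  shows "test_fun \<Omega> \<phi>"
proof -
  have "closure {x. \<phi> x \<noteq> 0} \<subseteq> K"
    using assms by (intro closure_minimal compact_imp_closed) auto
  then show ?thesis
    using assms compact_closure[of "{x. \<phi> x \<noteq> 0}"] bounded_subset[OF compact_imp_bounded, of K "{x. \<phi> x \<noteq> 0}"]
    by (auto simp: test_fun_def)
qed

lemma test_fun_pd:
  assumes "test_fun \<Omega> \<phi>"
  shows "test_fun \<Omega> (pd i \<phi>)"
proof (rule test_fun_compact)
  show "compact (closure {x. \<phi> x \<noteq> 0})" "closure {x. \<phi> x \<noteq> 0} \<subseteq> \<Omega>" "smooth_fun (pd i \<phi>)"
    using assms by (auto simp: test_fun_def smooth_fun_pd)
  show "x \<in> closure {x. \<phi> x \<noteq> 0}" if "pd i \<phi> x \<noteq> 0" for x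
  proof (rule ccontr)
    assume x: "x \<notin> closure {x. \<phi> x \<noteq> 0}"
    have "(\<phi> has_derivative (\<lambda>_. 0)) (at x)"
      by (rule has_derivative_transform_within_open[of "\<lambda>_. 0" _ _ _ "- closure {x. \<phi> x \<noteq> 0}"])
        (use x closure_subset in \<open>auto simp: subset_eq\<close>)
    from pd_eqI[OF this] that show False by simp
  qed
qed

lemma test_fun_bounded:
  assumes "test_fun \<Omega> \<phi>"
  shows "\<exists>B\<ge>0. \<forall>x. \<bar>\<phi> x\<bar> \<le> B"
proof -
  have "compact (\<phi> ` closure {x. \<phi> x \<noteq> 0})"
    using assms by (intro compact_continuous_image smooth_fun_continuous) (auto simp: test_fun_def)
  then obtain B where "\<forall>y \<in> \<phi> ` closure {x. \<phi> x \<noteq> 0}. norm y \<le> B"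
    using compact_imp_bounded bounded_iff by blast
  then have "\<bar>\<phi> x\<bar> \<le> max B 0" for x
    using closure_subset by (cases "\<phi> x = 0") (force simp: le_max_iff_disj)+
  then show ?thesis by (intro exI[of _ "max B 0"]) auto
qed

lemma abs_sum_component_le:
  fixes h :: "real^'n"
  assumes "\<And>i. \<bar>a i\<bar> \<le> L"
  shows "\<bar>\<Sum>i\<in>UNIV. h $ i * a i\<bar> \<le> real CARD('n) * L * norm h"
proof -
  have "0 \<le> L" using assms[of undefined] by linarith
  then have "\<bar>h $ i * a i\<bar> \<le> norm h * L" for i
    unfolding abs_mult using assms component_le_norm_cart by (intro mult_mono) auto
  then have "\<bar>\<Sum>i\<in>UNIV. h $ i * a i\<bar> \<le> (\<Sum>i\<in>(UNIV :: 'n set). norm h * L)"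
    by (intro order_trans[OF sum_abs] sum_mono)
  then show ?thesis by (simp add: mult_ac)
qed

lemma test_fun_lipschitz:
  fixes \<phi> :: "real^'n \<Rightarrow> real"
  assumes "test_fun \<Omega> \<phi>"
  shows "\<exists>L\<ge>0. \<forall>x y. \<bar>\<phi> x - \<phi> y\<bar> \<le> L * norm (x - y)"
proof -
  have "\<forall>i. \<exists>B\<ge>0. \<forall>x. \<bar>pd i \<phi> x\<bar> \<le> B"
    using test_fun_bounded[OF test_fun_pd[OF assms]] by blast
  then obtain B where B: "\<And>i. 0 \<le> B i" "\<And>i x. \<bar>pd i \<phi> x\<bar> \<le> B i" by metis
  define L where "L = (\<Sum>i\<in>UNIV. B i)"
  have L: "\<bar>pd i \<phi> x\<bar> \<le> L" for i x
    using B member_le_sum[of i UNIV B] order_trans by (fastforce simp: L_def)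
  have "\<bar>\<phi> x - \<phi> y\<bar> \<le> (real CARD('n) * L) * norm (x - y)" for x y
    unfolding real_norm_def[symmetric]
    using has_derivative_pd[OF smooth_fun_differentiable[OF test_fun_smooth[OF assms]]]
      abs_sum_component_le[OF L]
    by (intro differentiable_bound[of UNIV \<phi> "\<lambda>x h. \<Sum>i\<in>UNIV. h $ i * pd i \<phi> x"] onorm_le) auto
  moreover have "0 \<le> L" using B by (auto simp: L_def intro: sum_nonneg)
  ultimately show ?thesis by (intro exI[of _ "real CARD('n) * L"]) auto
qed

text \<open>The first partial derivatives are Lipschitz because they are test functions themselves.
  What matters is a constant independent of x: the remainder can then be integrated in order to
  differentiate averages.\<close>

lemma test_fun_taylor:
  fixes \<phi> :: "real^'n \<Rightarrow> real"
  assumes "test_fun \<Omega> \<phi>"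
  shows "\<exists>L\<ge>0. \<forall>x h. \<bar>\<phi> (x + h) - \<phi> x - (\<Sum>i\<in>UNIV. h $ i * pd i \<phi> x)\<bar> \<le> L * norm h * norm h"
proof -
  have "\<forall>i. \<exists>L\<ge>0. \<forall>x y. \<bar>pd i \<phi> x - pd i \<phi> y\<bar> \<le> L * norm (x - y)"
    using test_fun_lipschitz[OF test_fun_pd[OF assms]] by blast
  then obtain B where B: "\<And>i. 0 \<le> B i" "\<And>i x y. \<bar>pd i \<phi> x - pd i \<phi> y\<bar> \<le> B i * norm (x - y)" by metis
  define L where "L = (\<Sum>i\<in>UNIV. B i)"
  have BL: "B i \<le> L" for i
    using B member_le_sum[of i UNIV B] by (auto simp: L_def)
  have L: "\<bar>pd i \<phi> x - pd i \<phi> y\<bar> \<le> L * norm (x - y)" for i x y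
    using B BL[of i] mult_right_mono order_trans by (metis norm_ge_zero)
  have L0: "0 \<le> L" using B by (auto simp: L_def intro: sum_nonneg)
  have "\<bar>\<phi> (x + h) - \<phi> x - (\<Sum>i\<in>UNIV. h $ i * pd i \<phi> x)\<bar> \<le> norm (x + h - x) * (real CARD('n) * (L * norm h))" for x h
    unfolding real_norm_def[symmetric]
  proof (rule order_trans[OF _ differentiable_bound_linearization[of x "x + h" "cball x (norm h)" \<phi> "\<lambda>x h. \<Sum>i\<in>UNIV. h $ i * pd i \<phi> x" x "real CARD('n) * (L * norm h)"]])
    show "x + t *\<^sub>R (x + h - x) \<in> cball x (norm h)" if "t \<in> {0..1}" for t
      using that by (auto simp: dist_norm mult_left_le_one_le)
    show "(\<phi> has_derivative (\<lambda>h. \<Sum>i\<in>UNIV. h $ i * pd i \<phi> y)) (at y within cball x (norm h))" for y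
      by (rule has_derivative_at_withinI, rule has_derivative_pd, rule smooth_fun_differentiable[OF test_fun_smooth[OF assms]])
    show "onorm ((\<lambda>h. \<Sum>i\<in>UNIV. h $ i * pd i \<phi> y) - (\<lambda>h. \<Sum>i\<in>UNIV. h $ i * pd i \<phi> x)) \<le> real CARD('n) * (L * norm h)"
      if "y \<in> cball x (norm h)" for y
    proof (rule onorm_le)
      fix k :: "real^'n"
      have "\<bar>pd i \<phi> y - pd i \<phi> x\<bar> \<le> L * norm h" for i
        using L[of i y x] that L0 by (smt (verit) dist_norm mem_cball mult_left_mono norm_minus_commute)
      from abs_sum_component_le[of "\<lambda>i. pd i \<phi> y - pd i \<phi> x", OF this, of k]
      show "norm (((\<lambda>h. \<Sum>i\<in>UNIV. h $ i * pd i \<phi> y) - (\<lambda>h. \<Sum>i\<in>UNIV. h $ i * pd i \<phi> x)) k) \<le> real CARD('n) * (L * norm h) * norm k"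
        by (simp add: right_diff_distrib sum_subtractf)
    qed
  qed auto
  then show ?thesis using L0
    by (intro exI[of _ "real CARD('n) * L"]) (auto simp: mult_ac)
qed

text \<open>The index k closes the family under differentiation up to linear combinations. The
  parameter c is later sent to 0, where the function with k = 0 tends to the indicator of the
  positive half line.\<close>

definition flat_exp :: "real \<Rightarrow> nat \<Rightarrow> real \<Rightarrow> real" where
  "flat_exp c k t = (if 0 < t then exp (- c / t) / t ^ k else 0)"

text \<open>Only the term of degree k + 1 in the series of exp (c / t) is kept: k of its powers
  cancel the denominator and one factor t remains.\<close>

lemma flat_exp_le:
  assumes "0 < c"
  shows "\<bar>flat_exp c k t\<bar> \<le> (fact (Suc k) / c ^ Suc k) * \<bar>t\<bar>"
proof (cases "0 < t")
  case True
  have "(c / t) ^ Suc k / fact (Suc k) \<le> exp (c / t)"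
    using assms True sum_le_suminf[OF summable_exp_generic, of "{Suc k}" "c / t"]
    by (simp add: exp_def divide_inverse mult.commute scaleR_conv_of_real)
  then have "exp (- c / t) / t ^ k \<le> fact (Suc k) / c ^ Suc k * t"
    using assms True by (simp add: exp_minus field_simps del: fact_Suc)
  then show ?thesis using True by (simp add: flat_exp_def del: fact_Suc)
next
  case False
  have "0 \<le> (fact (Suc k) / c ^ Suc k) * \<bar>t\<bar>" using assms by (intro mult_nonneg_nonneg) auto
  then show ?thesis using False by (simp add: flat_exp_def del: fact_Suc power_Suc)
qed

lemma DERIV_flat_exp:
  assumes "0 < c"
  shows "(flat_exp c k has_real_derivative c * flat_exp c (k + 2) t - real k * flat_exp c (Suc k) t) (at t)"
proof -
  consider "t < 0" | "t = 0" | "0 < t" by linarith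
  then show ?thesis
  proof cases
    case 1
    have "(flat_exp c k has_real_derivative 0) (at t)"
      by (rule has_field_derivative_transform_within_open[of "\<lambda>_. 0" _ _ "{..<0}"]) (use 1 in \<open>auto simp: flat_exp_def\<close>)
    then show ?thesis using 1 by (simp add: flat_exp_def)
  next
    case 2
    \<comment> \<open>The difference quotient at 0 is the member of the family with index k + 1, so
      the linear bound settles the derivative there.\<close>
    have "((\<lambda>y. flat_exp c (Suc k) y) \<longlongrightarrow> 0) (at 0)"
    proof (rule Lim_null_comparison)
      show "\<forall>\<^sub>F y in at 0. norm (flat_exp c (Suc k) y) \<le> (fact (Suc (Suc k)) / c ^ Suc (Suc k)) * \<bar>y\<bar>"
        unfolding real_norm_def by (intro always_eventually allI flat_exp_le assms)
    qed (use assms in \<open>auto intro!: tendsto_eq_intros\<close>)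
    then have "((\<lambda>y. (flat_exp c k y - flat_exp c k 0) / (y - 0)) \<longlongrightarrow> 0) (at 0)"
      by (rule Lim_transform_eventually) (auto simp: flat_exp_def)
    then show ?thesis using 2 by (simp add: has_field_derivative_iff flat_exp_def)
  next
    case 3
    have "((\<lambda>t. exp (- c / t) / t ^ k) has_real_derivative c * flat_exp c (k + 2) t - real k * flat_exp c (Suc k) t) (at t)"
    proof -
      have "t * t ^ (j - Suc 0) = (if j = 0 then t else t ^ j)" for j by (cases j) auto
      then show ?thesis using 3 assms
        by (cases k) (auto intro!: derivative_eq_intros simp: flat_exp_def field_simps power2_eq_square)
    qed
    then show ?thesis
      by (rule has_field_derivative_transform_within_open[of _ _ _ "{0<..}"]) (use 3 in \<open>auto simp: flat_exp_def\<close>)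
  qed
qed

text \<open>A class of differentiable functions closed under partial derivatives, so that smoothness
  follows by induction on the list of directions. The affine argument allows factors for both faces
  of a box.\<close>

inductive smooth_gen :: "(real^'n \<Rightarrow> real) \<Rightarrow> bool" where
  const: "smooth_gen (\<lambda>x. a)"
| flat_exp: "0 < c \<Longrightarrow> smooth_gen (\<lambda>x. flat_exp c k (s * x $ i + b))"
| add: "smooth_gen f \<Longrightarrow> smooth_gen g \<Longrightarrow> smooth_gen (\<lambda>x. f x + g x)"
| mult: "smooth_gen f \<Longrightarrow> smooth_gen g \<Longrightarrow> smooth_gen (\<lambda>x. f x * g x)"

lemma smooth_gen_pd:
  assumes "smooth_gen f"
  shows "(\<forall>x. f differentiable (at x)) \<and> (\<forall>j. smooth_gen (pd j f))"
  using assms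
proof induction
  case (const a)
  have "pd j (\<lambda>x. a) = (\<lambda>_. 0)" for j :: 'a
    by (rule ext) (simp add: pd_eqI[OF has_derivative_const])
  then show ?case by (simp add: smooth_gen.const)
next
  case (flat_exp c k s i b)
  have D: "((\<lambda>x::real^'a. flat_exp c k (s * x $ i + b)) has_derivative
    (\<lambda>h. (s * h $ i) * (c * flat_exp c (k + 2) (s * x $ i + b) - real k * flat_exp c (Suc k) (s * x $ i + b)))) (at x)" for x
    by (rule DERIV_compose_FDERIV[OF DERIV_flat_exp[OF flat_exp]])
      (auto intro!: derivative_eq_intros bounded_linear.has_derivative[OF bounded_linear_vec_nth])
  have pd: "pd j (\<lambda>x::real^'a. flat_exp c k (s * x $ i + b)) = (\<lambda>x. (s * axis j 1 $ i) * (c * flat_exp c (k + 2) (s * x $ i + b) + (- real k) * flat_exp c (Suc k) (s * x $ i + b)))" for j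
    by (rule ext) (simp add: pd_eqI[OF D])
  show ?case
    unfolding pd using D flat_exp by (auto simp only: differentiable_def intro!: smooth_gen.intros)
next
  case (add f g)
  then have "pd j (\<lambda>x. f x + g x) = (\<lambda>x. pd j f x + pd j g x)" for j
    by (intro ext) (simp add: pd_eqI[OF has_derivative_add[OF has_derivative_pd has_derivative_pd]] pd_eqI[OF has_derivative_pd, symmetric])
  then show ?case using add by (auto intro!: smooth_gen.intros)
next
  case (mult f g)
  then have "pd j (\<lambda>x. f x * g x) = (\<lambda>x. f x * pd j g x + pd j f x * g x)" for j
    by (intro ext) (simp add: pd_eqI[OF has_derivative_mult[OF has_derivative_pd has_derivative_pd]] pd_eqI[OF has_derivative_pd, symmetric])
  then show ?case using mult by (auto intro!: smooth_gen.intros)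
qed

lemma smooth_gen_smooth_fun:
  assumes "smooth_gen f"
  shows "smooth_fun f"
proof -
  have "smooth_gen (iter_pd ds f)" for ds
    by (induction ds) (use assms smooth_gen_pd in auto)
  then show ?thesis using smooth_gen_pd unfolding smooth_fun_def by blast
qed

text \<open>Boxes are preferred to balls because the function factors over the coordinates and
  because open boxes form an intersection-stable generator of the Borel sets.\<close>

definition box_bump :: "real \<Rightarrow> real^'n \<Rightarrow> real^'n \<Rightarrow> real^'n \<Rightarrow> real" where
  "box_bump c a b x = (\<Prod>i\<in>UNIV. flat_exp c 0 (x $ i - a $ i) * flat_exp c 0 (b $ i - x $ i))"

lemma flat_exp_bounds: "0 \<le> flat_exp c 0 t" "0 < c \<Longrightarrow> flat_exp c 0 t \<le> 1" "flat_exp c 0 t = 0 \<longleftrightarrow> t \<le> 0"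
  by (auto simp: flat_exp_def)

lemma box_bump_nonzero_iff: "box_bump c a b x \<noteq> 0 \<longleftrightarrow> x \<in> box a b"
  by (auto simp: box_bump_def mem_box_cart flat_exp_bounds(3) not_le)

lemma box_bump_bounds: "0 \<le> box_bump c a b x" "0 < c \<Longrightarrow> box_bump c a b x \<le> 1"
  unfolding box_bump_def by (auto intro!: prod_nonneg prod_le_1 mult_le_one mult_nonneg_nonneg flat_exp_bounds(1,2))

lemma smooth_fun_box_bump:
  assumes "0 < c"
  shows "smooth_fun (box_bump c a (b :: real^'n))"
proof -
  have *: "smooth_gen (\<lambda>x::real^'n. flat_exp c 0 (x $ i - a $ i) * flat_exp c 0 (b $ i - x $ i))" for i
    using smooth_gen.mult[OF smooth_gen.flat_exp[OF assms, of 0 1 i "- a $ i"] smooth_gen.flat_exp[OF assms, of 0 "-1" i "b $ i"]]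
    by simp
  have "smooth_gen (\<lambda>x::real^'n. \<Prod>i\<in>I. flat_exp c 0 (x $ i - a $ i) * flat_exp c 0 (b $ i - x $ i))" if "finite I" for I
    using that by induction (auto intro: smooth_gen.intros(1) smooth_gen.mult *)
  from this[of UNIV] show ?thesis unfolding box_bump_def[abs_def] by (intro smooth_gen_smooth_fun) simp
qed

lemma test_fun_box_bump: "0 < c \<Longrightarrow> cbox a b \<subseteq> \<Omega> \<Longrightarrow> test_fun \<Omega> (box_bump c a b)"
  using box_subset_cbox by (intro test_fun_compact[of _ "cbox a b"] smooth_fun_box_bump) (auto simp: box_bump_nonzero_iff)

lemma box_bump_tendsto: "(\<lambda>k. box_bump (1 / real (Suc k)) a b x) \<longlonglongrightarrow> indicator (box a b) x"
proof (cases "x \<in> box a b")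
  case True
  have "(\<lambda>k. flat_exp (1 / real (Suc k)) 0 t) \<longlonglongrightarrow> 1" if "0 < t" for t
  proof -
    have "(\<lambda>k. exp (- (1 / real (Suc k)) / t)) \<longlonglongrightarrow> exp (- 0 / t)"
      using that by (intro tendsto_intros LIMSEQ_Suc[OF lim_1_over_n]) auto
    then show ?thesis using that by (simp add: flat_exp_def)
  qed
  then have "(\<lambda>k. flat_exp (1 / real (Suc k)) 0 (x $ i - a $ i) * flat_exp (1 / real (Suc k)) 0 (b $ i - x $ i)) \<longlonglongrightarrow> 1 * 1" for i
    using True by (intro tendsto_mult) (auto simp: mem_box_cart)
  then have "(\<lambda>k. box_bump (1 / real (Suc k)) a b x) \<longlonglongrightarrow> (\<Prod>i\<in>(UNIV :: 'a set). 1 * 1)"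
    unfolding box_bump_def by (rule tendsto_prod)
  then show ?thesis using True by simp
next
  case False
  then have "box_bump c a b x = 0" for c using box_bump_nonzero_iff[of c a b x] by simp
  then show ?thesis using False by simp
qed

section \<open>Averages of test functions and the fundamental lemma\<close>

text \<open>The convolution of \<phi> with the image under \<tau> of the measure with density c. As
  an integral over the parameter space it requires no density on \<open>real^'n\<close>.\<close>

definition avg :: "'w measure \<Rightarrow> ('w \<Rightarrow> real) \<Rightarrow> ('w \<Rightarrow> real^'n) \<Rightarrow> (real^'n \<Rightarrow> real) \<Rightarrow> real^'n \<Rightarrow> real" where
  "avg M c \<tau> \<phi> z = (\<integral>\<omega>. c \<omega> * \<phi> (z - \<tau> \<omega>) \<partial>M)"

lemma integrable_avg:
  assumes \<phi>: "test_fun \<Omega> \<phi>" and c: "integrable M c" and [measurable]: "\<tau> \<in> borel_measurable M"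
  shows "integrable M (\<lambda>\<omega>. c \<omega> * \<phi> (z - \<tau> \<omega>))"
proof -
  obtain B where B: "0 \<le> B" "\<And>x. \<bar>\<phi> x\<bar> \<le> B" using test_fun_bounded[OF \<phi>] by blast
  have [measurable]: "\<phi> \<in> borel_measurable borel"
    by (rule smooth_fun_borel_measurable[OF test_fun_smooth[OF \<phi>]])
  show ?thesis
  proof (rule Bochner_Integration.integrable_bound)
    show "integrable M (\<lambda>\<omega>. c \<omega> * B)" using c by simp
    show "(\<lambda>\<omega>. c \<omega> * \<phi> (z - \<tau> \<omega>)) \<in> borel_measurable M" using c by measurable
    show "AE \<omega> in M. norm (c \<omega> * \<phi> (z - \<tau> \<omega>)) \<le> norm (c \<omega> * B)"
      using B by (auto simp: abs_mult intro!: mult_left_mono)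
  qed
qed

text \<open>Differentiation under the integral sign: the Taylor remainder of \<phi> is uniform, so
  integrating it against c leaves an error quadratic in \<open>norm h\<close>.\<close>

lemma has_derivative_avg:
  fixes \<phi> :: "real^'n \<Rightarrow> real"
  assumes \<phi>: "test_fun \<Omega> \<phi>" and c: "integrable M c" and \<tau>: "\<tau> \<in> borel_measurable M"
  shows "(avg M c \<tau> \<phi> has_derivative (\<lambda>h. \<Sum>i\<in>UNIV. h $ i * avg M c \<tau> (pd i \<phi>) z)) (at z)"
proof -
  obtain L where L: "0 \<le> L" "\<And>x h. \<bar>\<phi> (x + h) - \<phi> x - (\<Sum>i\<in>UNIV. h $ i * pd i \<phi> x)\<bar> \<le> L * norm h * norm h"
    using test_fun_taylor[OF \<phi>] by blast
  define K where "K = (\<integral>\<omega>. \<bar>c \<omega>\<bar> \<partial>M) * L"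
  note int = integrable_avg[OF \<phi> c \<tau>] integrable_avg[OF test_fun_pd[OF \<phi>] c \<tau>]
  have est: "\<bar>avg M c \<tau> \<phi> (z + h) - avg M c \<tau> \<phi> z - (\<Sum>i\<in>UNIV. h $ i * avg M c \<tau> (pd i \<phi>) z)\<bar> \<le> K * norm h * norm h" for h
  proof -
    have "avg M c \<tau> \<phi> (z + h) - avg M c \<tau> \<phi> z - (\<Sum>i\<in>UNIV. h $ i * avg M c \<tau> (pd i \<phi>) z)
      = (\<integral>\<omega>. c \<omega> * \<phi> (z + h - \<tau> \<omega>) - c \<omega> * \<phi> (z - \<tau> \<omega>) - (\<Sum>i\<in>UNIV. h $ i * (c \<omega> * pd i \<phi> (z - \<tau> \<omega>))) \<partial>M)"
      unfolding avg_def using int by (subst Bochner_Integration.integral_diff; simp)+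
    also have "\<dots> = (\<integral>\<omega>. c \<omega> * (\<phi> (z - \<tau> \<omega> + h) - \<phi> (z - \<tau> \<omega>) - (\<Sum>i\<in>UNIV. h $ i * pd i \<phi> (z - \<tau> \<omega>))) \<partial>M)"
      by (intro Bochner_Integration.integral_cong) (auto simp: algebra_simps sum_distrib_left)
    also have "\<bar>\<dots>\<bar> \<le> (\<integral>\<omega>. \<bar>c \<omega> * (\<phi> (z - \<tau> \<omega> + h) - \<phi> (z - \<tau> \<omega>) - (\<Sum>i\<in>UNIV. h $ i * pd i \<phi> (z - \<tau> \<omega>)))\<bar> \<partial>M)"
      by (rule integral_abs_bound)
    also have "\<dots> \<le> (\<integral>\<omega>. \<bar>c \<omega>\<bar> * (L * norm h * norm h) \<partial>M)"
    proof (rule integral_mono)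
      have "integrable M (\<lambda>\<omega>. c \<omega> * \<phi> (z + h - \<tau> \<omega>) - c \<omega> * \<phi> (z - \<tau> \<omega>) - (\<Sum>i\<in>UNIV. h $ i * (c \<omega> * pd i \<phi> (z - \<tau> \<omega>))))"
        using int by simp
      then have "integrable M (\<lambda>\<omega>. c \<omega> * (\<phi> (z - \<tau> \<omega> + h) - \<phi> (z - \<tau> \<omega>) - (\<Sum>i\<in>UNIV. h $ i * pd i \<phi> (z - \<tau> \<omega>))))"
        by (simp add: algebra_simps sum_distrib_left)
      then show "integrable M (\<lambda>\<omega>. \<bar>c \<omega> * (\<phi> (z - \<tau> \<omega> + h) - \<phi> (z - \<tau> \<omega>) - (\<Sum>i\<in>UNIV. h $ i * pd i \<phi> (z - \<tau> \<omega>)))\<bar>)"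
        by (rule integrable_abs)
    qed (use c L in \<open>auto simp: abs_mult intro!: mult_left_mono\<close>)
    also have "\<dots> = K * norm h * norm h" by (simp add: K_def mult.assoc)
    finally show ?thesis .
  qed
  show ?thesis
  proof (rule has_derivativeI_sandwich[of 1 _ _ _ _ "\<lambda>y. K * norm (y - z)"])
    show "bounded_linear (\<lambda>h::real^'n. \<Sum>i\<in>UNIV. h $ i * avg M c \<tau> (pd i \<phi>) z)"
      by (intro bounded_linear_sum bounded_linear_mult_const bounded_linear_vec_nth)
    show "norm ((avg M c \<tau> \<phi> y - avg M c \<tau> \<phi> z) - (\<Sum>i\<in>UNIV. (y - z) $ i * avg M c \<tau> (pd i \<phi>) z)) / norm (y - z) \<le> K * norm (y - z)"
      if "y \<noteq> z" for y
      using est[of "y - z"] that by (simp add: divide_le_eq)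
    show "((\<lambda>y. K * norm (y - z)) \<longlongrightarrow> 0) (at z)"
      by (auto intro!: tendsto_eq_intros)
  qed simp
qed

lemma pd_avg:
  assumes "test_fun \<Omega> \<phi>" "integrable M c" "\<tau> \<in> borel_measurable M"
  shows "pd i (avg M c \<tau> \<phi>) = avg M c \<tau> (pd i \<phi>)"
proof
  fix z
  have "pd i (avg M c \<tau> \<phi>) z = (\<Sum>j\<in>UNIV. axis i 1 $ j * avg M c \<tau> (pd j \<phi>) z)"
    by (rule pd_eqI[OF has_derivative_avg[OF assms]])
  also have "\<dots> = (\<Sum>j\<in>UNIV. if j = i then avg M c \<tau> (pd i \<phi>) z else 0)"
    by (intro sum.cong) (auto simp: axis_def)
  finally show "pd i (avg M c \<tau> \<phi>) z = avg M c \<tau> (pd i \<phi>) z" by simp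
qed

text \<open>Partial derivatives pass to \<phi>, which remains a test function, so every iterated
  derivative of the average is the average of a test function.\<close>

lemma smooth_fun_avg:
  assumes "test_fun \<Omega> \<phi>" "integrable M c" "\<tau> \<in> borel_measurable M"
  shows "smooth_fun (avg M c \<tau> \<phi>)"
proof -
  have "test_fun \<Omega> (iter_pd ds \<phi>) \<and> iter_pd ds (avg M c \<tau> \<phi>) = avg M c \<tau> (iter_pd ds \<phi>)" for ds
    by (induction ds) (auto simp: assms test_fun_pd pd_avg[OF _ assms(2,3)])
  then have "iter_pd ds (avg M c \<tau> \<phi>) differentiable (at x)" for ds x
    using has_derivative_avg[OF _ assms(2,3), of \<Omega> "iter_pd ds \<phi>" x] by (simp add: differentiableI)
  then show ?thesis by (simp add: smooth_fun_def)
qed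

lemma test_fun_avg:
  assumes "smooth_fun \<phi>" "compact D" "\<And>x. \<phi> x \<noteq> 0 \<Longrightarrow> x \<in> D" and c: "integrable M c" "\<tau> \<in> borel_measurable M"
    and "compact H" "\<And>\<omega>. c \<omega> \<noteq> 0 \<Longrightarrow> \<tau> \<omega> \<in> H" and "{x + h |x h. x \<in> D \<and> h \<in> H} \<subseteq> \<Omega>"
  shows "test_fun \<Omega> (avg M c \<tau> \<phi>)"
proof (rule test_fun_compact)
  show "smooth_fun (avg M c \<tau> \<phi>)"
    using assms by (intro smooth_fun_avg[of UNIV] test_fun_compact[of \<phi> D]) auto
  show "compact {x + h |x h. x \<in> D \<and> h \<in> H}" using assms by (intro compact_sums)
  show "z \<in> {x + h |x h. x \<in> D \<and> h \<in> H}" if "avg M c \<tau> \<phi> z \<noteq> 0" for z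
  proof (rule ccontr)
    assume z: "z \<notin> {x + h |x h. x \<in> D \<and> h \<in> H}"
    have "c \<omega> * \<phi> (z - \<tau> \<omega>) = 0" for \<omega>
    proof (rule ccontr)
      assume "c \<omega> * \<phi> (z - \<tau> \<omega>) \<noteq> 0"
      then have "z - \<tau> \<omega> \<in> D" "\<tau> \<omega> \<in> H" using assms by auto
      then have "(z - \<tau> \<omega>) + \<tau> \<omega> \<in> {x + h |x h. x \<in> D \<and> h \<in> H}" by blast
      moreover have "(z - \<tau> \<omega>) + \<tau> \<omega> = z" by simp
      ultimately show False using z by metis
    qed
    with that show False by (simp add: avg_def)
  qed
qed fact

text \<open>The transpose of \<open>avg\<close> under the Lebesgue pairing; it acts on functions
  that are merely integrable.\<close>

definition translate_avg :: "'w measure \<Rightarrow> ('w \<Rightarrow> real) \<Rightarrow> ('w \<Rightarrow> real^'n) \<Rightarrow> (real^'n \<Rightarrow> real) \<Rightarrow> real^'n \<Rightarrow> real" where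
  "translate_avg M c \<tau> h x = (\<integral>\<omega>. c \<omega> * h (x + \<tau> \<omega>) \<partial>M)"

lemma integrable_lborel_translate:
  fixes h :: "'a::euclidean_space \<Rightarrow> real"
  assumes "integrable lborel h"
  shows "integrable lborel (\<lambda>x. h (x + a))" "(\<integral>x. h (x + a) \<partial>lborel) = (\<integral>x. h x \<partial>lborel)"
proof -
  have [measurable]: "h \<in> borel_measurable borel" using assms by simp
  have "integrable (distr lborel borel ((+) a)) h" using assms by (simp add: lborel_distr_plus)
  then show "integrable lborel (\<lambda>x. h (x + a))" by (subst (asm) integrable_distr_eq) (auto simp: add.commute)
  have "(\<integral>x. h x \<partial>lborel) = (\<integral>x. h x \<partial>distr lborel borel ((+) a))" by (simp add: lborel_distr_plus)
  also have "\<dots> = (\<integral>x. h (x + a) \<partial>lborel)" by (subst integral_distr) (auto simp: add.commute)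
  finally show "(\<integral>x. h (x + a) \<partial>lborel) = (\<integral>x. h x \<partial>lborel)" ..
qed

text \<open>By translation invariance the slice at \<omega> has L^1 norm
  \<open>\<bar>c \<omega>\<bar>\<close> times the norm of h, so the total is the product of the two
  norms.\<close>

lemma integrable_translate_product:
  fixes h :: "real^'n \<Rightarrow> real"
  assumes "sigma_finite_measure M" and c: "integrable M c" and [measurable]: "\<tau> \<in> borel_measurable M" and h: "integrable lborel h"
  shows "integrable (lborel \<Otimes>\<^sub>M M) (\<lambda>(x, \<omega>). c \<omega> * h (x + \<tau> \<omega>))"
proof -
  interpret M: sigma_finite_measure M by fact
  interpret P: pair_sigma_finite lborel M ..
  interpret Q: pair_sigma_finite M lborel ..
  have [measurable]: "h \<in> borel_measurable borel" "c \<in> borel_measurable M" using h c by auto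
  have "integrable (M \<Otimes>\<^sub>M lborel) (\<lambda>(\<omega>, x). c \<omega> * h (x + \<tau> \<omega>))"
  proof (rule Q.Fubini_integrable)
    have "(\<integral>x. norm (case (\<omega>, x) of (\<omega>, x) \<Rightarrow> c \<omega> * h (x + \<tau> \<omega>)) \<partial>lborel) = \<bar>c \<omega>\<bar> * (\<integral>x. \<bar>h x\<bar> \<partial>lborel)" for \<omega>
      using integrable_lborel_translate(2)[OF integrable_abs[OF h], of "\<tau> \<omega>"] by (simp add: abs_mult)
    then show "integrable M (\<lambda>\<omega>. \<integral>x. norm (case (\<omega>, x) of (\<omega>, x) \<Rightarrow> c \<omega> * h (x + \<tau> \<omega>)) \<partial>lborel)"
      using c by simp
  qed (use integrable_lborel_translate(1)[OF h] in auto)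
  then show ?thesis using P.integrable_product_swap_iff[of "\<lambda>(x, \<omega>). c \<omega> * h (x + \<tau> \<omega>)"] by simp
qed

lemma integrable_translate_avg:
  assumes "sigma_finite_measure M" "integrable M c" "\<tau> \<in> borel_measurable M" "integrable lborel h"
  shows "integrable lborel (translate_avg M c \<tau> h)"
proof -
  interpret M: sigma_finite_measure M by fact
  interpret P: pair_sigma_finite lborel M ..
  show ?thesis
    using P.integrable_fst'[OF integrable_translate_product[OF assms]] by (simp add: translate_avg_def[abs_def])
qed

text \<open>Fubini together with the substitution z = x + \<tau> \<omega> for fixed \<omega>. Since
  \<phi> is bounded, one integrand is dominated by the product of c and h, the other by the product
  of c and the translated h.\<close>

lemma integral_avg_transpose:
  fixes h :: "real^'n \<Rightarrow> real"
  assumes M: "sigma_finite_measure M" and c: "integrable M c" and \<tau>: "\<tau> \<in> borel_measurable M" and h: "integrable lborel h"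
    and \<phi>: "test_fun \<Omega> \<phi>"
  shows "(\<integral>z. h z * avg M c \<tau> \<phi> z \<partial>lborel) = (\<integral>x. \<phi> x * translate_avg M c \<tau> h x \<partial>lborel)"
proof -
  interpret M: sigma_finite_measure M by fact
  interpret P: pair_sigma_finite lborel M ..
  note [measurable] = \<tau> smooth_fun_borel_measurable[OF test_fun_smooth[OF \<phi>]]
  have [measurable]: "h \<in> borel_measurable borel" "c \<in> borel_measurable M" using h c by auto
  obtain B where B: "0 \<le> B" "\<And>x. \<bar>\<phi> x\<bar> \<le> B" using test_fun_bounded[OF \<phi>] by blast
  have i0: "integrable (lborel \<Otimes>\<^sub>M M) (\<lambda>(x, \<omega>). c \<omega> * h x)"
    using integrable_translate_product[OF M c _ h, of "\<lambda>_. 0"] by simp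
  have i1: "integrable (lborel \<Otimes>\<^sub>M M) (\<lambda>(x, \<omega>). h x * (c \<omega> * \<phi> (x - \<tau> \<omega>)))"
  proof (rule Bochner_Integration.integrable_bound)
    show "integrable (lborel \<Otimes>\<^sub>M M) (\<lambda>z. B * (case z of (x, \<omega>) \<Rightarrow> c \<omega> * h x))" using i0 by simp
    have "norm (h x * (c \<omega> * \<phi> (x - \<tau> \<omega>))) \<le> norm (B * (c \<omega> * h x))" for x \<omega>
      using mult_left_mono[OF B(2)[of "x - \<tau> \<omega>"], of "\<bar>c \<omega> * h x\<bar>"] B(1) by (simp add: abs_mult mult_ac)
    then show "AE z in lborel \<Otimes>\<^sub>M M. norm (case z of (x, \<omega>) \<Rightarrow> h x * (c \<omega> * \<phi> (x - \<tau> \<omega>))) \<le> norm (B * (case z of (x, \<omega>) \<Rightarrow> c \<omega> * h x))"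
      by (intro AE_I2) (simp add: split_beta)
  qed measurable
  have i2: "integrable (lborel \<Otimes>\<^sub>M M) (\<lambda>(x, \<omega>). \<phi> x * (c \<omega> * h (x + \<tau> \<omega>)))"
  proof (rule Bochner_Integration.integrable_bound)
    show "integrable (lborel \<Otimes>\<^sub>M M) (\<lambda>z. B * (case z of (x, \<omega>) \<Rightarrow> c \<omega> * h (x + \<tau> \<omega>)))"
      using integrable_translate_product[OF M c \<tau> h] by simp
    have "norm (\<phi> x * (c \<omega> * h (x + \<tau> \<omega>))) \<le> norm (B * (c \<omega> * h (x + \<tau> \<omega>)))" for x \<omega>
      using mult_right_mono[OF B(2)[of x], of "\<bar>c \<omega> * h (x + \<tau> \<omega>)\<bar>"] B(1) by (simp add: abs_mult)
    then show "AE z in lborel \<Otimes>\<^sub>M M. norm (case z of (x, \<omega>) \<Rightarrow> \<phi> x * (c \<omega> * h (x + \<tau> \<omega>))) \<le> norm (B * (case z of (x, \<omega>) \<Rightarrow> c \<omega> * h (x + \<tau> \<omega>)))"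
      by (intro AE_I2) (simp add: split_beta)
  qed measurable
  have hp: "integrable lborel (\<lambda>x. h x * \<phi> (x - a))" for a
  proof (rule Bochner_Integration.integrable_bound)
    show "integrable lborel (\<lambda>x. h x * B)" using h by simp
  qed (use B in \<open>auto simp: abs_mult intro!: mult_left_mono\<close>)
  have "(\<integral>z. h z * avg M c \<tau> \<phi> z \<partial>lborel) = (\<integral>z. (\<integral>\<omega>. h z * (c \<omega> * \<phi> (z - \<tau> \<omega>)) \<partial>M) \<partial>lborel)"
    by (simp add: avg_def)
  also have "\<dots> = (\<integral>\<omega>. (\<integral>z. h z * (c \<omega> * \<phi> (z - \<tau> \<omega>)) \<partial>lborel) \<partial>M)"
    using P.Fubini_integral[OF i1] by simp
  also have "\<dots> = (\<integral>\<omega>. (\<integral>x. \<phi> x * (c \<omega> * h (x + \<tau> \<omega>)) \<partial>lborel) \<partial>M)"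
  proof (rule Bochner_Integration.integral_cong)
    fix \<omega>
    have "(\<integral>z. h z * (c \<omega> * \<phi> (z - \<tau> \<omega>)) \<partial>lborel) = c \<omega> * (\<integral>z. h z * \<phi> (z - \<tau> \<omega>) \<partial>lborel)"
      by (simp add: mult.left_commute)
    also have "\<dots> = c \<omega> * (\<integral>x. h (x + \<tau> \<omega>) * \<phi> x \<partial>lborel)"
      using integrable_lborel_translate(2)[OF hp[of "\<tau> \<omega>"], of "\<tau> \<omega>"] by simp
    also have "\<dots> = (\<integral>x. c \<omega> * (h (x + \<tau> \<omega>) * \<phi> x) \<partial>lborel)"
      by simp
    also have "\<dots> = (\<integral>x. \<phi> x * (c \<omega> * h (x + \<tau> \<omega>)) \<partial>lborel)"
      by (intro Bochner_Integration.integral_cong) (auto simp: mult_ac)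
    finally show "(\<integral>z. h z * (c \<omega> * \<phi> (z - \<tau> \<omega>)) \<partial>lborel) = (\<integral>x. \<phi> x * (c \<omega> * h (x + \<tau> \<omega>)) \<partial>lborel)" .
  qed simp
  also have "\<dots> = (\<integral>x. (\<integral>\<omega>. \<phi> x * (c \<omega> * h (x + \<tau> \<omega>)) \<partial>M) \<partial>lborel)"
    using P.Fubini_integral[OF i2] by simp
  finally show ?thesis by (simp add: translate_avg_def)
qed

text \<open>A Dynkin argument on the intersection-stable generator of open boxes. The hypothesis on
  the whole space carries the step to complements, as \<open>UNIV\<close> is not a box.\<close>

lemma AE_zero_of_box_integrals:
  fixes v :: "'a::euclidean_space \<Rightarrow> real"
  assumes v: "integrable lborel v" and box: "\<And>a b. (\<integral>x\<in>box a b. v x \<partial>lborel) = 0" and whole: "(\<integral>x. v x \<partial>lborel) = 0"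
  shows "AE x in lborel. v x = 0"
proof (rule density_unique_real)
  have im: "set_integrable lborel A v" if "A \<in> sets lborel" for A
    unfolding set_integrable_def by (rule integrable_mult_indicator[OF that v])
  fix A :: "'a set"
  assume "A \<in> sets lborel"
  then have A: "A \<in> sigma_sets UNIV (range (\<lambda>(a, b). box a b :: 'a set))"
    by (simp add: borel_eq_box sets_measure_of)
  have stable: "Int_stable (range (\<lambda>(a, b). box a b :: 'a set))"
    by (auto simp: Int_stable_def box_Int_box)
  have "range (\<lambda>(a, b). box a b :: 'a set) \<subseteq> Pow UNIV" by simp
  from stable this A have "(\<integral>x\<in>A. v x \<partial>lborel) = 0"
  proof (induction rule: sigma_sets_induct_disjoint)
    case (basic A)
    then show ?case using box by auto
  next
    case (compl A)
    then have A: "A \<in> sets borel" by (simp add: borel_eq_box sets_measure_of)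
    have "(\<integral>x\<in>UNIV - A. v x \<partial>lborel) + (\<integral>x\<in>A. v x \<partial>lborel) = (\<integral>x\<in>(UNIV - A) \<union> A. v x \<partial>lborel)"
      using A by (subst set_integral_Un) (auto intro!: im)
    then show ?case using compl whole by (simp add: set_lebesgue_integral_def)
  next
    case (union A)
    then have A: "A i \<in> sets lborel" for i by (auto simp: borel_eq_box sets_measure_of)
    then have "(\<integral>x\<in>(\<Union>i. A i). v x \<partial>lborel) = (\<Sum>i. \<integral>x\<in>A i. v x \<partial>lborel)"
      using union(1) by (intro lebesgue_integral_countable_add) (auto simp: disjoint_family_on_def intro!: im)
    then show ?case using union by simp
  qed (auto simp: set_lebesgue_integral_def)
  then show "(\<integral>x\<in>A. v x \<partial>lborel) = (\<integral>x\<in>A. 0 \<partial>lborel)" by (simp add: set_lebesgue_integral_def)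
qed (use v in auto)

text \<open>The fundamental lemma of the calculus of variations on a box. The bumps of a smaller box
  converge to its indicator, and dominated convergence turns the hypothesis into vanishing integrals
  over boxes.\<close>

lemma AE_zero_of_test_integrals:
  fixes u :: "real^'n \<Rightarrow> real"
  assumes u: "integrable lborel u"
    and test: "\<And>\<psi>. smooth_fun \<psi> \<Longrightarrow> (\<And>x. \<psi> x \<noteq> 0 \<Longrightarrow> x \<in> cbox a b) \<Longrightarrow> (\<integral>x. u x * \<psi> x \<partial>lborel) = 0"
  shows "AE x in lborel. x \<in> box a b \<longrightarrow> u x = 0"
proof -
  have [measurable]: "u \<in> borel_measurable borel" using u by simp
  have sub: "(\<integral>x. indicator (box c d) x * u x \<partial>lborel) = 0" if "box c d \<subseteq> box a b" for c d
  proof (rule LIMSEQ_unique)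
    note [measurable] = smooth_fun_borel_measurable[OF smooth_fun_box_bump]
    show "(\<lambda>k. \<integral>x. u x * box_bump (1 / real (Suc k)) c d x \<partial>lborel) \<longlonglongrightarrow> (\<integral>x. indicator (box c d) x * u x \<partial>lborel)"
    proof (rule integral_dominated_convergence[where w = "\<lambda>x. \<bar>u x\<bar>"])
      show "AE x in lborel. (\<lambda>k. u x * box_bump (1 / real (Suc k)) c d x) \<longlonglongrightarrow> indicator (box c d) x * u x"
      proof (rule AE_I2)
        fix x
        show "(\<lambda>k. u x * box_bump (1 / real (Suc k)) c d x) \<longlonglongrightarrow> indicator (box c d) x * u x"
          using tendsto_mult[OF tendsto_const box_bump_tendsto, of "u x" c d x] by (simp only: mult.commute)
      qed
      show "AE x in lborel. norm (u x * box_bump (1 / real (Suc k)) c d x) \<le> \<bar>u x\<bar>" for k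
        using box_bump_bounds[of "1 / real (Suc k)" c d] by (auto simp: abs_mult intro!: mult_left_le)
    qed (use u in auto)
    have "(\<integral>x. u x * box_bump (1 / real (Suc k)) c d x \<partial>lborel) = 0" for k
      using that box_subset_cbox[of a b] by (intro test smooth_fun_box_bump) (auto simp: box_bump_nonzero_iff)
    then show "(\<lambda>k. \<integral>x. u x * box_bump (1 / real (Suc k)) c d x \<partial>lborel) \<longlonglongrightarrow> 0" by simp
  qed
  have "AE x in lborel. indicator (box a b) x * u x = 0"
  proof (rule AE_zero_of_box_integrals)
    show "integrable lborel (\<lambda>x. indicator (box a b) x * u x)"
      using u integrable_mult_indicator[of "box a b" lborel u] by simp
    show "(\<integral>x. indicator (box a b) x * u x \<partial>lborel) = 0" by (rule sub) simp
    fix c d :: "real^'n"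
    \<comment> \<open>An arbitrary box meets \<open>box a b\<close> in a box, which brings it under
      \<open>sub\<close>.\<close>
    obtain e f where ef: "box c d \<inter> box a b = box e f" using box_Int_box by blast
    have "(\<integral>x\<in>box c d. indicator (box a b) x * u x \<partial>lborel) = (\<integral>x. indicator (box e f) x * u x \<partial>lborel)"
      unfolding set_lebesgue_integral_def ef[symmetric] by (intro Bochner_Integration.integral_cong) (auto simp: indicator_def)
    then show "(\<integral>x\<in>box c d. indicator (box a b) x * u x \<partial>lborel) = 0" using sub[of e f] ef by auto
  qed
  then show ?thesis by (auto simp: indicator_def elim!: eventually_mono split: if_splits)
qed

section \<open>Representation by averages over cones\<close>

lemma integrable_mult_test:
  assumes f: "integrable lborel f" and \<phi>: "test_fun \<Omega> \<phi>"
  shows "integrable lborel (\<lambda>x. f x * \<phi> x)"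
proof -
  obtain B where B: "0 \<le> B" "\<And>x. \<bar>\<phi> x\<bar> \<le> B" using test_fun_bounded[OF \<phi>] by blast
  note [measurable] = smooth_fun_borel_measurable[OF test_fun_smooth[OF \<phi>]]
  have [measurable]: "f \<in> borel_measurable borel" using f by simp
  show ?thesis
  proof (rule Bochner_Integration.integrable_bound)
    show "integrable lborel (\<lambda>x. f x * B)" using f by simp
  qed (use B in \<open>auto simp: abs_mult intro!: mult_left_mono\<close>)
qed

text \<open>The union of the segments from 0 to the points of a ball. Translated by x, it is the set
  on which the averages at x read their function.\<close>

definition cone_hull :: "real^'n \<Rightarrow> real \<Rightarrow> (real^'n) set" where
  "cone_hull w s = (\<lambda>(t, y). t *\<^sub>R y) ` ({0..1} \<times> cball w s)"

lemma compact_cone_hull: "compact (cone_hull w s)"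
  unfolding cone_hull_def
  by (intro compact_continuous_image compact_Times) (auto simp: split_beta intro!: continuous_intros)

lemma cone_hull_zero: "0 \<le> s \<Longrightarrow> 0 \<in> cone_hull w s"
  unfolding cone_hull_def by (rule image_eqI[of _ _ "(0, w)"]) auto

text \<open>For s > 0 the density of the uniform probability on [0, 1] times the ball; the
  normalisation makes the averaging identity reproduce \<open>\<psi> z\<close> itself.\<close>

definition cone_weight :: "real^'n \<Rightarrow> real \<Rightarrow> real \<times> (real^'n) \<Rightarrow> real" where
  "cone_weight w s \<omega> = indicator ({0..1} \<times> cball w s) \<omega> / measure lborel (cball w s)"

abbreviation cone_grad_weight :: "real^'n \<Rightarrow> real \<Rightarrow> 'n \<Rightarrow> real \<times> (real^'n) \<Rightarrow> real" where
  "cone_grad_weight w s i \<omega> \<equiv> cone_weight w s \<omega> * ((1 - fst \<omega>) * snd \<omega> $ i)"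

abbreviation cone_point :: "real \<times> (real^'n) \<Rightarrow> real^'n" where
  "cone_point \<omega> \<equiv> fst \<omega> *\<^sub>R snd \<omega>"

lemma cone_weight_measurable [measurable]: "cone_weight w s \<in> borel_measurable borel"
  "cone_grad_weight w s i \<in> borel_measurable borel"
proof -
  have [measurable]: "{0..1::real} \<times> cball w s \<in> sets borel"
    by (intro borel_closed closed_Times) auto
  show *[measurable]: "cone_weight w s \<in> borel_measurable borel"
    unfolding cone_weight_def by measurable
  have "(\<lambda>\<omega>::real \<times> (real^'a). (1 - fst \<omega>) * snd \<omega> $ i) \<in> borel_measurable borel"
    by (intro borel_measurable_continuous_onI continuous_intros)
  then show "cone_grad_weight w s i \<in> borel_measurable borel" by measurable
qed

lemma integrable_cone_weight:
  fixes w :: "real^'n"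
  shows "integrable (lborel \<Otimes>\<^sub>M lborel) (cone_weight w s)"
proof -
  have "emeasure (lborel \<Otimes>\<^sub>M lborel) ({0..1::real} \<times> cball w s) = emeasure lborel {0..1::real} * emeasure lborel (cball w s)"
    by (intro lborel.emeasure_pair_measure_Times) auto
  also have "\<dots> < \<infinity>" using emeasure_lborel_cball_finite[of w s] by (simp add: ennreal_mult_less_top)
  finally have "integrable (lborel \<Otimes>\<^sub>M lborel) (indicator ({0..1::real} \<times> cball w s) :: _ \<Rightarrow> real)"
    by (intro integrable_real_indicator) auto
  then show ?thesis unfolding cone_weight_def by simp
qed

lemma cone_weight_nonzero: "cone_weight w s \<omega> \<noteq> 0 \<Longrightarrow> fst \<omega> \<in> {0..1} \<and> snd \<omega> \<in> cball w s"
  by (cases \<omega>) (auto simp: cone_weight_def indicator_def split: if_splits)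

lemma cone_point_in_hull: "cone_weight w s \<omega> \<noteq> 0 \<Longrightarrow> cone_point \<omega> \<in> cone_hull w s"
  using cone_weight_nonzero[of w s \<omega>] unfolding cone_hull_def
  by (intro image_eqI[of _ _ \<omega>]) (auto simp: split_beta mem_Times_iff)

lemma integrable_cone_grad_weight:
  fixes w :: "real^'n"
  shows "integrable (lborel \<Otimes>\<^sub>M lborel) (cone_grad_weight w s i)"
proof (rule Bochner_Integration.integrable_bound)
  show "integrable (lborel \<Otimes>\<^sub>M lborel) (\<lambda>\<omega>. cone_weight w s \<omega> * (norm w + s))"
    using integrable_cone_weight[of w s] by simp
  show "cone_grad_weight w s i \<in> borel_measurable (lborel \<Otimes>\<^sub>M lborel)"
    by (simp add: lborel_prod)
  have "norm (cone_grad_weight w s i \<omega>) \<le> norm (cone_weight w s \<omega> * (norm w + s))" for \<omega>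
  proof (cases "cone_weight w s \<omega> = 0")
    case False
    note nz = cone_weight_nonzero[OF False]
    have "\<bar>snd \<omega> $ i\<bar> \<le> norm w + s"
      using component_le_norm_cart[of "snd \<omega>" i] norm_triangle_sub[of "snd \<omega>" w] nz
      by (simp add: dist_norm norm_minus_commute)
    then have "\<bar>(1 - fst \<omega>) * snd \<omega> $ i\<bar> \<le> 1 * (norm w + s)"
      unfolding abs_mult using nz by (intro mult_mono) auto
    then show ?thesis by (auto simp: abs_mult intro!: mult_left_mono)
  qed simp
  then show "AE \<omega> in lborel \<Otimes>\<^sub>M lborel. norm (cone_grad_weight w s i \<omega>) \<le> norm (cone_weight w s \<omega> * (norm w + s))"
    by simp
qed

lemma cone_point_measurable [measurable]:
  "(cone_point :: real \<times> (real^'n) \<Rightarrow> _) \<in> borel_measurable (lborel \<Otimes>\<^sub>M lborel)"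
  unfolding lborel_prod measurable_lborel2
  by (intro borel_measurable_continuous_onI continuous_intros)

text \<open>Integrating the derivative of \<open>(1 - t) * \<psi> (z - t y)\<close> over \<open>t \<in> [0, 1]\<close> and averaging over \<open>y\<close>.\<close>
lemma test_fun_cone_average:
  fixes \<psi> :: "real^'n \<Rightarrow> real"
  assumes \<psi>: "test_fun \<Omega> \<psi>" and "0 < s"
  shows "\<psi> z = avg (lborel \<Otimes>\<^sub>M lborel) (cone_weight w s) cone_point \<psi> z
     + (\<Sum>i\<in>UNIV. avg (lborel \<Otimes>\<^sub>M lborel) (cone_grad_weight w s i) cone_point (pd i \<psi>) z)"
proof -
  let ?M = "lborel \<Otimes>\<^sub>M lborel :: (real \<times> (real^'n)) measure"
  define b where "b = measure lborel (cball w s)"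
  have b: "0 < b" using \<open>0 < s\<close> by (simp add: b_def)
  \<comment> \<open>The factor 1 - t vanishes at t = 1, so the boundary terms leave only
    \<open>\<psi> z\<close>.\<close>
  define G where "G y t = - ((1 - t) * \<psi> (z - t *\<^sub>R y))" for y t
  define G' where "G' y t = \<psi> (z - t *\<^sub>R y) + (1 - t) * (\<Sum>i\<in>UNIV. y $ i * pd i \<psi> (z - t *\<^sub>R y))" for y t
  have sm: "smooth_fun \<psi>" "smooth_fun (pd i \<psi>)" for i
    using test_fun_smooth[OF \<psi>] smooth_fun_pd by auto
  have contG: "isCont (G' y) t" for y t
  proof -
    have c: "isCont (\<lambda>t. \<phi> (z - t *\<^sub>R y)) t" if "smooth_fun \<phi>" for \<phi> :: "real^'n \<Rightarrow> real"
    proof (rule isCont_o2[where g = \<phi>])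
      show "isCont \<phi> (z - t *\<^sub>R y)"
        using smooth_fun_continuous[OF that, of UNIV] by (simp add: continuous_on_eq_continuous_at)
    qed (intro continuous_intros)
    show ?thesis unfolding G'_def by (intro continuous_intros c sm)
  qed
  have derG: "(G y has_real_derivative G' y t) (at t)" for y t
  proof -
    have "((\<lambda>t. \<psi> (z - t *\<^sub>R y)) has_derivative (\<lambda>h. \<Sum>i\<in>UNIV. (- (h *\<^sub>R y)) $ i * pd i \<psi> (z - t *\<^sub>R y))) (at t)"
      by (rule has_derivative_compose[OF _ has_derivative_pd[OF smooth_fun_differentiable[OF sm(1)]]])
        (auto intro!: derivative_eq_intros)
    then have "((\<lambda>t. \<psi> (z - t *\<^sub>R y)) has_real_derivative - (\<Sum>i\<in>UNIV. y $ i * pd i \<psi> (z - t *\<^sub>R y))) (at t)"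
      by (rule has_derivative_imp_has_field_derivative) (simp add: sum_distrib_left sum_negf mult_ac)
    then show ?thesis unfolding G_def G'_def
      by (auto intro!: derivative_eq_intros simp: algebra_simps)
  qed
  have FTC: "(\<integral>t. G' y t * indicator {0..1} t \<partial>lborel) = \<psi> z" for y
    using integral_FTC_Icc_real[of 0 1 "G y" "G' y"] derG contG by (simp add: G_def)
  note int = integrable_avg[OF \<psi> integrable_cone_weight cone_point_measurable, of w s z]
    integrable_avg[OF test_fun_pd[OF \<psi>] integrable_cone_grad_weight cone_point_measurable]
  have int_G: "integrable ?M (\<lambda>\<omega>. cone_weight w s \<omega> * G' (snd \<omega>) (fst \<omega>))"
  proof -
    have "integrable ?M (\<lambda>\<omega>. cone_weight w s \<omega> * \<psi> (z - cone_point \<omega>) + (\<Sum>i\<in>UNIV. cone_grad_weight w s i \<omega> * pd i \<psi> (z - cone_point \<omega>)))"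
      using int by simp
    then show ?thesis by (simp add: G'_def algebra_simps sum_distrib_left)
  qed
  have "avg ?M (cone_weight w s) cone_point \<psi> z + (\<Sum>i\<in>UNIV. avg ?M (cone_grad_weight w s i) cone_point (pd i \<psi>) z)
     = (\<integral>\<omega>. cone_weight w s \<omega> * \<psi> (z - cone_point \<omega>) + (\<Sum>i\<in>UNIV. cone_grad_weight w s i \<omega> * pd i \<psi> (z - cone_point \<omega>)) \<partial>?M)"
    unfolding avg_def using int by simp
  also have "\<dots> = (\<integral>\<omega>. cone_weight w s \<omega> * G' (snd \<omega>) (fst \<omega>) \<partial>?M)"
    by (intro Bochner_Integration.integral_cong) (auto simp: G'_def algebra_simps sum_distrib_left)
  also have "\<dots> = (\<integral>y. (\<integral>t. cone_weight w s (t, y) * G' y t \<partial>lborel) \<partial>lborel)"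
  proof -
    have eq: "(\<lambda>\<omega>. cone_weight w s \<omega> * G' (snd \<omega>) (fst \<omega>)) = (\<lambda>(t, y). cone_weight w s (t, y) * G' y t)"
      by (auto simp: fun_eq_iff)
    show ?thesis
      unfolding eq by (rule lborel_pair.integral_snd[symmetric]) (use int_G eq in simp)
  qed
  also have "\<dots> = (\<integral>y. indicator (cball w s) y * (\<psi> z / b) \<partial>lborel)"
  proof (rule Bochner_Integration.integral_cong)
    fix y
    have "(\<integral>t. cone_weight w s (t, y) * G' y t \<partial>lborel) = (\<integral>t. (indicator (cball w s) y / b) * (G' y t * indicator {0..1} t) \<partial>lborel)"
      by (intro Bochner_Integration.integral_cong) (auto simp: cone_weight_def b_def indicator_def)
    then show "(\<integral>t. cone_weight w s (t, y) * G' y t \<partial>lborel) = indicator (cball w s) y * (\<psi> z / b)"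
      by (simp add: FTC)
  qed simp
  also have "\<dots> = \<psi> z"
    using b by (simp add: b_def)
  finally show ?thesis by simp
qed

text \<open>Dual to the averaging identity for test functions: f is paired with that identity, the
  weak identity moves the derivative over to g, the averages are transposed, and the fundamental
  lemma concludes. The averages of a function supported in the box live on the box enlarged by the
  cone, which is why the weak identity is asked for there.\<close>

lemma cone_representation_box:
  fixes f :: "real^'n \<Rightarrow> real" and g :: "'n \<Rightarrow> real^'n \<Rightarrow> real"
  assumes f: "integrable lborel f" and g: "\<And>i. integrable lborel (g i)" and "0 < s"
    and weak: "\<And>\<phi> i. test_fun {x + h |x h. x \<in> cbox a b \<and> h \<in> cone_hull w s} \<phi> \<Longrightarrow>
      (\<integral>x. f x * pd i \<phi> x \<partial>lborel) = - (\<integral>x. g i x * \<phi> x \<partial>lborel)"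
  shows "AE x in lborel. x \<in> box a b \<longrightarrow>
     f x = translate_avg (lborel \<Otimes>\<^sub>M lborel) (cone_weight w s) cone_point f x
       - (\<Sum>i\<in>UNIV. translate_avg (lborel \<Otimes>\<^sub>M lborel) (cone_grad_weight w s i) cone_point (g i) x)"
proof -
  let ?M = "lborel \<Otimes>\<^sub>M lborel :: (real \<times> (real^'n)) measure"
  let ?K = "{x + h |x h. x \<in> cbox a b \<and> h \<in> cone_hull w s}"
  have M: "sigma_finite_measure ?M" by (simp add: lborel_prod sigma_finite_lborel)
  define S where "S = translate_avg ?M (cone_weight w s) cone_point f"
  define T where "T i = translate_avg ?M (cone_grad_weight w s i) cone_point (g i)" for i
  have S: "integrable lborel S" unfolding S_def
    by (intro integrable_translate_avg M integrable_cone_weight f) measurable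
  have T: "integrable lborel (T i)" for i unfolding T_def
    by (intro integrable_translate_avg M integrable_cone_grad_weight g) measurable
  have "AE x in lborel. x \<in> box a b \<longrightarrow> f x - S x + (\<Sum>i\<in>UNIV. T i x) = 0"
  proof (rule AE_zero_of_test_integrals)
    show "integrable lborel (\<lambda>x. f x - S x + (\<Sum>i\<in>UNIV. T i x))" using f S T by simp
    fix \<psi> :: "real^'n \<Rightarrow> real"
    assume sm: "smooth_fun \<psi>" and supp: "\<And>x. \<psi> x \<noteq> 0 \<Longrightarrow> x \<in> cbox a b"
    have \<psi>: "test_fun UNIV \<psi>" using sm supp by (intro test_fun_compact[of \<psi> "cbox a b"]) auto
    let ?A = "avg ?M (cone_weight w s) cone_point"
    let ?G = "\<lambda>i. avg ?M (cone_grad_weight w s i) cone_point"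
    have tA: "test_fun ?K (?A \<psi>)"
      by (rule test_fun_avg[OF sm compact_cbox supp integrable_cone_weight cone_point_measurable compact_cone_hull cone_point_in_hull]) auto
    have tG: "test_fun ?K (?G i \<psi>)" for i
      by (rule test_fun_avg[OF sm compact_cbox supp integrable_cone_grad_weight cone_point_measurable compact_cone_hull cone_point_in_hull]) auto
    have pdG: "pd i (?G i \<psi>) = ?G i (pd i \<psi>)" for i
      by (rule pd_avg[OF \<psi> integrable_cone_grad_weight cone_point_measurable])
    have iG: "integrable lborel (\<lambda>x. f x * ?G i (pd i \<psi>) x)" for i
      using integrable_mult_test[OF f test_fun_pd[OF tG[of i], of i]] by (simp add: pdG)
    have "(\<integral>x. f x * \<psi> x \<partial>lborel) = (\<integral>x. f x * ?A \<psi> x + (\<Sum>i\<in>UNIV. f x * ?G i (pd i \<psi>) x) \<partial>lborel)"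
      by (subst test_fun_cone_average[OF \<psi> \<open>0 < s\<close>, of _ w]) (simp add: distrib_left sum_distrib_left)
    also have "\<dots> = (\<integral>x. f x * ?A \<psi> x \<partial>lborel) + (\<Sum>i\<in>UNIV. \<integral>x. f x * ?G i (pd i \<psi>) x \<partial>lborel)"
      using iG integrable_mult_test[OF f tA] by simp
    also have "(\<integral>x. f x * ?A \<psi> x \<partial>lborel) = (\<integral>x. \<psi> x * S x \<partial>lborel)"
      unfolding S_def by (rule integral_avg_transpose[OF M integrable_cone_weight cone_point_measurable f \<psi>])
    also have "(\<Sum>i\<in>UNIV. \<integral>x. f x * ?G i (pd i \<psi>) x \<partial>lborel) = (\<Sum>i\<in>UNIV. - (\<integral>x. \<psi> x * T i x \<partial>lborel))"
    proof (rule sum.cong)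
      fix i
      have "(\<integral>x. g i x * ?G i \<psi> x \<partial>lborel) = (\<integral>x. \<psi> x * T i x \<partial>lborel)"
        unfolding T_def by (rule integral_avg_transpose[OF M integrable_cone_grad_weight cone_point_measurable g \<psi>])
      then show "(\<integral>x. f x * ?G i (pd i \<psi>) x \<partial>lborel) = - (\<integral>x. \<psi> x * T i x \<partial>lborel)"
        using weak[OF tG[of i], of i] by (simp add: pdG)
    qed simp
    finally have "(\<integral>x. f x * \<psi> x \<partial>lborel) = (\<integral>x. S x * \<psi> x \<partial>lborel) - (\<Sum>i\<in>UNIV. \<integral>x. T i x * \<psi> x \<partial>lborel)"
      by (simp add: sum_negf mult.commute)
    then show "(\<integral>x. (f x - S x + (\<Sum>i\<in>UNIV. T i x)) * \<psi> x \<partial>lborel) = 0"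
      using integrable_mult_test[OF f \<psi>] integrable_mult_test[OF S \<psi>] integrable_mult_test[OF T \<psi>]
      by (simp add: distrib_right left_diff_distrib sum_distrib_right)
  qed
  then show ?thesis unfolding S_def T_def by (auto elim!: eventually_mono)
qed

text \<open>If the integrand is not integrable, the Bochner integral is 0 by convention and the
  bound is trivial.\<close>

lemma ennreal_abs_translate_avg_le:
  "ennreal \<bar>translate_avg M c \<tau> h x\<bar> \<le> (\<integral>\<^sup>+\<omega>. ennreal (\<bar>c \<omega>\<bar> * \<bar>h (x + \<tau> \<omega>)\<bar>) \<partial>M)"
proof (cases "integrable M (\<lambda>\<omega>. c \<omega> * h (x + \<tau> \<omega>))")
  case True
  then show ?thesis using integral_norm_bound_ennreal[OF True] by (simp add: translate_avg_def abs_mult)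
qed (simp add: translate_avg_def not_integrable_integral_eq)

lemma cone_estimate_box:
  fixes f :: "real^'n \<Rightarrow> real" and g :: "'n \<Rightarrow> real^'n \<Rightarrow> real"
  assumes f: "integrable lborel f" and g: "\<And>i. integrable lborel (g i)" and "0 < s"
    and weak: "\<And>\<phi> i. test_fun {x + h |x h. x \<in> cbox a b \<and> h \<in> cone_hull w s} \<phi> \<Longrightarrow>
      (\<integral>x. f x * pd i \<phi> x \<partial>lborel) = - (\<integral>x. g i x * \<phi> x \<partial>lborel)"
    and small: "cball w s \<subseteq> cball 0 1"
  shows "AE x in lborel. x \<in> box a b \<longrightarrow>
     ennreal \<bar>f x\<bar> \<le> (\<integral>\<^sup>+\<omega>. ennreal (cone_weight w s \<omega> * (\<bar>f (x + cone_point \<omega>)\<bar> + (\<Sum>i\<in>UNIV. \<bar>g i (x + cone_point \<omega>)\<bar>))) \<partial>(lborel \<Otimes>\<^sub>M lborel))"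
proof (rule eventually_mono[OF cone_representation_box[OF f g \<open>0 < s\<close> weak]], assumption, intro impI)
  let ?M = "lborel \<Otimes>\<^sub>M lborel :: (real \<times> (real^'n)) measure"
  fix x
  note [measurable] = borel_measurable_integrable[OF f] borel_measurable_integrable[OF g]
  have wn: "0 \<le> cone_weight w s \<omega>" for \<omega> by (simp add: cone_weight_def)
  \<comment> \<open>The extra factor (1 - t) y_i is at most 1 in absolute value because the ball
    lies in the unit ball.\<close>
  have bound: "\<bar>cone_grad_weight w s i \<omega>\<bar> \<le> cone_weight w s \<omega>" for i \<omega>
  proof (cases "cone_weight w s \<omega> = 0")
    case False
    note nz = cone_weight_nonzero[OF False]
    then have "\<bar>snd \<omega> $ i\<bar> \<le> 1" using small component_le_norm_cart[of "snd \<omega>" i] by force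
    then have "\<bar>(1 - fst \<omega>) * snd \<omega> $ i\<bar> \<le> 1 * 1"
      unfolding abs_mult using nz by (intro mult_mono) auto
    then show ?thesis using wn[of \<omega>] by (simp add: abs_mult mult_left_le)
  qed simp
  have [measurable]: "cone_weight w s \<in> borel_measurable ?M" by (simp add: lborel_prod)
  assume "x \<in> box a b \<longrightarrow> f x = translate_avg ?M (cone_weight w s) cone_point f x
       - (\<Sum>i\<in>UNIV. translate_avg ?M (cone_grad_weight w s i) cone_point (g i) x)" and "x \<in> box a b"
  then have "\<bar>f x\<bar> \<le> \<bar>translate_avg ?M (cone_weight w s) cone_point f x\<bar> + (\<Sum>i\<in>UNIV. \<bar>translate_avg ?M (cone_grad_weight w s i) cone_point (g i) x\<bar>)"
    using sum_abs[of "\<lambda>i. translate_avg ?M (cone_grad_weight w s i) cone_point (g i) x" UNIV] by linarith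
  then have "ennreal \<bar>f x\<bar> \<le> ennreal \<bar>translate_avg ?M (cone_weight w s) cone_point f x\<bar> + (\<Sum>i\<in>UNIV. ennreal \<bar>translate_avg ?M (cone_grad_weight w s i) cone_point (g i) x\<bar>)"
    by (simp add: ennreal_plus[symmetric] sum_nonneg del: ennreal_plus)
  also have "\<dots> \<le> (\<integral>\<^sup>+\<omega>. ennreal (cone_weight w s \<omega> * \<bar>f (x + cone_point \<omega>)\<bar>) \<partial>?M) + (\<Sum>i\<in>UNIV. \<integral>\<^sup>+\<omega>. ennreal (cone_weight w s \<omega> * \<bar>g i (x + cone_point \<omega>)\<bar>) \<partial>?M)"
    using wn by (intro add_mono sum_mono order_trans[OF ennreal_abs_translate_avg_le] nn_integral_mono ennreal_leI mult_right_mono bound) auto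
  also have "\<dots> = (\<integral>\<^sup>+\<omega>. ennreal (cone_weight w s \<omega> * \<bar>f (x + cone_point \<omega>)\<bar>) + (\<Sum>i\<in>UNIV. ennreal (cone_weight w s \<omega> * \<bar>g i (x + cone_point \<omega>)\<bar>)) \<partial>?M)"
    by (subst nn_integral_add; (subst nn_integral_sum)?) auto
  also have "\<dots> = (\<integral>\<^sup>+\<omega>. ennreal (cone_weight w s \<omega> * (\<bar>f (x + cone_point \<omega>)\<bar> + (\<Sum>i\<in>UNIV. \<bar>g i (x + cone_point \<omega>)\<bar>))) \<partial>?M)"
    using wn by (intro nn_integral_cong) (simp add: distrib_left sum_distrib_left ennreal_plus[symmetric] sum_nonneg del: ennreal_plus)
  finally show "ennreal \<bar>f x\<bar> \<le> \<dots>" .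
qed

text \<open>Localisation. The points whose translated cone stays in \<Omega> form an open set, hence
  a countable union of closed boxes. Each box plus the cone is a compact subset K of \<Omega>;
  cutting f and g off outside K makes them integrable and leaves their pairing with test functions
  supported in K unchanged.\<close>

lemma cone_estimate:
  fixes f :: "real^'n \<Rightarrow> real" and g :: "'n \<Rightarrow> real^'n \<Rightarrow> real"
  assumes "open \<Omega>" and [measurable]: "f \<in> borel_measurable borel" "\<And>i. g i \<in> borel_measurable borel"
    and f: "\<And>K. compact K \<Longrightarrow> K \<subseteq> \<Omega> \<Longrightarrow> integrable lborel (\<lambda>x. indicator K x * f x)"
    and g: "\<And>K i. compact K \<Longrightarrow> K \<subseteq> \<Omega> \<Longrightarrow> integrable lborel (\<lambda>x. indicator K x * g i x)"
    and "0 < s"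
    and weak: "\<And>\<phi> i. test_fun \<Omega> \<phi> \<Longrightarrow> (\<integral>x. f x * pd i \<phi> x \<partial>lborel) = - (\<integral>x. g i x * \<phi> x \<partial>lborel)"
    and small: "cball w s \<subseteq> cball 0 1"
  shows "AE x in lborel. (\<forall>h\<in>cone_hull w s. x + h \<in> \<Omega>) \<longrightarrow>
     ennreal \<bar>f x\<bar> \<le> (\<integral>\<^sup>+\<omega>. ennreal (cone_weight w s \<omega> * (\<bar>f (x + cone_point \<omega>)\<bar> + (\<Sum>i\<in>UNIV. \<bar>g i (x + cone_point \<omega>)\<bar>))) \<partial>(lborel \<Otimes>\<^sub>M lborel))"
    (is "AE x in lborel. _ \<longrightarrow> ?E x")
proof -
  define U where "U = {x. \<forall>h\<in>cone_hull w s. x + h \<in> \<Omega>}"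
  have "- U = (\<Union>x\<in>- \<Omega>. \<Union>y\<in>cone_hull w s. {x - y})"
    by (auto simp: U_def algebra_simps)
  then have "closed (- U)"
    using closed_compact_differences[of "- \<Omega>" "cone_hull w s"] \<open>open \<Omega>\<close> compact_cone_hull[of w s] by (simp add: closed_Compl)
  then have "open U" by (simp add: closed_def)
  have "\<exists>\<D>. countable \<D> \<and> \<D> \<subseteq> Pow U \<and> (\<forall>X\<in>\<D>. \<exists>a b. X = cbox a b) \<and> \<Union>\<D> = U"
  proof (rule open_countable_Union_open_cbox[OF \<open>open U\<close>])
    fix \<D> assume 1: "countable \<D>" and 2: "\<D> \<subseteq> Pow U" and 3: "\<And>X. X \<in> \<D> \<Longrightarrow> \<exists>a b. X = cbox a b" and 4: "\<Union>\<D> = U"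
    show ?thesis by (rule exI[of _ \<D>]) (intro conjI ballI 1 2 3 4)
  qed
  then obtain \<D> where \<D>: "countable \<D>" "\<D> \<subseteq> Pow U" "\<forall>X\<in>\<D>. \<exists>a b. X = cbox a b" "\<Union>\<D> = U"
    by auto
  have "AE x in lborel. x \<in> X \<longrightarrow> ?E x" if "X \<in> \<D>" for X
  proof -
    obtain a b where X: "X = cbox a b" using \<D>(3) \<open>X \<in> \<D>\<close> by blast
    define K where "K = {x + h |x h. x \<in> cbox a b \<and> h \<in> cone_hull w s}"
    have K: "compact K" "K \<subseteq> \<Omega>"
      using \<D>(2) \<open>X \<in> \<D>\<close> compact_sums[OF compact_cbox compact_cone_hull, of a b w s] unfolding K_def X U_def by auto
    have sub: "indicator K x * (\<phi> x :: real) = \<phi> x" if "test_fun K \<phi>" for \<phi> and x :: "real^'n"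
      using that closure_subset[of "{x. \<phi> x \<noteq> 0}"] by (auto simp: test_fun_def indicator_def)
    have "AE x in lborel. x \<in> box a b \<longrightarrow>
      ennreal \<bar>indicator K x * f x\<bar> \<le> (\<integral>\<^sup>+\<omega>. ennreal (cone_weight w s \<omega> * (\<bar>indicator K (x + cone_point \<omega>) * f (x + cone_point \<omega>)\<bar>
        + (\<Sum>i\<in>UNIV. \<bar>indicator K (x + cone_point \<omega>) * g i (x + cone_point \<omega>)\<bar>))) \<partial>(lborel \<Otimes>\<^sub>M lborel))"
    proof (rule cone_estimate_box[OF f[OF K] g[OF K] \<open>0 < s\<close> _ small])
      fix \<phi> :: "real^'n \<Rightarrow> real" and i
      assume "test_fun {x + h |x h. x \<in> cbox a b \<and> h \<in> cone_hull w s} \<phi>"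
      then have \<phi>: "test_fun K \<phi>" by (simp add: K_def)
      have "(\<integral>x. indicator K x * f x * pd i \<phi> x \<partial>lborel) = (\<integral>x. f x * (indicator K x * pd i \<phi> x) \<partial>lborel)"
        "(\<integral>x. indicator K x * g i x * \<phi> x \<partial>lborel) = (\<integral>x. g i x * (indicator K x * \<phi> x) \<partial>lborel)"
        by (intro Bochner_Integration.integral_cong; simp)+
      then show "(\<integral>x. indicator K x * f x * pd i \<phi> x \<partial>lborel) = - (\<integral>x. indicator K x * g i x * \<phi> x \<partial>lborel)"
        using weak[OF test_fun_mono[OF \<phi> K(2)], of i] by (simp add: sub[OF \<phi>] sub[OF test_fun_pd[OF \<phi>]])
    qed
    \<comment> \<open>The cover consists of closed boxes and the estimate holds on open ones; the
      faces are null sets.\<close>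
    moreover have "AE x in lborel. x \<in> cbox a b \<longrightarrow> x \<in> box a b"
    proof -
      have "AE x in lebesgue. x \<notin> cbox a b - box a b"
        using negligible_frontier_interval[of a b] by (intro AE_not_in) (simp add: negligible_iff_null_sets)
      then show ?thesis by (auto simp: AE_completion_iff)
    qed
    ultimately show ?thesis
    proof eventually_elim
      case (elim x)
      show ?case
      proof
        assume "x \<in> X"
        then have x: "x \<in> cbox a b" "x \<in> box a b" using elim X by auto
        \<comment> \<open>The apex 0 belongs to the cone, so the cutoff does not change the value at
          x.\<close>
        have "x + 0 \<in> K" unfolding K_def using x cone_hull_zero[of s w] \<open>0 < s\<close> by fastforce
        then have "ennreal \<bar>f x\<bar> = ennreal \<bar>indicator K x * f x\<bar>" by simp
        also have "\<dots> \<le> (\<integral>\<^sup>+\<omega>. ennreal (cone_weight w s \<omega> * (\<bar>indicator K (x + cone_point \<omega>) * f (x + cone_point \<omega>)\<bar>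
          + (\<Sum>i\<in>UNIV. \<bar>indicator K (x + cone_point \<omega>) * g i (x + cone_point \<omega>)\<bar>))) \<partial>(lborel \<Otimes>\<^sub>M lborel))"
          using elim x by blast
        also have "\<dots> \<le> (\<integral>\<^sup>+\<omega>. ennreal (cone_weight w s \<omega> * (\<bar>f (x + cone_point \<omega>)\<bar> + (\<Sum>i\<in>UNIV. \<bar>g i (x + cone_point \<omega>)\<bar>))) \<partial>(lborel \<Otimes>\<^sub>M lborel))"
          by (intro nn_integral_mono ennreal_leI mult_left_mono add_mono sum_mono) (auto simp: indicator_def cone_weight_def)
        finally show "?E x" .
      qed
    qed
  qed
  then have "AE x in lborel. \<forall>X\<in>\<D>. x \<in> X \<longrightarrow> ?E x"
    unfolding AE_ball_countable[OF \<D>(1)] by (intro ballI)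
  then show ?thesis
  proof eventually_elim
    case (elim x)
    then show ?case using \<D>(4) unfolding U_def by blast
  qed
qed

section \<open>Consequences of the cone condition\<close>

text \<open>A point within \<eta> h of the axis point at distance h makes an angle with the axis
  whose cosine is at least (1 - \<eta>) / (1 + \<eta>), and the bound on \<eta> makes this at least
  \<open>\<bar>cos (\<kappa> / 2)\<bar>\<close>. Scaling by t > 0 does not change the angle.\<close>

lemma fin_cone_contains_multiples:
  fixes v z :: "real^'n"
  assumes "v \<noteq> 0" "0 < h" "2 * h \<le> \<rho>" "0 < \<kappa>" "\<kappa> < pi"
    and \<eta>: "0 \<le> \<eta>" "\<eta> \<le> (1 - \<bar>cos (\<kappa> / 2)\<bar>) / 2"
    and z: "norm (z - (h / norm v) *\<^sub>R v) \<le> \<eta> * h" and t: "0 \<le> t" "t \<le> 1"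
  shows "t *\<^sub>R z \<in> fin_cone \<rho> v \<kappa>"
proof -
  define \<gamma> where "\<gamma> = \<bar>cos (\<kappa> / 2)\<bar>"
  define u where "u = (1 / norm v) *\<^sub>R v"
  have u: "norm u = 1" using \<open>v \<noteq> 0\<close> by (simp add: u_def)
  have \<gamma>: "0 \<le> \<gamma>" "\<gamma> \<le> 1" by (auto simp: \<gamma>_def)
  have \<eta>1: "\<eta> \<le> 1 / 2" using \<eta> \<gamma> by (simp add: \<gamma>_def)
  have zu: "norm (z - h *\<^sub>R u) \<le> \<eta> * h" using z by (simp add: u_def)
  have "\<bar>(z - h *\<^sub>R u) \<bullet> u\<bar> \<le> \<eta> * h"
    using Cauchy_Schwarz_ineq2[of "z - h *\<^sub>R u" u] zu u by simp
  moreover have "(z - h *\<^sub>R u) \<bullet> u = z \<bullet> u - h"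
    using u by (simp add: inner_diff_left dot_square_norm)
  ultimately have "h - \<eta> * h \<le> z \<bullet> u" by linarith
  then have dot: "(1 - \<eta>) * h \<le> z \<bullet> u" by (simp add: left_diff_distrib)
  have nz: "norm z \<le> (1 + \<eta>) * h"
    using norm_triangle_sub[of z "h *\<^sub>R u"] zu u \<open>0 < h\<close> by (simp add: algebra_simps)
  show ?thesis
  proof (cases "t = 0")
    case False
    then have "0 < t" using t by simp
    have "0 < (1 - \<eta>) * h" using \<eta>1 \<open>0 < h\<close> by (intro mult_pos_pos) auto
    then have "0 < z \<bullet> u" using dot by linarith
    then have "z \<noteq> 0" by auto
    have "\<eta> * (1 + \<gamma>) \<le> (1 - \<gamma>) / 2 * 2"
      using \<eta> \<gamma> by (intro mult_mono) (auto simp: \<gamma>_def)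
    then have "\<gamma> * (1 + \<eta>) \<le> 1 - \<eta>" by (simp add: algebra_simps)
    have "\<gamma> * norm z \<le> \<gamma> * ((1 + \<eta>) * h)" using nz \<gamma> by (intro mult_left_mono)
    also have "\<dots> \<le> (1 - \<eta>) * h"
      using \<open>\<gamma> * (1 + \<eta>) \<le> 1 - \<eta>\<close> \<open>0 < h\<close> by (simp add: mult.assoc[symmetric] mult_right_mono)
    also have "\<dots> \<le> z \<bullet> u" by (rule dot)
    finally have "\<gamma> \<le> (z \<bullet> u) / norm z" using \<open>z \<noteq> 0\<close> by (simp add: pos_le_divide_eq)
    also have "(z \<bullet> u) / norm z = ((t *\<^sub>R z) \<bullet> v) / (norm (t *\<^sub>R z) * norm v)"
      using \<open>0 < t\<close> by (simp add: u_def)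
    finally have "cos (\<kappa> / 2) \<le> ((t *\<^sub>R z) \<bullet> v) / (norm (t *\<^sub>R z) * norm v)" (is "_ \<le> ?q")
      by (simp add: \<gamma>_def)
    moreover have "\<bar>?q\<bar> \<le> 1"
      using Cauchy_Schwarz_ineq2[of "t *\<^sub>R z" v] \<open>z \<noteq> 0\<close> \<open>0 < t\<close> \<open>v \<noteq> 0\<close> by (simp add: abs_divide divide_le_eq_1_pos abs_mult)
    ultimately have "arccos ?q \<le> arccos (cos (\<kappa> / 2))"
      by (subst arccos_le_mono) auto
    also have "\<dots> = \<kappa> / 2" using assms by (intro arccos_cos) auto
    finally have "arccos ?q \<le> \<kappa> / 2" .
    moreover have "norm (t *\<^sub>R z) \<le> \<rho>"
    proof -
      have "norm (t *\<^sub>R z) \<le> norm z" using t by (simp add: mult_left_le_one_le)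
      also have "\<dots> \<le> (1 + \<eta>) * h" by (rule nz)
      also have "\<dots> \<le> 2 * h" using \<eta>1 \<open>0 < h\<close> by (intro mult_right_mono) auto
      finally show ?thesis using assms by simp
    qed
    ultimately show ?thesis using \<open>z \<noteq> 0\<close> \<open>0 < t\<close> by (simp add: fin_cone_def)
  qed (simp add: fin_cone_def)
qed

text \<open>Finitely many thick segments suffice: far from the origin they come from the cone condition and
  are short; near the origin they point outwards.\<close>
lemma cone_condition_segments:
  fixes \<Omega> :: "(real^'n) set"
  assumes "open \<Omega>" "cone_condition \<Omega>" "0 \<in> \<Omega>"
  shows "\<exists>W s c. finite W \<and> 0 < s \<and> 0 < c \<and> c \<le> 1 \<and> (\<forall>w\<in>W. cball w s \<subseteq> cball 0 1) \<and>
    (\<forall>x\<in>\<Omega>. x \<noteq> 0 \<longrightarrow> (\<exists>w\<in>W. \<forall>t\<in>{0..1}. \<forall>y\<in>cball w s.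
       x + t *\<^sub>R y \<in> \<Omega> \<and> c * norm x \<le> norm (x + t *\<^sub>R y) \<and> c * t \<le> norm (x + t *\<^sub>R y)))"
proof -
  obtain \<rho> and v :: "real^'n" and \<kappa> where cone: "0 < \<rho>" "v \<noteq> 0" "0 < \<kappa>" "\<kappa> < pi"
    "\<And>x. x \<in> \<Omega> \<Longrightarrow> \<exists>T::real^'n \<Rightarrow> real^'n. orthogonal_transformation T \<and> (\<lambda>y. x + T y) ` fin_cone \<rho> v \<kappa> \<subseteq> \<Omega>"
    using assms(2) unfolding cone_condition_def by blast
  obtain R where R: "0 < R" "ball 0 R \<subseteq> \<Omega>" using assms(1,3) open_contains_ball by blast
  \<comment> \<open>The length of the axis segments: 1/2 keeps the balls in the unit ball, \<rho>/2
    keeps them in the given cone, and R/8 makes every displacement at most R/4, half of the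
    threshold R/2 that separates the two cases below.\<close>
  define h where "h = min (1 / 2) (min (\<rho> / 2) (R / 8))"
  have h: "0 < h" "h \<le> 1 / 2" "2 * h \<le> \<rho>" "h \<le> R / 8" using cone R by (auto simp: h_def)
  define \<eta> where "\<eta> = (1 - \<bar>cos (\<kappa> / 2)\<bar>) / 2"
  have "\<bar>cos (\<kappa> / 2)\<bar> < 1"
  proof -
    have "0 < cos (\<kappa> / 2)" using cone by (intro cos_gt_zero_pi) auto
    moreover have "cos (\<kappa> / 2) < cos 0" using cone by (intro cos_monotone_0_pi) auto
    ultimately show ?thesis by simp
  qed
  then have \<eta>: "0 < \<eta>" "\<eta> \<le> 1 / 2" by (auto simp: \<eta>_def)
  \<comment> \<open>If a net point is within s of h u, its ball of radius s is within 2 s = \<eta> h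
    of h u, the tolerance allowed by the cone.\<close>
  define s where "s = \<eta> * h / 2"
  have s: "0 < s" "2 * s = \<eta> * h" "2 * s \<le> h / 2"
    using \<eta> h mult_right_mono[OF \<eta>(2), of h] by (auto simp: s_def)
  obtain k where k: "finite k" "sphere (0::real^'n) h \<subseteq> (\<Union>x\<in>k. ball x s)"
    using compact_sphere[of "0::real^'n" h] s(1) unfolding compact_eq_totally_bounded by blast
  \<comment> \<open>Total boundedness gives centres that may lie far from the sphere. Those in use
    lie near it, and the restriction keeps all balls in the unit ball.\<close>
  define W where "W = {w \<in> k. norm w \<le> h + s}"
  \<comment> \<open>1/2 and R/4 are the lower bounds obtained far from the origin; h/2 is the least
    outward speed near it.\<close>
  define c where "c = min (1 / 2) (min (R / 4) (h / 2))"
  have c: "0 < c" "c \<le> 1 / 2" "c \<le> R / 4" "c \<le> h / 2" using h R by (auto simp: c_def)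
  have dir: "\<exists>w\<in>W. \<forall>y\<in>cball w s. norm (y - h *\<^sub>R u) \<le> 2 * s" if "norm u = 1" for u :: "real^'n"
  proof -
    have "h *\<^sub>R u \<in> sphere 0 h" using that h by simp
    from subsetD[OF k(2) this] obtain w where w: "w \<in> k" "dist w (h *\<^sub>R u) < s" by auto
    have "norm w \<le> norm (h *\<^sub>R u) + dist w (h *\<^sub>R u)" unfolding dist_norm by (rule norm_triangle_sub)
    then have "w \<in> W" using w that h by (simp add: W_def)
    moreover have "norm (y - h *\<^sub>R u) \<le> 2 * s" if "y \<in> cball w s" for y
      using that w(2) dist_triangle[of y "h *\<^sub>R u" w] by (simp add: dist_norm[symmetric] dist_commute)
    ultimately show ?thesis by blast
  qed
  have small: "norm y \<le> 2 * h" if "norm (y - h *\<^sub>R u) \<le> 2 * s" "norm u = 1" for u y :: "real^'n"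
  proof -
    have "norm y \<le> norm (h *\<^sub>R u) + norm (y - h *\<^sub>R u)" by (rule norm_triangle_sub)
    moreover have "norm (h *\<^sub>R u) = h" using that h by simp
    ultimately show ?thesis using that(1) s(3) h(1) by linarith
  qed
  have main: "\<exists>w\<in>W. \<forall>t\<in>{0..1}. \<forall>y\<in>cball w s.
       x + t *\<^sub>R y \<in> \<Omega> \<and> c * norm x \<le> norm (x + t *\<^sub>R y) \<and> c * t \<le> norm (x + t *\<^sub>R y)"
    if x: "x \<in> \<Omega>" "x \<noteq> 0" for x
  proof (cases "norm x < R / 2")
    case True
    \<comment> \<open>Near the origin the direction is that of x, so the radial component grows with
      t, while the path stays in the ball of radius R.\<close>
    define u where "u = (1 / norm x) *\<^sub>R x"
    have u: "norm u = 1" "x \<bullet> u = norm x" using x by (auto simp: u_def power2_norm_eq_inner[symmetric] power2_eq_square)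
    obtain w where w: "w \<in> W" "\<And>y. y \<in> cball w s \<Longrightarrow> norm (y - h *\<^sub>R u) \<le> 2 * s" using dir[OF u(1)] by blast
    have "x + t *\<^sub>R y \<in> \<Omega> \<and> c * norm x \<le> norm (x + t *\<^sub>R y) \<and> c * t \<le> norm (x + t *\<^sub>R y)"
      if t: "t \<in> {0..1}" and y: "y \<in> cball w s" for t y
    proof -
      note yu = w(2)[OF y]
      have "norm (t *\<^sub>R y) \<le> norm y" using t by (simp add: mult_left_le_one_le)
      then have "norm (x + t *\<^sub>R y) < R"
        using norm_triangle_ineq[of x "t *\<^sub>R y"] small[OF yu u(1)] True h by linarith
      then have in\<Omega>: "x + t *\<^sub>R y \<in> \<Omega>" using R(2) by auto
      have "\<bar>(y - h *\<^sub>R u) \<bullet> u\<bar> \<le> 2 * s"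
        using Cauchy_Schwarz_ineq2[of "y - h *\<^sub>R u" u] yu u by simp
      moreover have "(y - h *\<^sub>R u) \<bullet> u = y \<bullet> u - h"
        using u by (simp add: inner_diff_left dot_square_norm)
      ultimately have "h / 2 \<le> y \<bullet> u" using s by linarith
      then have "t * (h / 2) \<le> t * (y \<bullet> u)" using t by (intro mult_left_mono) auto
      moreover have "(x + t *\<^sub>R y) \<bullet> u \<le> norm (x + t *\<^sub>R y)"
        using norm_cauchy_schwarz[of "x + t *\<^sub>R y" u] u by simp
      ultimately have ge: "norm x + t * (h / 2) \<le> norm (x + t *\<^sub>R y)"
        by (simp add: inner_add_left u)
      have "c * norm x \<le> norm x" "0 \<le> t * (h / 2)" "c * t \<le> t * (h / 2)"
        using c t h mult_right_mono[of c "h / 2" t] by (auto simp: mult_left_le_one_le mult.commute)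
      moreover have "0 \<le> norm x" by simp
      ultimately show ?thesis using in\<Omega> ge by (intro conjI) linarith+
    qed
    then show ?thesis using w(1) by blast
  next
    case False
    obtain T :: "real^'n \<Rightarrow> real^'n" where T: "orthogonal_transformation T" "(\<lambda>y. x + T y) ` fin_cone \<rho> v \<kappa> \<subseteq> \<Omega>"
      using cone(5)[OF x(1)] by blast
    \<comment> \<open>Away from the origin the direction is the axis of the congruent cone. As the
      displacement is at most R/4 and \<open>norm x \<ge> R / 2\<close>, at least half of
      \<open>norm x\<close> survives.\<close>
    define u where "u = T ((1 / norm v) *\<^sub>R v)"
    have u: "norm u = 1" using cone T(1) by (simp add: u_def orthogonal_transformation_norm)
    obtain w where w: "w \<in> W" "\<And>y. y \<in> cball w s \<Longrightarrow> norm (y - h *\<^sub>R u) \<le> 2 * s" using dir[OF u] by blast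
    have "x + t *\<^sub>R y \<in> \<Omega> \<and> c * norm x \<le> norm (x + t *\<^sub>R y) \<and> c * t \<le> norm (x + t *\<^sub>R y)"
      if t: "t \<in> {0..1}" and y: "y \<in> cball w s" for t y
    proof -
      note yu = w(2)[OF y]
      interpret T: linear T using T(1) by (simp add: orthogonal_transformation_def)
      obtain z where z: "y = T z" using orthogonal_transformation_surj[OF T(1)] by (metis surjD)
      have "y - h *\<^sub>R u = T (z - (h / norm v) *\<^sub>R v)"
        by (simp add: z u_def T.diff T.scaleR)
      then have "norm (z - (h / norm v) *\<^sub>R v) \<le> \<eta> * h"
        using yu s(2) T(1) by (simp add: orthogonal_transformation_norm)
      then have "t *\<^sub>R z \<in> fin_cone \<rho> v \<kappa>"
        using t cone h \<eta> by (intro fin_cone_contains_multiples[of v h \<rho> \<kappa> \<eta>]) (auto simp: \<eta>_def)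
      then have "x + T (t *\<^sub>R z) \<in> \<Omega>" using T(2) by blast
      then have in\<Omega>: "x + t *\<^sub>R y \<in> \<Omega>" by (simp add: z T.scaleR)
      have "norm (t *\<^sub>R y) \<le> norm y" using t by (simp add: mult_left_le_one_le)
      then have "norm x - R / 4 \<le> norm (x + t *\<^sub>R y)"
        using norm_triangle_ineq2[of x "- (t *\<^sub>R y)"] small[OF yu u] h by simp
      then have ge: "norm x / 2 \<le> norm (x + t *\<^sub>R y)" "R / 4 \<le> norm (x + t *\<^sub>R y)" using False by auto
      have "c * norm x \<le> norm x / 2" "c * t \<le> R / 4"
        using c t mult_right_mono[OF c(2), of "norm x"] mult_mono[of c "R / 4" t 1] R by auto
      then show ?thesis using in\<Omega> ge by linarith
    qed
    then show ?thesis using w(1) by blast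
  qed
  have sub: "cball w s \<subseteq> cball 0 1" if "w \<in> W" for w
  proof
    fix y assume "y \<in> cball w s"
    then have "norm y \<le> norm w + s" using norm_triangle_sub[of y w] by (simp add: dist_norm norm_minus_commute)
    moreover have "norm w \<le> h + s" using that by (simp add: W_def)
    ultimately have "norm y \<le> 1" using s(3) h(2) by linarith
    then show "y \<in> cball 0 1" by simp
  qed
  show ?thesis
    by (rule exI[of _ W], rule exI[of _ s], rule exI[of _ c]) (use k c s sub main in \<open>auto simp: W_def\<close>)
qed

section \<open>The cone potential on annuli\<close>

text \<open>The L^p norm for nonnegative extended functions over \<open>lborel\<close>; potentials
  may enter it before they are known to be finite.\<close>

definition lnorm :: "real \<Rightarrow> ('a::euclidean_space \<Rightarrow> ennreal) \<Rightarrow> ennreal" where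
  "lnorm p g = enn_rpow (\<integral>\<^sup>+x. enn_rpow (g x) p \<partial>lborel) (1 / p)"

lemma lnorm_mono: "0 < p \<Longrightarrow> (\<And>x. f x \<le> g x) \<Longrightarrow> lnorm p f \<le> lnorm p g"
  unfolding lnorm_def by (intro enn_rpow_mono nn_integral_mono) auto

lemma lnorm_mono_AE: "0 < p \<Longrightarrow> AE x in lborel. f x \<le> g x \<Longrightarrow> lnorm p f \<le> lnorm p g"
  unfolding lnorm_def by (intro enn_rpow_mono nn_integral_mono_AE) (auto elim!: eventually_mono intro: enn_rpow_mono)

lemma lnorm_cmult:
  assumes "0 < p" and [measurable]: "g \<in> borel_measurable borel"
  shows "lnorm p (\<lambda>x. c * g x) = c * lnorm p g"
  using assms(1) by (simp add: lnorm_def enn_rpow_mult nn_integral_cmult enn_rpow_cancel)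

lemma lnorm_sum_le:
  assumes "0 < p" "finite I" and [measurable]: "\<And>i. i \<in> I \<Longrightarrow> g i \<in> borel_measurable borel"
  shows "lnorm p (\<lambda>x. \<Sum>i\<in>I. g i x) \<le> ennreal (real (card I) * real (card I) powr (1 / p)) * (\<Sum>i\<in>I. lnorm p (g i))"
proof -
  have p: "0 < 1 / p" using assms by simp
  have "(\<integral>\<^sup>+x. enn_rpow (\<Sum>i\<in>I. g i x) p \<partial>lborel) \<le> (\<integral>\<^sup>+x. ennreal (real (card I) powr p) * (\<Sum>i\<in>I. enn_rpow (g i x) p) \<partial>lborel)"
    by (intro nn_integral_mono enn_rpow_sum_le assms)
  also have "\<dots> = ennreal (real (card I) powr p) * (\<Sum>i\<in>I. \<integral>\<^sup>+x. enn_rpow (g i x) p \<partial>lborel)"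
    by (simp add: nn_integral_cmult nn_integral_sum)
  finally have "lnorm p (\<lambda>x. \<Sum>i\<in>I. g i x) \<le> ennreal ((real (card I) powr p) powr (1 / p)) * enn_rpow (\<Sum>i\<in>I. \<integral>\<^sup>+x. enn_rpow (g i x) p \<partial>lborel) (1 / p)"
    unfolding lnorm_def by (intro enn_rpow_le_cmult[OF p powr_ge_zero])
  also have "\<dots> \<le> ennreal ((real (card I) powr p) powr (1 / p)) * (ennreal (real (card I) powr (1 / p)) * (\<Sum>i\<in>I. lnorm p (g i)))"
    unfolding lnorm_def by (intro mult_left_mono enn_rpow_sum_le assms p) auto
  also have "\<dots> = ennreal (real (card I) * real (card I) powr (1 / p)) * (\<Sum>i\<in>I. lnorm p (g i))"
    using assms by (simp add: powr_powr ennreal_mult mult.assoc)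
  finally show ?thesis .
qed

lemma lnorm_const_indicator:
  assumes "0 < p" "A \<in> sets lborel"
  shows "lnorm p (\<lambda>x. c * indicator A x) = c * enn_rpow (emeasure lborel A) (1 / p)"
proof -
  have "enn_rpow (c * indicator A x) p = enn_rpow c p * indicator A x" for x
    using assms by (simp add: indicator_def)
  then show ?thesis
    using assms by (simp add: lnorm_def nn_integral_cmult_indicator enn_rpow_mult enn_rpow_cancel)
qed

lemma lnorm_frac_integral_le:
  assumes "1 < p" "0 < \<sigma>" "0 < q" "DIM('a::euclidean_space) / q = DIM('a) / p - \<sigma>"
  shows "\<exists>C\<ge>0. \<forall>g :: 'a \<Rightarrow> ennreal. g \<in> borel_measurable borel \<longrightarrow> lnorm q (frac_integral \<sigma> g) \<le> ennreal C * lnorm p g"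
  using frac_integral_bounded[OF assms] unfolding lnorm_def by blast

lemma ennreal_mult_inverse_cancel:
  assumes "a * b = 1" "0 \<le> a" "0 \<le> b"
  shows "ennreal a * (ennreal b * x) = x"
  using assms by (simp add: mult.assoc[symmetric] ennreal_mult[symmetric])

text \<open>The normalised estimate extended by homogeneity. If the norm vanishes, g is zero almost
  everywhere, and so is its dilate.\<close>

lemma ball_integral_le_lnorm:
  fixes g :: "'a::euclidean_space \<Rightarrow> ennreal"
  assumes [measurable]: "g \<in> borel_measurable borel" and p: "1 < p" and t: "0 < t"
  shows "ball_integral t g x \<le> ennreal ((measure lborel (cball (0::'a) 1) + 1) * t powr - (DIM('a) / p)) * lnorm p g"
    (is "_ \<le> ennreal ?B * _")
proof (cases "lnorm p g")
  case (real N)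
  show ?thesis
  proof (cases "N = 0")
    case True
    then have "(\<integral>\<^sup>+x. enn_rpow (g x) p \<partial>lborel) = 0"
      using real by (simp add: lnorm_def enn_rpow_eq_0_iff)
    then have "AE x in lborel. g x = 0"
      by (subst (asm) nn_integral_0_iff_AE) (auto simp: enn_rpow_eq_0_iff)
    then have "(\<integral>\<^sup>+y. g y \<partial>lborel) = 0" by (simp add: nn_integral_0_iff_AE)
    moreover have "ball_integral t g x \<le> (\<integral>\<^sup>+y. g (x + t *\<^sub>R y) \<partial>lborel)"
      unfolding ball_integral_def by (intro nn_integral_mono) (auto simp: indicator_def)
    ultimately show ?thesis by (simp add: nn_integral_lborel_dilate[OF _ t])
  next
    case False
    then have N: "0 < N" using real by simp
    have "lnorm p (\<lambda>x. ennreal (1 / N) * g x) = 1"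
      using real p N by (subst lnorm_cmult) (auto simp: ennreal_mult[symmetric])
    then have "enn_rpow (lnorm p (\<lambda>x. ennreal (1 / N) * g x)) p = 1"
      using enn_rpow_ennreal[of 1 p] by simp
    then have "(\<integral>\<^sup>+x. enn_rpow (ennreal (1 / N) * g x) p \<partial>lborel) = 1"
      using p unfolding lnorm_def by (subst (asm) enn_rpow_cancel) auto
    then have "ball_integral t (\<lambda>x. ennreal (1 / N) * g x) x \<le> ennreal ?B"
      using p t by (intro ball_integral_le) auto
    then have "ennreal N * (ennreal (1 / N) * ball_integral t g x) \<le> ennreal N * ennreal ?B"
      by (intro mult_left_mono) (auto simp: ball_integral_cmult)
    moreover have "ennreal N * (ennreal (1 / N) * ball_integral t g x) = ball_integral t g x"
      using N by (intro ennreal_mult_inverse_cancel) auto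
    ultimately show ?thesis unfolding real(2) by (simp only: mult.commute)
  qed
next
  case top
  have "0 < ?B" using t by (auto intro!: mult_pos_pos add_nonneg_pos)
  then have "ennreal ?B \<noteq> 0" by (simp only: ennreal_eq_0_iff not_le)
  then show ?thesis unfolding top by (simp only: ennreal_mult_top if_False top_greatest)
qed

section \<open>Dyadic annuli\<close>

lemma annulus_borel [measurable]: "annulus k \<in> sets borel"
  unfolding annulus_def by measurable

text \<open>The index is one more than the floor of \<open>log 2 (norm z)\<close>, since
  \<open>annulus k\<close> starts at radius \<open>2 powr (k - 1)\<close>.\<close>

lemma annulus_ex1:
  assumes "(z :: real^'n) \<noteq> 0"
  shows "\<exists>j0. \<forall>j. z \<in> annulus j \<longleftrightarrow> j = j0"
proof -
  have "z \<in> annulus j \<longleftrightarrow> real_of_int (j - 1) \<le> log 2 (norm z) \<and> log 2 (norm z) < real_of_int (j - 1) + 1" for j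
    using assms by (simp add: annulus_def le_log_iff log_less_iff)
  then have "z \<in> annulus j \<longleftrightarrow> \<lfloor>log 2 (norm z)\<rfloor> = j - 1" for j
    unfolding floor_eq_iff by blast
  moreover have "\<lfloor>log 2 (norm z)\<rfloor> = j - 1 \<longleftrightarrow> j = \<lfloor>log 2 (norm z)\<rfloor> + 1" for j by arith
  ultimately have "\<forall>j. z \<in> annulus j \<longleftrightarrow> j = \<lfloor>log 2 (norm z)\<rfloor> + 1" by simp
  then show ?thesis by (rule exI)
qed

lemma sum_over_annuli:
  assumes "(z :: real^'n) \<noteq> 0"
  shows "(\<integral>\<^sup>+j. a * indicator (annulus j) z \<partial>count_space UNIV) = a"
proof -
  obtain j0 where "\<And>j. z \<in> annulus j \<longleftrightarrow> j = j0" using annulus_ex1[OF assms] by blast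
  then have "(\<lambda>j. a * indicator (annulus j) z) = (\<lambda>j. a * indicator {j0} j)" by (auto simp: indicator_def)
  then show ?thesis by (simp add: nn_integral_cmult_indicator)
qed

text \<open>Scaling by \<open>2 powr - k\<close> moves the annulus into the unit ball.\<close>

lemma emeasure_annulus_le:
  fixes k :: int
  shows "emeasure lborel (annulus k :: (real^'n) set) \<le> ennreal (measure lborel (cball (0::real^'n) 1) * 2 powr (k * CARD('n)))"
proof -
  define r where "r = (2::real) powr k"
  have r: "0 < r" by (simp add: r_def)
  have "indicator (annulus k) (r *\<^sub>R y) \<le> (indicator (cball 0 1) y :: ennreal)" for y :: "real^'n"
    using r by (auto simp: indicator_def annulus_def r_def)
  then have "(\<integral>\<^sup>+y. indicator (annulus k) (0 + r *\<^sub>R (y :: real^'n)) \<partial>lborel) \<le> (\<integral>\<^sup>+y. indicator (cball (0::real^'n) 1) y \<partial>lborel)"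
    by - (rule nn_integral_mono, simp)
  also have "(\<integral>\<^sup>+y. indicator (annulus k) (0 + r *\<^sub>R (y :: real^'n)) \<partial>lborel) = ennreal (r powr - real CARD('n)) * emeasure lborel (annulus k :: (real^'n) set)"
    using r by (subst nn_integral_lborel_dilate) auto
  also have "(\<integral>\<^sup>+y. indicator (cball (0::real^'n) 1) y \<partial>lborel) = ennreal (measure lborel (cball (0::real^'n) 1))"
    using emeasure_lborel_cball_finite[of "0::real^'n" 1] by (simp add: emeasure_eq_ennreal_measure)
  finally have "ennreal (r powr CARD('n)) * (ennreal (r powr - real CARD('n)) * emeasure lborel (annulus k :: (real^'n) set))
    \<le> ennreal (r powr CARD('n)) * ennreal (measure lborel (cball (0::real^'n) 1))"
    by (intro mult_left_mono) auto
  moreover have "ennreal (r powr CARD('n)) * (ennreal (r powr - real CARD('n)) * emeasure lborel (annulus k :: (real^'n) set)) = emeasure lborel (annulus k :: (real^'n) set)"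
    using r by (intro ennreal_mult_inverse_cancel) (auto simp: powr_add[symmetric])
  moreover have "r powr CARD('n) = 2 powr (k * CARD('n))" by (simp add: r_def powr_powr)
  ultimately show ?thesis by (simp add: ennreal_mult mult.commute)
qed

text \<open>Neither \<Omega> nor the chosen ball appears: the ball is enlarged to the unit ball, and
  all that is kept of the geometry are the two lower bounds on
  \<open>norm (x + t *\<^sub>R y)\<close>, imposed as a cutoff of the integrand. The potential can
  thus be estimated for arbitrary Borel functions G.\<close>

definition cone_potential :: "real \<Rightarrow> (real^'n \<Rightarrow> ennreal) \<Rightarrow> real^'n \<Rightarrow> ennreal" where
  "cone_potential c G x = (\<integral>\<^sup>+t. (\<integral>\<^sup>+y. (if c * norm x \<le> norm (x + t *\<^sub>R y) \<and> c * t \<le> norm (x + t *\<^sub>R y)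
     then G (x + t *\<^sub>R y) else 0) * indicator (cball 0 1) y \<partial>lborel) * indicator {0<..<1} t \<partial>lborel)"

lemma cone_potential_measurable [measurable]:
  assumes [measurable]: "G \<in> borel_measurable borel"
  shows "cone_potential c G \<in> borel_measurable borel"
  unfolding cone_potential_def by measurable

text \<open>Where the integrand survives, the point has norm at least \<open>c * norm x > 0\<close>
  and lies in exactly one annulus; sum and integrals are then interchanged.\<close>

lemma cone_potential_annuli:
  fixes G :: "real^'n \<Rightarrow> ennreal"
  assumes [measurable]: "G \<in> borel_measurable borel" and "0 < c" "x \<noteq> 0"
  shows "cone_potential c G x = (\<integral>\<^sup>+j. cone_potential c (\<lambda>z. G z * indicator (annulus j) z) x \<partial>count_space UNIV)"
proof -
  let ?P = "\<lambda>t y. c * norm x \<le> norm (x + t *\<^sub>R y) \<and> c * t \<le> norm (x + t *\<^sub>R y)"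
  have pt: "(if ?P t y then G (x + t *\<^sub>R y) else 0) * indicator (cball 0 1) y
    = (\<integral>\<^sup>+j. (if ?P t y then G (x + t *\<^sub>R y) * indicator (annulus j) (x + t *\<^sub>R y) else 0) * indicator (cball 0 1) y \<partial>count_space UNIV)" for t y
  proof (cases "?P t y")
    case True
    then have "x + t *\<^sub>R y \<noteq> 0" using assms by (auto simp: mult_le_0_iff)
    then have "(\<integral>\<^sup>+j. (G (x + t *\<^sub>R y) * indicator (cball 0 1) y) * indicator (annulus j) (x + t *\<^sub>R y) \<partial>count_space UNIV) = G (x + t *\<^sub>R y) * indicator (cball 0 1) y"
      by (rule sum_over_annuli)
    then show ?thesis using True by (simp add: mult_ac)
  next
    case False
    show ?thesis unfolding if_not_P[OF False] by simp
  qed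
  have "cone_potential c G x = (\<integral>\<^sup>+t. (\<integral>\<^sup>+j. (\<integral>\<^sup>+y. (if ?P t y then G (x + t *\<^sub>R y) * indicator (annulus j) (x + t *\<^sub>R y) else 0)
      * indicator (cball 0 1) y \<partial>lborel) * indicator {0<..<1} t \<partial>count_space UNIV) \<partial>lborel)"
    unfolding cone_potential_def pt
    by (subst nn_integral_count_space_int_swap) (auto simp: nn_integral_multc lborel.sigma_finite_measure_axioms)
  then show ?thesis
    unfolding cone_potential_def
    by (subst (asm) nn_integral_count_space_int_swap) (auto simp: lborel.sigma_finite_measure_axioms)
qed

text \<open>The cutoff \<open>c * norm x \<le> norm z\<close> excludes annuli much closer to the
  origin than x. The bound on N involves c / 2 because \<open>norm x\<close> is only known to be at
  least \<open>2 powr (k - 1)\<close>.\<close>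

lemma cone_potential_annulus_zero:
  fixes G :: "real^'n \<Rightarrow> ennreal"
  assumes "x \<in> annulus k" "0 < c" "2 powr - real N \<le> c / 2" "j \<le> k - int N"
  shows "cone_potential c (\<lambda>z. G z * indicator (annulus j) z) x = 0"
proof -
  have "z \<notin> annulus j" if "c * norm x \<le> norm z" for z :: "real^'n"
  proof
    assume "z \<in> annulus j"
    then have "norm z < 2 powr j" by (simp add: annulus_def)
    also have "\<dots> \<le> 2 powr (real_of_int k - real N)" using assms(4) by (intro powr_mono) auto
    also have "\<dots> = 2 powr - real N * 2 powr k" by (simp add: powr_add[symmetric])
    also have "\<dots> \<le> c / 2 * 2 powr k" using assms(3) by (intro mult_right_mono) auto
    also have "\<dots> = c * 2 powr (real_of_int k - 1)" by (simp add: powr_diff)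
    also have "\<dots> \<le> c * norm x" using assms by (intro mult_left_mono) (auto simp: annulus_def)
    finally show False using that by simp
  qed
  then have "(if c * norm x \<le> norm z \<and> c * t \<le> norm z then G z * indicator (annulus j) z else 0) = 0" for z t
    by auto
  then show ?thesis unfolding cone_potential_def by (simp only: mult_zero_left nn_integral_const)
qed

text \<open>In the annulus j the cutoff gives \<open>c * t \<le> norm z < 2 powr j\<close>, which
  limits t.\<close>

lemma cone_potential_inner_le:
  fixes G :: "real^'n \<Rightarrow> ennreal"
  assumes "0 < c"
  shows "(\<integral>\<^sup>+y. (if c * norm x \<le> norm (x + t *\<^sub>R y) \<and> c * t \<le> norm (x + t *\<^sub>R y)
     then G (x + t *\<^sub>R y) * indicator (annulus j) (x + t *\<^sub>R y) else 0) * indicator (cball 0 1) y \<partial>lborel)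
    \<le> ball_integral t (\<lambda>z. G z * indicator (annulus j) z) x * indicator {..<2 powr j / c} t"
    (is "?L \<le> _")
proof (cases "t < 2 powr j / c")
  case True
  then show ?thesis unfolding ball_integral_def by (auto intro!: nn_integral_mono)
next
  case False
  have "\<not> (c * t \<le> norm z \<and> z \<in> annulus j)" for z :: "real^'n"
    using False assms by (auto simp: annulus_def not_less divide_le_eq mult.commute)
  then have "(if c * norm x \<le> norm z \<and> c * t \<le> norm z then G z * indicator (annulus j) z else 0) = 0" for z
    by auto
  then show ?thesis by (simp only: mult_zero_left nn_integral_const zero_le)
qed

text \<open>For t < d = \<open>2 powr j / c\<close> and \<sigma> \<le> 1 one has
  \<open>1 \<le> d powr (1 - \<sigma>) * t powr (\<sigma> - 1)\<close>, which trades the kernel of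
  order 1 for that of order \<sigma>.\<close>

lemma cone_potential_annulus_near:
  fixes G :: "real^'n \<Rightarrow> ennreal"
  assumes [measurable]: "G \<in> borel_measurable borel" and "0 < c" "\<sigma> \<le> 1"
  shows "cone_potential c (\<lambda>z. G z * indicator (annulus j) z) x
    \<le> ennreal ((2 powr j / c) powr (1 - \<sigma>)) * frac_integral \<sigma> (\<lambda>z. G z * indicator (annulus j) z) x"
proof -
  let ?g = "\<lambda>z. G z * indicator (annulus j) z"
  define d where "d = 2 powr j / c"
  have d: "0 < d" using assms by (simp add: d_def)
  have "cone_potential c ?g x \<le> (\<integral>\<^sup>+t. ball_integral t ?g x * indicator {..<d} t * indicator {0<..<1} t \<partial>lborel)"
    unfolding cone_potential_def d_def by (intro nn_integral_mono mult_right_mono cone_potential_inner_le assms) auto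
  also have "\<dots> \<le> (\<integral>\<^sup>+t. ennreal (d powr (1 - \<sigma>)) * (ennreal (t powr (\<sigma> - 1)) * ball_integral t ?g x * indicator {0<..<1} t) \<partial>lborel)"
  proof (intro nn_integral_mono)
    fix t :: real
    show "ball_integral t ?g x * indicator {..<d} t * indicator {0<..<1} t
      \<le> ennreal (d powr (1 - \<sigma>)) * (ennreal (t powr (\<sigma> - 1)) * ball_integral t ?g x * indicator {0<..<1} t)"
    proof (cases "0 < t \<and> t < d")
      case True
      have "1 = d powr (1 - \<sigma>) * d powr (\<sigma> - 1)" using d by (simp add: powr_add[symmetric])
      also have "\<dots> \<le> d powr (1 - \<sigma>) * t powr (\<sigma> - 1)"
        using True assms by (intro mult_left_mono powr_mono2') auto
      finally have "1 \<le> ennreal (d powr (1 - \<sigma>)) * ennreal (t powr (\<sigma> - 1))"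
        by (simp add: ennreal_mult[symmetric] ennreal_1[symmetric] del: ennreal_1)
      then have "1 * ball_integral t ?g x \<le> ennreal (d powr (1 - \<sigma>)) * ennreal (t powr (\<sigma> - 1)) * ball_integral t ?g x"
        by (intro mult_right_mono) auto
      then show ?thesis by (auto simp: indicator_def mult.assoc)
    qed (auto simp: indicator_def)
  qed
  also have "\<dots> = ennreal (d powr (1 - \<sigma>)) * frac_integral \<sigma> ?g x"
    unfolding frac_integral_def by (rule nn_integral_cmult) measurable
  finally show ?thesis by (simp add: d_def)
qed

text \<open>Since \<open>norm x < 2 powr k \<le> 2 powr (j - 2)\<close> and
  \<open>norm y \<le> 1\<close>, reaching the annulus j takes \<open>t \<ge> 2 powr (j - 2)\<close>.
  There the ball integral is at most a multiple of \<open>t powr - (n / p)\<close> times the norm,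
  and the admissible t lie in an interval of length \<open>2 powr j / c\<close>. The factor
  \<open>4 powr (n / p)\<close> comes from the shift by 2 in the exponent.\<close>

lemma cone_potential_annulus_far:
  fixes G :: "real^'n \<Rightarrow> ennreal"
  assumes [measurable]: "G \<in> borel_measurable borel" and "0 < c" "1 < p" and x: "x \<in> annulus k" and j: "k + 2 \<le> j"
  shows "cone_potential c (\<lambda>z. G z * indicator (annulus j) z) x
    \<le> ennreal ((measure lborel (cball (0::real^'n) 1) + 1) * 4 powr (CARD('n) / p) / c * 2 powr (j * (1 - CARD('n) / p)))
       * lnorm p (\<lambda>z. G z * indicator (annulus j) z)"
proof -
  let ?g = "\<lambda>z. G z * indicator (annulus j) z"
  define B where "B = measure lborel (cball (0::real^'n) 1) + 1"
  have B: "0 < B" by (simp add: B_def add_nonneg_pos)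
  define e where "e = 2 powr (real_of_int j - 2)"
  have e: "0 < e" by (simp add: e_def)
  define n where "n = real CARD('n)"
  let ?J = "\<lambda>t. \<integral>\<^sup>+y. (if c * norm x \<le> norm (x + t *\<^sub>R y) \<and> c * t \<le> norm (x + t *\<^sub>R y)
     then ?g (x + t *\<^sub>R y) else 0) * indicator (cball 0 1) y \<partial>lborel"
  have zero: "?J t = 0" if t: "0 < t" "t < e" for t
  proof -
    have "x + t *\<^sub>R y \<notin> annulus j" if "norm y \<le> 1" for y
    proof -
      have "norm (x + t *\<^sub>R y) \<le> norm x + t * norm y" using norm_triangle_ineq[of x "t *\<^sub>R y"] t by simp
      also have "t * norm y \<le> t * 1" using that t by (intro mult_left_mono) auto
      also have "norm x < 2 powr k" using x by (simp add: annulus_def)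
      also have "2 powr real_of_int k \<le> e" using j unfolding e_def by (intro powr_mono) auto
      also have "t * 1 < e" using t by simp
      also have "e + e = 2 powr (real_of_int j - 1)" by (simp add: e_def powr_diff)
      finally show ?thesis by (simp add: annulus_def)
    qed
    then have "(if c * norm x \<le> norm (x + t *\<^sub>R y) \<and> c * t \<le> norm (x + t *\<^sub>R y) then ?g (x + t *\<^sub>R y) else 0) * indicator (cball 0 1) y = 0" for y
      by (cases "norm y \<le> 1") auto
    then have "?J t = (\<integral>\<^sup>+(y::real^'n). 0 \<partial>lborel)" by (intro nn_integral_cong)
    then show ?thesis by simp
  qed
  have "cone_potential c ?g x \<le> (\<integral>\<^sup>+t. ennreal (B * e powr - (n / p)) * lnorm p ?g * indicator {0..2 powr j / c} t \<partial>lborel)"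
    unfolding cone_potential_def
  proof (intro nn_integral_mono)
    fix t :: real
    show "?J t * indicator {0<..<1} t \<le> ennreal (B * e powr - (n / p)) * lnorm p ?g * indicator {0..2 powr j / c} t"
    proof (cases "e \<le> t")
      case True
      have "?J t * indicator {0<..<1} t \<le> ball_integral t ?g x * indicator {..<2 powr j / c} t * indicator {0<..<1} t"
        by (intro mult_right_mono cone_potential_inner_le assms) auto
      also have "\<dots> \<le> (ennreal (B * t powr - (n / p)) * lnorm p ?g) * indicator {0..2 powr j / c} t"
      proof -
        have "ball_integral t ?g x \<le> ennreal (B * t powr - (n / p)) * lnorm p ?g"
          using ball_integral_le_lnorm[of ?g p t x] True e assms by (simp add: B_def n_def)
        then show ?thesis by (auto simp: indicator_def)
      qed
      also have "ennreal (B * t powr - (n / p)) \<le> ennreal (B * e powr - (n / p))"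
        using True e B assms by (intro ennreal_leI mult_left_mono powr_mono2') (auto simp: n_def)
      finally show ?thesis by (auto simp: mult_right_mono)
    next
      case False
      then show ?thesis using zero[of t] by (auto simp: indicator_def)
    qed
  qed
  also have "\<dots> = ennreal (B * e powr - (n / p)) * lnorm p ?g * ennreal (2 powr j / c)"
    using assms by (subst nn_integral_cmult_indicator) auto
  also have "\<dots> = ennreal (B * e powr - (n / p) * (2 powr j / c)) * lnorm p ?g"
    using B assms by (subst (2) ennreal_mult) (auto simp: mult_ac)
  also have "B * e powr - (n / p) * (2 powr j / c) = B * 4 powr (n / p) / c * 2 powr (j * (1 - n / p))"
  proof -
    have "e powr - (n / p) = 2 powr ((real_of_int j - 2) * - (n / p))" by (simp add: e_def powr_powr)
    moreover have "(4::real) powr (n / p) = 2 powr (2 * (n / p))"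
      using powr_powr[of "2::real" 2 "n / p"] by simp
    moreover have "(real_of_int j - 2) * - (n / p) + j = 2 * (n / p) + j * (1 - n / p)" by (simp add: algebra_simps)
    ultimately show ?thesis by (simp add: powr_add[symmetric])
  qed
  finally show ?thesis by (simp add: B_def n_def)
qed

lemma cone_potential_pointwise_le:
  fixes G :: "real^'n \<Rightarrow> ennreal" and k :: int
  assumes [measurable]: "G \<in> borel_measurable borel" and "0 < c" "\<sigma> \<le> 1" "1 < p" and N: "2 powr - real N \<le> c / 2"
    and x: "x \<in> annulus k"
  defines "g \<equiv> \<lambda>j z. G z * indicator (annulus j) z"
    and "D \<equiv> (measure lborel (cball (0::real^'n) 1) + 1) * 4 powr (CARD('n) / p) / c"
  shows "cone_potential c G x \<le> (\<Sum>j\<in>{k - int N + 1..k + 1}. ennreal ((2 powr real_of_int j / c) powr (1 - \<sigma>)) * frac_integral \<sigma> (g j) x)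
    + (\<integral>\<^sup>+j. (if k + 2 \<le> j then ennreal (D * 2 powr (real_of_int j * (1 - CARD('n) / p))) * lnorm p (g j) else 0) \<partial>count_space UNIV)"
proof -
  let ?J = "{k - int N + 1..k + 1}"
  let ?A = "\<lambda>j. ennreal ((2 powr real_of_int j / c) powr (1 - \<sigma>)) * frac_integral \<sigma> (g j) x"
  let ?Q = "\<lambda>j. if k + 2 \<le> j then ennreal (D * 2 powr (real_of_int j * (1 - CARD('n) / p))) * lnorm p (g j) else 0"
  have "x \<noteq> 0" using x by (auto simp: annulus_def)
  then have "cone_potential c G x = (\<integral>\<^sup>+j. cone_potential c (g j) x \<partial>count_space UNIV)"
    unfolding g_def using \<open>0 < c\<close> by (intro cone_potential_annuli) auto
  also have "\<dots> \<le> (\<integral>\<^sup>+j. ?A j * indicator ?J j + ?Q j \<partial>count_space UNIV)"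
  proof (intro nn_integral_mono)
    fix j
    consider "j \<le> k - int N" | "j \<in> ?J" | "k + 2 \<le> j" by force
    then show "cone_potential c (g j) x \<le> ?A j * indicator ?J j + ?Q j"
    proof cases
      case 1
      then show ?thesis
        unfolding g_def using cone_potential_annulus_zero[OF x \<open>0 < c\<close> N, of j] by simp
    next
      case 2
      then show ?thesis
        using cone_potential_annulus_near[of G c \<sigma> j x] assms(2,3) unfolding g_def by (auto simp: indicator_def)
    next
      case 3
      then show ?thesis
        using cone_potential_annulus_far[of G c p x k j] assms(2,4) x unfolding g_def D_def by (auto simp: indicator_def)
    qed
  qed
  also have "\<dots> = (\<integral>\<^sup>+j. ?A j * indicator ?J j \<partial>count_space UNIV) + (\<integral>\<^sup>+j. ?Q j \<partial>count_space UNIV)"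
    by (rule nn_integral_add) auto
  also have "(\<integral>\<^sup>+j. ?A j * indicator ?J j \<partial>count_space UNIV) = (\<Sum>j\<in>?J. ?A j)"
    by (subst nn_integral_indicator_finite) auto
  finally show ?thesis .
qed

text \<open>Both parts are expressed through the same weights
  \<open>2 powr (- \<theta> * \<bar>j - k\<bar>)\<close>: for the finitely many near annuli this
  costs a constant, for the far ones it is an identity of exponents. The far bound is constant on
  the annulus k, whose measure supplies the power with exponent k n / q.\<close>

lemma cone_potential_annulus_lnorm_le:
  fixes p q \<sigma> \<alpha>\<^sub>1 \<alpha>\<^sub>2 \<theta> c :: real
  assumes p: "1 < p" and \<sigma>: "0 < \<sigma>" "\<sigma> \<le> 1" and q: "0 < q" "CARD('n) / q = CARD('n) / p - \<sigma>"
    and \<alpha>: "\<alpha>\<^sub>2 = \<alpha>\<^sub>1 + 1 - \<sigma>" and \<theta>: "\<theta> = \<alpha>\<^sub>1 + CARD('n) / q" "0 < \<theta>" and c: "0 < c"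
  shows "\<exists>C\<ge>0. \<forall>G :: real^'n \<Rightarrow> ennreal. G \<in> borel_measurable borel \<longrightarrow> (\<forall>k::int.
    ennreal (2 powr (k * \<alpha>\<^sub>1)) * lnorm q (\<lambda>x. cone_potential c G x * indicator (annulus k) x)
     \<le> ennreal C * (\<integral>\<^sup>+j. ennreal (2 powr (- \<theta> * \<bar>real_of_int (j - k)\<bar>)) *
         (ennreal (2 powr (real_of_int j * \<alpha>\<^sub>2)) * lnorm p (\<lambda>z. G z * indicator (annulus j) z)) \<partial>count_space UNIV))"
proof -
  obtain N where "(1 / 2) ^ N < c / 2" using real_arch_pow_inv[of "c / 2" "1 / 2"] c by auto
  then have N: "2 powr - real N \<le> c / 2" by (simp add: powr_minus powr_realpow power_one_over inverse_eq_divide)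
  obtain C0 where C0: "0 \<le> C0" "\<And>g :: real^'n \<Rightarrow> ennreal. g \<in> borel_measurable borel \<Longrightarrow> lnorm q (frac_integral \<sigma> g) \<le> ennreal C0 * lnorm p g"
    using lnorm_frac_integral_le[of p \<sigma> q, where 'a = "real^'n"] p \<sigma> q by auto
  define B where "B = measure lborel (cball (0::real^'n) 1)"
  define D where "D = (B + 1) * 4 powr (CARD('n) / p) / c"
  have BD: "0 \<le> B" "0 \<le> D" using c by (auto simp: B_def D_def)
  define N1 where "N1 = real N + 1"
  \<comment> \<open>On the near annuli \<open>\<bar>j - k\<bar> \<le> N1\<close>, so replacing k by
    j in the weight and inserting the decay factor costs at most the last power of 2.\<close>
  define C1 where "C1 = (1 / c) powr (1 - \<sigma>) * C0 * 2 powr (N1 * (\<bar>\<alpha>\<^sub>1\<bar> + \<theta>))"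
  have C1: "0 \<le> C1" using C0 by (simp add: C1_def)
  define K where "K = real (N + 2) * real (N + 2) powr (1 / q)"
  have K: "0 \<le> K" by (simp add: K_def)
  define C where "C = K * (N1 * C1 + B powr (1 / q) * D)"
  have C: "0 \<le> C" using K C1 BD by (simp add: C_def N1_def)
  have "ennreal (2 powr (k * \<alpha>\<^sub>1)) * lnorm q (\<lambda>x. cone_potential c G x * indicator (annulus k) x)
     \<le> ennreal C * (\<integral>\<^sup>+j. ennreal (2 powr (- \<theta> * \<bar>real_of_int (j - k)\<bar>)) *
         (ennreal (2 powr (real_of_int j * \<alpha>\<^sub>2)) * lnorm p (\<lambda>z. G z * indicator (annulus j) z)) \<partial>count_space UNIV)"
    if [measurable]: "G \<in> borel_measurable borel" for G :: "real^'n \<Rightarrow> ennreal" and k :: int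
  proof -
    define g where "g j = (\<lambda>z. G z * indicator (annulus j) z)" for j
    have [measurable]: "g j \<in> borel_measurable borel" for j unfolding g_def by measurable
    define w where "w j = ennreal (2 powr (- \<theta> * \<bar>real_of_int (j - k)\<bar>)) * (ennreal (2 powr (real_of_int j * \<alpha>\<^sub>2)) * lnorm p (g j))" for j
    define S where "S = (\<integral>\<^sup>+j. w j \<partial>count_space UNIV)"
    have wS: "w j \<le> S" for j unfolding S_def by (rule nn_integral_ge_point) simp
    define J where "J = {k - int N + 1..k + 1}"
    have J: "finite J" "card J = N + 1" by (auto simp: J_def)
    define A where "A j x = ennreal ((2 powr real_of_int j / c) powr (1 - \<sigma>)) * frac_integral \<sigma> (g j) x" for j x
    have [measurable]: "A j \<in> borel_measurable borel" for j unfolding A_def by measurable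
    define Q where "Q = (\<integral>\<^sup>+j. (if k + 2 \<le> j then ennreal (D * 2 powr (real_of_int j * (1 - CARD('n) / p))) * lnorm p (g j) else 0) \<partial>count_space UNIV)"
    \<comment> \<open>\<open>None\<close> stands for the far part, constant on the annulus, and
      \<open>Some j\<close> for the potential of a near annulus, so that a single sum of N + 2
      functions remains.\<close>
    define F where "F i = (case i of None \<Rightarrow> (\<lambda>x. Q * indicator (annulus k) x) | Some j \<Rightarrow> A j)" for i
    have [measurable]: "F i \<in> borel_measurable borel" for i by (cases i) (auto simp: F_def)
    let ?I = "insert None (Some ` J)"
    have cardI: "card ?I = N + 2" using J by (simp add: card_image)
    have pt: "cone_potential c G x * indicator (annulus k) x \<le> (\<Sum>i\<in>?I. F i x)" for x
    proof (cases "x \<in> annulus k")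
      case True
      have "cone_potential c G x \<le> (\<Sum>j\<in>J. A j x) + Q"
        unfolding J_def A_def Q_def g_def D_def B_def
        by (rule cone_potential_pointwise_le[OF _ c \<sigma>(2) p N True]) measurable
      also have "\<dots> = (\<Sum>i\<in>?I. F i x)"
        using True J by (simp add: F_def sum.reindex add.commute)
      finally show ?thesis using True by simp
    qed simp
    have near: "ennreal (2 powr (k * \<alpha>\<^sub>1)) * lnorm q (A j) \<le> ennreal C1 * S" if "j \<in> J" for j
    proof -
      have "\<bar>real_of_int (j - k)\<bar> \<le> N1" using that by (auto simp: J_def N1_def)
      then have "(real_of_int k - real_of_int j) * \<alpha>\<^sub>1 \<le> N1 * \<bar>\<alpha>\<^sub>1\<bar>" "\<theta> * \<bar>real_of_int (j - k)\<bar> \<le> \<theta> * N1"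
        using \<theta>(2) mult_mono[of "\<bar>real_of_int (j - k)\<bar>" N1 "\<bar>\<alpha>\<^sub>1\<bar>" "\<bar>\<alpha>\<^sub>1\<bar>"] abs_ge_self[of "(real_of_int k - real_of_int j) * \<alpha>\<^sub>1"]
        by (auto simp: abs_mult abs_minus_commute N1_def)
      then have "k * \<alpha>\<^sub>1 + j * (1 - \<sigma>) \<le> N1 * (\<bar>\<alpha>\<^sub>1\<bar> + \<theta>) + - \<theta> * \<bar>real_of_int (j - k)\<bar> + j * \<alpha>\<^sub>2"
        by (simp add: \<alpha> algebra_simps)
      then have "2 powr (k * \<alpha>\<^sub>1 + j * (1 - \<sigma>)) \<le> (2::real) powr (N1 * (\<bar>\<alpha>\<^sub>1\<bar> + \<theta>) + - \<theta> * \<bar>real_of_int (j - k)\<bar> + j * \<alpha>\<^sub>2)"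
        by (intro powr_mono) auto
      then have "2 powr (k * \<alpha>\<^sub>1) * 2 powr (j * (1 - \<sigma>)) \<le> 2 powr (N1 * (\<bar>\<alpha>\<^sub>1\<bar> + \<theta>)) * 2 powr (- \<theta> * \<bar>real_of_int (j - k)\<bar>) * 2 powr (j * \<alpha>\<^sub>2)"
        by (simp only: powr_add)
      then have "(1 / c) powr (1 - \<sigma>) * C0 * (2 powr (k * \<alpha>\<^sub>1) * 2 powr (j * (1 - \<sigma>)))
        \<le> (1 / c) powr (1 - \<sigma>) * C0 * (2 powr (N1 * (\<bar>\<alpha>\<^sub>1\<bar> + \<theta>)) * 2 powr (- \<theta> * \<bar>real_of_int (j - k)\<bar>) * 2 powr (j * \<alpha>\<^sub>2))"
        using C0 by (intro mult_left_mono) auto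
      then have coeff: "2 powr (k * \<alpha>\<^sub>1) * ((2 powr real_of_int j / c) powr (1 - \<sigma>) * C0) \<le> C1 * (2 powr (- \<theta> * \<bar>real_of_int (j - k)\<bar>) * 2 powr (j * \<alpha>\<^sub>2))"
        using c by (simp add: C1_def powr_divide powr_powr mult_ac)
      have "lnorm q (A j) = ennreal ((2 powr real_of_int j / c) powr (1 - \<sigma>)) * lnorm q (frac_integral \<sigma> (g j))"
        unfolding A_def by (rule lnorm_cmult[OF q(1)]) measurable
      also have "\<dots> \<le> ennreal ((2 powr real_of_int j / c) powr (1 - \<sigma>)) * (ennreal C0 * lnorm p (g j))"
        by (intro mult_left_mono C0) auto
      finally have "ennreal (2 powr (k * \<alpha>\<^sub>1)) * lnorm q (A j) \<le> ennreal (2 powr (k * \<alpha>\<^sub>1)) * (ennreal ((2 powr real_of_int j / c) powr (1 - \<sigma>)) * (ennreal C0 * lnorm p (g j)))"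
        by (intro mult_left_mono) auto
      also have "\<dots> = ennreal (2 powr (k * \<alpha>\<^sub>1) * ((2 powr real_of_int j / c) powr (1 - \<sigma>) * C0)) * lnorm p (g j)"
        using C0 by (simp add: ennreal_mult mult.assoc)
      also have "\<dots> \<le> ennreal (C1 * (2 powr (- \<theta> * \<bar>real_of_int (j - k)\<bar>) * 2 powr (j * \<alpha>\<^sub>2))) * lnorm p (g j)"
        using coeff by (intro mult_right_mono ennreal_leI) auto
      also have "\<dots> = ennreal C1 * w j"
        using C1 by (simp add: w_def ennreal_mult mult.assoc)
      also have "\<dots> \<le> ennreal C1 * S" by (intro mult_left_mono wS) auto
      finally show ?thesis .
    qed
    have far: "ennreal (2 powr (k * \<alpha>\<^sub>1)) * lnorm q (F None) \<le> ennreal (B powr (1 / q) * D) * S"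
    proof -
      have "lnorm q (F None) = Q * enn_rpow (emeasure lborel (annulus k :: (real^'n) set)) (1 / q)"
        using q by (simp add: F_def lnorm_const_indicator)
      also have "\<dots> \<le> Q * ennreal (B powr (1 / q) * 2 powr (k * (CARD('n) / q)))"
      proof (rule mult_left_mono)
        have "enn_rpow (emeasure lborel (annulus k :: (real^'n) set)) (1 / q) \<le> enn_rpow (ennreal (B * 2 powr (k * CARD('n)))) (1 / q)"
          unfolding B_def using q by (intro enn_rpow_mono emeasure_annulus_le) auto
        then show "enn_rpow (emeasure lborel (annulus k :: (real^'n) set)) (1 / q) \<le> ennreal (B powr (1 / q) * 2 powr (k * (CARD('n) / q)))"
          using BD by (simp add: enn_rpow_ennreal powr_mult powr_powr)
      qed simp
      finally have "ennreal (2 powr (k * \<alpha>\<^sub>1)) * lnorm q (F None) \<le> ennreal (2 powr (k * \<alpha>\<^sub>1)) * (Q * ennreal (B powr (1 / q) * 2 powr (k * (CARD('n) / q))))"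
        by (intro mult_left_mono) auto
      also have "\<dots> = ennreal (B powr (1 / q) * 2 powr (k * \<theta>)) * Q"
      proof -
        have "2 powr (k * \<alpha>\<^sub>1) * (B powr (1 / q) * 2 powr (k * (CARD('n) / q))) = B powr (1 / q) * 2 powr (k * \<theta>)"
          by (simp add: \<theta> powr_add distrib_left)
        then have "ennreal (2 powr (k * \<alpha>\<^sub>1)) * ennreal (B powr (1 / q) * 2 powr (k * (CARD('n) / q))) = ennreal (B powr (1 / q) * 2 powr (k * \<theta>))"
          by (simp only: ennreal_mult[symmetric] powr_ge_zero mult_nonneg_nonneg)
        then show ?thesis by (metis mult.assoc mult.commute)
      qed
      also have "\<dots> = (\<integral>\<^sup>+j. ennreal (B powr (1 / q) * 2 powr (k * \<theta>)) * (if k + 2 \<le> j then ennreal (D * 2 powr (real_of_int j * (1 - CARD('n) / p))) * lnorm p (g j) else 0) \<partial>count_space UNIV)"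
        unfolding Q_def by (rule nn_integral_cmult[symmetric]) simp
      also have "\<dots> \<le> (\<integral>\<^sup>+j. ennreal (B powr (1 / q) * D) * w j \<partial>count_space UNIV)"
      proof (intro nn_integral_mono)
        fix j
        show "ennreal (B powr (1 / q) * 2 powr (k * \<theta>)) * (if k + 2 \<le> j then ennreal (D * 2 powr (real_of_int j * (1 - CARD('n) / p))) * lnorm p (g j) else 0)
           \<le> ennreal (B powr (1 / q) * D) * w j"
        proof (cases "k + 2 \<le> j")
          case True
          \<comment> \<open>For j \<ge> k + 2 the absolute value is j - k, and
            \<open>\<alpha>\<^sub>2 - \<theta>\<close> = 1 - \<sigma> - n / q = 1 - n / p.\<close>
          have "k * \<theta> + j * (1 - CARD('n) / p) = - \<theta> * \<bar>real_of_int (j - k)\<bar> + j * \<alpha>\<^sub>2"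
          proof -
            have "k * (a + X) + j * (1 - (X + \<sigma>)) = - (a + X) * \<bar>real_of_int (j - k)\<bar> + j * (a + 1 - \<sigma>)" for a X :: real
              using True by (simp add: algebra_simps)
            moreover have "CARD('n) / p = CARD('n) / q + \<sigma>" using q by simp
            ultimately show ?thesis by (simp only: \<theta>(1) \<alpha>)
          qed
          then have "2 powr (k * \<theta>) * 2 powr (j * (1 - CARD('n) / p)) = 2 powr (- \<theta> * \<bar>real_of_int (j - k)\<bar>) * (2::real) powr (j * \<alpha>\<^sub>2)"
            by (simp only: powr_add[symmetric])
          then have "B powr (1 / q) * 2 powr (k * \<theta>) * (D * 2 powr (real_of_int j * (1 - CARD('n) / p))) = B powr (1 / q) * D * (2 powr (- \<theta> * \<bar>real_of_int (j - k)\<bar>) * 2 powr (j * \<alpha>\<^sub>2))"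
            by (simp add: mult_ac)
          then have "ennreal (B powr (1 / q) * 2 powr (k * \<theta>)) * ennreal (D * 2 powr (real_of_int j * (1 - CARD('n) / p)))
            = ennreal (B powr (1 / q) * D) * (ennreal (2 powr (- \<theta> * \<bar>real_of_int (j - k)\<bar>)) * ennreal (2 powr (j * \<alpha>\<^sub>2)))"
            using BD by (simp only: ennreal_mult[symmetric] powr_ge_zero mult_nonneg_nonneg)
          then have "ennreal (B powr (1 / q) * 2 powr (k * \<theta>)) * ennreal (D * 2 powr (real_of_int j * (1 - CARD('n) / p))) * lnorm p (g j)
            = ennreal (B powr (1 / q) * D) * (ennreal (2 powr (- \<theta> * \<bar>real_of_int (j - k)\<bar>)) * ennreal (2 powr (j * \<alpha>\<^sub>2))) * lnorm p (g j)" by (rule arg_cong)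
          then show ?thesis unfolding w_def if_P[OF True] mult.assoc by (rule eq_refl)
        next
          case False
          show ?thesis unfolding if_not_P[OF False] by simp
        qed
      qed
      also have "\<dots> = ennreal (B powr (1 / q) * D) * S"
        unfolding S_def by (rule nn_integral_cmult) simp
      finally show ?thesis .
    qed
    have "lnorm q (\<lambda>x. cone_potential c G x * indicator (annulus k) x) \<le> lnorm q (\<lambda>x. \<Sum>i\<in>?I. F i x)"
      by (intro lnorm_mono q pt)
    also have "\<dots> \<le> ennreal K * (\<Sum>i\<in>?I. lnorm q (F i))"
      using lnorm_sum_le[OF q(1), of ?I F] J by (simp only: cardI K_def finite_insert finite_imageI) simp
    finally have "ennreal (2 powr (k * \<alpha>\<^sub>1)) * lnorm q (\<lambda>x. cone_potential c G x * indicator (annulus k) x)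
      \<le> ennreal (2 powr (k * \<alpha>\<^sub>1)) * (ennreal K * (\<Sum>i\<in>?I. lnorm q (F i)))"
      by (intro mult_left_mono) auto
    also have "\<dots> = ennreal K * (ennreal (2 powr (k * \<alpha>\<^sub>1)) * lnorm q (F None) + (\<Sum>j\<in>J. ennreal (2 powr (k * \<alpha>\<^sub>1)) * lnorm q (A j)))"
      using J by (simp add: sum.reindex F_def distrib_left sum_distrib_left mult.left_commute)
    also have "\<dots> \<le> ennreal K * (ennreal (B powr (1 / q) * D) * S + (\<Sum>j\<in>J. ennreal C1 * S))"
      by (intro mult_left_mono add_mono sum_mono near far) auto
    also have "\<dots> = ennreal C * S"
    proof -
      have "(\<Sum>j\<in>J. ennreal C1 * S) = ennreal (N1 * C1) * S"
        using J C1 by (simp add: N1_def ennreal_mult ennreal_of_nat_eq_real_of_nat mult.assoc add.commute)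
      then have "ennreal (B powr (1 / q) * D) * S + (\<Sum>j\<in>J. ennreal C1 * S) = (ennreal (B powr (1 / q) * D) + ennreal (N1 * C1)) * S"
        by (simp only: distrib_right)
      also have "ennreal (B powr (1 / q) * D) + ennreal (N1 * C1) = ennreal (N1 * C1 + B powr (1 / q) * D)"
        using BD C1 by (subst ennreal_plus[symmetric]) (auto simp: N1_def add.commute)
      finally show ?thesis
        using K BD C1 by (simp add: C_def ennreal_mult mult.assoc N1_def)
    qed
    finally show ?thesis unfolding S_def w_def g_def .
  qed
  then show ?thesis using C by blast
qed

text \<open>The weights depend on j - k only, so the sum over j is a discrete convolution, with a
  kernel that is summable because its rate \<open>\<alpha>\<^sub>1 + n / q\<close> is
  positive.\<close>

lemma cone_potential_seq_norm_le:
  fixes p q \<sigma> \<alpha>\<^sub>1 \<alpha>\<^sub>2 c :: real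
  assumes "1 < p" "0 < \<sigma>" "\<sigma> \<le> 1" "0 < q" "CARD('n) / q = CARD('n) / p - \<sigma>"
    "\<alpha>\<^sub>2 = \<alpha>\<^sub>1 + 1 - \<sigma>" "0 < \<alpha>\<^sub>1 + CARD('n) / q" "0 < c" and r: "1 \<le> r"
  shows "\<exists>C\<ge>0. \<forall>G :: real^'n \<Rightarrow> ennreal. G \<in> borel_measurable borel \<longrightarrow>
    seq_norm r (\<lambda>k. ennreal (2 powr (k * \<alpha>\<^sub>1)) * lnorm q (\<lambda>x. cone_potential c G x * indicator (annulus k) x))
     \<le> ennreal C * seq_norm r (\<lambda>j. ennreal (2 powr (real_of_int j * \<alpha>\<^sub>2)) * lnorm p (\<lambda>z. G z * indicator (annulus j) z))"
proof -
  let ?\<theta> = "\<alpha>\<^sub>1 + CARD('n) / q"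
  obtain C where C: "0 \<le> C" "\<And>(G :: real^'n \<Rightarrow> ennreal) k::int. G \<in> borel_measurable borel \<Longrightarrow>
    ennreal (2 powr (k * \<alpha>\<^sub>1)) * lnorm q (\<lambda>x. cone_potential c G x * indicator (annulus k) x)
     \<le> ennreal C * (\<integral>\<^sup>+j. ennreal (2 powr (- ?\<theta> * \<bar>real_of_int (j - k)\<bar>)) *
         (ennreal (2 powr (real_of_int j * \<alpha>\<^sub>2)) * lnorm p (\<lambda>z. G z * indicator (annulus j) z)) \<partial>count_space UNIV)"
    using cone_potential_annulus_lnorm_le[of p \<sigma> q \<alpha>\<^sub>2 \<alpha>\<^sub>1 ?\<theta> c] assms by blast
  obtain D where D: "0 \<le> D" "\<And>a. seq_norm r (\<lambda>k. \<integral>\<^sup>+ j. ennreal (2 powr (- ?\<theta> * \<bar>real_of_int (j - k)\<bar>)) * a j \<partial>count_space UNIV)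
     \<le> ennreal D * seq_norm r a"
    using seq_norm_convolution_le[OF r, of ?\<theta>] assms by blast
  have "seq_norm r (\<lambda>k. ennreal (2 powr (k * \<alpha>\<^sub>1)) * lnorm q (\<lambda>x. cone_potential c G x * indicator (annulus k) x))
     \<le> ennreal (C * D) * seq_norm r (\<lambda>j. ennreal (2 powr (real_of_int j * \<alpha>\<^sub>2)) * lnorm p (\<lambda>z. G z * indicator (annulus j) z))"
    (is "?L \<le> _ * seq_norm r ?a")
    if "G \<in> borel_measurable borel" for G :: "real^'n \<Rightarrow> ennreal"
  proof -
    have "?L \<le> seq_norm r (\<lambda>k. ennreal C * (\<integral>\<^sup>+j. ennreal (2 powr (- ?\<theta> * \<bar>real_of_int (j - k)\<bar>)) * ?a j \<partial>count_space UNIV))"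
      by (intro seq_norm_mono r C that)
    also have "\<dots> \<le> ennreal C * (ennreal D * seq_norm r ?a)"
      unfolding seq_norm_cmult[OF r] by (intro mult_left_mono D) auto
    also have "\<dots> = ennreal (C * D) * seq_norm r ?a" using C(1) D(1) by (simp add: ennreal_mult mult.assoc)
    finally show ?thesis .
  qed
  then show ?thesis using C(1) D(1) by (intro exI[of _ "C * D"]) auto
qed

section \<open>The first order embedding\<close>

text \<open>Members of the spaces are Lebesgue measurable, while the estimates concern Borel
  functions and \<open>lborel\<close>. The value 0 outside \<Omega> turns integrals over \<Omega>
  into integrals over the whole space.\<close>

lemma borel_representative:
  fixes f :: "real^'n \<Rightarrow> real"
  assumes "open \<Omega>" "set_borel_measurable lebesgue \<Omega> f"
  shows "\<exists>f'\<in>borel_measurable borel. (AE x in lebesgue. f' x = indicator \<Omega> x * f x) \<and> (\<forall>x. x \<notin> \<Omega> \<longrightarrow> f' x = 0)"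
proof -
  have "(\<lambda>x. indicator \<Omega> x * f x) \<in> borel_measurable lebesgue"
    using assms(2) by (simp add: set_borel_measurable_def)
  from completion_ex_borel_measurable_real[OF this]
  obtain g where g: "g \<in> borel_measurable borel" "AE x in lborel. indicator \<Omega> x * f x = g x" by auto
  have "open \<Omega>" by fact
  then have [measurable]: "\<Omega> \<in> sets borel" by simp
  have "(\<lambda>x. indicator \<Omega> x * g x) \<in> borel_measurable borel" using g(1) by measurable
  moreover have "AE x in lebesgue. indicator \<Omega> x * g x = indicator \<Omega> x * f x"
    using AE_completion[OF g(2)] by (rule eventually_mono) (auto simp: indicator_def split: if_splits)
  ultimately show ?thesis by (intro bexI[of _ "\<lambda>x. indicator \<Omega> x * g x"]) auto
qed

lemma lp_norm_eq_lnorm: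
  fixes f f' :: "real^'n \<Rightarrow> real"
  assumes "0 < p" and [measurable]: "f' \<in> borel_measurable borel" and ae: "AE x in lebesgue. f' x = indicator \<Omega> x * f x"
  shows "lp_norm (ennreal p) (\<lambda>x. indicator (annulus k \<inter> \<Omega>) x * f x) = lnorm p (\<lambda>x. ennreal \<bar>f' x\<bar> * indicator (annulus k) x)"
proof -
  have "(\<integral>\<^sup>+x. ennreal (\<bar>indicator (annulus k \<inter> \<Omega>) x * f x\<bar> powr p) \<partial>lebesgue)
    = (\<integral>\<^sup>+x. enn_rpow (ennreal \<bar>f' x\<bar> * indicator (annulus k) x) p \<partial>lebesgue)"
    using ae by (intro nn_integral_cong_AE, elim eventually_mono) (auto simp: indicator_def enn_rpow_ennreal)
  also have "\<dots> = (\<integral>\<^sup>+x. enn_rpow (ennreal \<bar>f' x\<bar> * indicator (annulus k) x) p \<partial>lborel)"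
    by (rule nn_integral_completion) measurable
  finally show ?thesis using assms(1) by (simp add: lp_norm_def lnorm_def)
qed

lemma herz_norm_eq_seq_norm:
  fixes f f' :: "real^'n \<Rightarrow> real"
  assumes "0 < p" "f' \<in> borel_measurable borel" "AE x in lebesgue. f' x = indicator \<Omega> x * f x"
  shows "herz_norm \<alpha> (ennreal p) r \<Omega> f = seq_norm r (\<lambda>k. ennreal (2 powr (real_of_int k * \<alpha>)) * lnorm p (\<lambda>x. ennreal \<bar>f' x\<bar> * indicator (annulus k) x))"
  unfolding herz_norm_def seq_norm_def Let_def lp_norm_eq_lnorm[OF assms] ..

lemma compact_subset_annuli:
  fixes K :: "(real^'n) set"
  assumes "compact K" "0 \<notin> K"
  shows "\<exists>J :: int set. finite J \<and> K \<subseteq> (\<Union>j\<in>J. annulus j)"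
proof -
  obtain b where b: "\<And>z. z \<in> K \<Longrightarrow> norm z \<le> b" using compact_imp_bounded[OF assms(1)] bounded_iff by metis
  have "open (- K)" using compact_imp_closed[OF assms(1)] by (simp add: open_Compl)
  then obtain e where e: "0 < e" "ball 0 e \<subseteq> - K" using assms(2) open_contains_ball[of "- K"] by blast
  let ?J = "{\<lfloor>log 2 e\<rfloor>..\<lceil>log 2 b\<rceil> + 1}"
  have "\<exists>j\<in>?J. z \<in> annulus j" if z: "z \<in> K" for z
  proof -
    have "z \<noteq> 0" using z assms by auto
    then obtain j where j: "z \<in> annulus j" using annulus_ex1[of z] by blast
    have "e \<le> norm z" using e z by (auto simp: subset_eq not_less[symmetric])
    then have "e < 2 powr j" using j by (simp add: annulus_def)
    then have "log 2 e < j" using e by (simp add: log_less_iff)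
    moreover have "2 powr (real_of_int j - 1) \<le> b" using j b[OF z] by (simp add: annulus_def)
    then have "real_of_int j - 1 \<le> log 2 b"
      by (metis le_log_iff less_le_trans numeral_One one_less_numeral_iff powr_gt_zero semiring_norm(76) zero_neq_numeral)
    ultimately have "\<lfloor>log 2 e\<rfloor> \<le> j" "j \<le> \<lceil>log 2 b\<rceil> + 1" by linarith+
    then show ?thesis using j by auto
  qed
  then show ?thesis by (intro exI[of _ ?J]) auto
qed

text \<open>A compact set missing 0 meets finitely many annuli, and
  \<open>\<bar>h\<bar> \<le> 1 + \<bar>h\<bar> powr p\<close> reduces integrability to the finite
  measure of K and the norms on these annuli.\<close>

lemma integrable_on_compact_of_annuli:
  fixes h :: "real^'n \<Rightarrow> real"
  assumes [measurable]: "h \<in> borel_measurable borel" and p: "1 \<le> p"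
    and fin: "\<And>k. lnorm p (\<lambda>x. ennreal \<bar>h x\<bar> * indicator (annulus k) x) < top" and K: "compact K" "0 \<notin> K"
  shows "integrable lborel (\<lambda>x. indicator K x * h x)"
proof (rule integrableI_bounded)
  have [measurable]: "K \<in> sets borel" using K by (simp add: compact_imp_closed)
  show "(\<lambda>x. indicator K x * h x) \<in> borel_measurable lborel" by measurable
  obtain J :: "int set" where J: "finite J" "K \<subseteq> (\<Union>j\<in>J. annulus j)" using compact_subset_annuli[OF K] by blast
  have "ennreal (norm (indicator K x * h x)) \<le> indicator K x + (\<Sum>j\<in>J. enn_rpow (ennreal \<bar>h x\<bar> * indicator (annulus j) x) p)" for x
  proof (cases "x \<in> K")
    case True
    then obtain j where j: "j \<in> J" "x \<in> annulus j" using J by blast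
    have "\<bar>h x\<bar> \<le> 1 + \<bar>h x\<bar> powr p"
    proof (cases "\<bar>h x\<bar> \<le> 1")
      case False
      then have "\<bar>h x\<bar> powr 1 \<le> \<bar>h x\<bar> powr p" using p by (intro powr_mono) auto
      then show ?thesis using False by simp
    qed (simp add: add_increasing2)
    then have "ennreal \<bar>h x\<bar> \<le> ennreal (1 + \<bar>h x\<bar> powr p)" by (rule ennreal_leI)
    also have "\<dots> = 1 + enn_rpow (ennreal \<bar>h x\<bar> * indicator (annulus j) x) p"
      using j by (simp add: enn_rpow_ennreal)
    also have "\<dots> \<le> 1 + (\<Sum>j\<in>J. enn_rpow (ennreal \<bar>h x\<bar> * indicator (annulus j) x) p)"
      using j J by (intro add_left_mono member_le_sum) auto
    finally show ?thesis using True by simp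
  qed simp
  then have "(\<integral>\<^sup>+x. ennreal (norm (indicator K x * h x)) \<partial>lborel) \<le> (\<integral>\<^sup>+x. indicator K x + (\<Sum>j\<in>J. enn_rpow (ennreal \<bar>h x\<bar> * indicator (annulus j) x) p) \<partial>lborel)"
    by (intro nn_integral_mono)
  also have "\<dots> = emeasure lborel K + (\<Sum>j\<in>J. \<integral>\<^sup>+x. enn_rpow (ennreal \<bar>h x\<bar> * indicator (annulus j) x) p \<partial>lborel)"
    by (subst nn_integral_add; (subst nn_integral_sum)?) auto
  also have "\<dots> < \<infinity>"
    using emeasure_compact_finite[OF K(1)] fin J(1) by (simp add: lnorm_def enn_rpow_less_top_iff)
  finally show "(\<integral>\<^sup>+x. ennreal (norm (indicator K x * h x)) \<partial>lborel) < \<infinity>" .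
qed

text \<open>The zeroth and first order derivatives are indexed by \<^typ>\<open>'n option\<close>.\<close>
lemma cone_integral_le_cone_potential:
  fixes h :: "'n::finite option \<Rightarrow> real^'n \<Rightarrow> real"
  assumes [measurable]: "\<And>i. h i \<in> borel_measurable borel" and "0 < s" and small: "cball w s \<subseteq> cball 0 1"
    and geo: "\<And>t y. t \<in> {0..1} \<Longrightarrow> y \<in> cball w s \<Longrightarrow> c * norm x \<le> norm (x + t *\<^sub>R y) \<and> c * t \<le> norm (x + t *\<^sub>R y)"
  shows "(\<integral>\<^sup>+\<omega>. ennreal (cone_weight w s \<omega> * (\<bar>h None (x + cone_point \<omega>)\<bar> + (\<Sum>i\<in>UNIV. \<bar>h (Some i) (x + cone_point \<omega>)\<bar>))) \<partial>(lborel \<Otimes>\<^sub>M lborel))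
    \<le> ennreal (1 / measure lborel (cball (0::real^'n) s)) * cone_potential c (\<lambda>z. \<Sum>i\<in>UNIV. ennreal \<bar>h i z\<bar>) x"
proof -
  define b where "b = measure lborel (cball (0::real^'n) s)"
  have b: "0 < b" using \<open>0 < s\<close> by (simp add: b_def)
  \<comment> \<open>The measure of the ball does not depend on its centre, so one constant serves
    all w.\<close>
  have bw: "measure lborel (cball w s) = b" using \<open>0 < s\<close> by (simp add: b_def content_cball)
  define G where "G z = (\<Sum>i\<in>UNIV. ennreal \<bar>h i z\<bar>)" for z
  have [measurable]: "G \<in> borel_measurable borel" unfolding G_def by measurable
  have G_eq: "G z = ennreal (\<bar>h None z\<bar> + (\<Sum>i\<in>UNIV. \<bar>h (Some i) z\<bar>))" for z
    by (simp add: G_def UNIV_option_conv sum.reindex ennreal_plus[symmetric] sum_nonneg del: ennreal_plus)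
  let ?Q = "\<lambda>t y. (if c * norm x \<le> norm (x + t *\<^sub>R y) \<and> c * t \<le> norm (x + t *\<^sub>R y) then G (x + t *\<^sub>R y) else 0) * indicator (cball 0 1) y"
  have pt: "ennreal (cone_weight w s (t, y) * (\<bar>h None (x + t *\<^sub>R y)\<bar> + (\<Sum>i\<in>UNIV. \<bar>h (Some i) (x + t *\<^sub>R y)\<bar>)))
    \<le> ennreal (1 / b) * (?Q t y * indicator {0..1} t)" for t y
  proof (cases "t \<in> {0..1} \<and> y \<in> cball w s")
    case True
    then have Q: "?Q t y = G (x + t *\<^sub>R y)" using geo[of t y] small by auto
    have wt: "cone_weight w s (t, y) = 1 / b" using True by (simp add: cone_weight_def bw)
    have "ennreal (cone_weight w s (t, y) * (\<bar>h None (x + t *\<^sub>R y)\<bar> + (\<Sum>i\<in>UNIV. \<bar>h (Some i) (x + t *\<^sub>R y)\<bar>))) = ennreal (1 / b) * ?Q t y"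
      unfolding wt Q unfolding G_eq using b by (intro ennreal_mult') simp
    then show ?thesis using True by simp
  next
    case False
    then have "cone_weight w s (t, y) = 0" by (auto simp: cone_weight_def)
    then show ?thesis by simp
  qed
  have meas: "(\<lambda>\<omega>. ennreal (cone_weight w s \<omega> * (\<bar>h None (x + cone_point \<omega>)\<bar> + (\<Sum>i\<in>UNIV. \<bar>h (Some i) (x + cone_point \<omega>)\<bar>)))) \<in> borel_measurable (lborel \<Otimes>\<^sub>M lborel)"
  proof -
    have [measurable]: "cone_weight w s \<in> borel_measurable (lborel \<Otimes>\<^sub>M lborel)" by (simp add: lborel_prod)
    show ?thesis by measurable
  qed
  have "(\<integral>\<^sup>+\<omega>. ennreal (cone_weight w s \<omega> * (\<bar>h None (x + cone_point \<omega>)\<bar> + (\<Sum>i\<in>UNIV. \<bar>h (Some i) (x + cone_point \<omega>)\<bar>))) \<partial>(lborel \<Otimes>\<^sub>M lborel))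
    = (\<integral>\<^sup>+t. (\<integral>\<^sup>+y. ennreal (cone_weight w s (t, y) * (\<bar>h None (x + t *\<^sub>R y)\<bar> + (\<Sum>i\<in>UNIV. \<bar>h (Some i) (x + t *\<^sub>R y)\<bar>))) \<partial>lborel) \<partial>lborel)"
    using lborel.nn_integral_fst[OF meas, symmetric] by simp
  also have "\<dots> \<le> (\<integral>\<^sup>+t. (\<integral>\<^sup>+y. ennreal (1 / b) * (?Q t y * indicator {0..1} t) \<partial>lborel) \<partial>lborel)"
    by (intro nn_integral_mono pt)
  also have "\<dots> = (\<integral>\<^sup>+t. ennreal (1 / b) * ((\<integral>\<^sup>+y. ?Q t y \<partial>lborel) * indicator {0..1} t) \<partial>lborel)"
    by (simp add: nn_integral_cmult nn_integral_multc)
  also have "\<dots> = (\<integral>\<^sup>+t. ennreal (1 / b) * ((\<integral>\<^sup>+y. ?Q t y \<partial>lborel) * indicator {0<..<1} t) \<partial>lborel)"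
    using AE_lborel_singleton[of "0::real"] AE_lborel_singleton[of "1::real"]
    by (intro nn_integral_cong_AE) (auto simp: indicator_def)
  also have "\<dots> = ennreal (1 / b) * cone_potential c G x"
    unfolding cone_potential_def by (rule nn_integral_cmult) measurable
  finally show ?thesis by (simp add: b_def G_def[abs_def])
qed

text \<open>The cone estimate is applied in \<open>\<Omega> - {0}\<close>, where integrability on
  compact sets is available, once for each w in W. As W is finite, the exceptional sets combine to a
  null set, and only then is w chosen depending on x.\<close>

lemma sobolev_pointwise_le_cone_potential:
  fixes h :: "'n::finite option \<Rightarrow> real^'n \<Rightarrow> real"
  assumes "open \<Omega>" "finite W" "0 < s" "0 < c" "\<And>w. w \<in> W \<Longrightarrow> cball w s \<subseteq> cball 0 1"
    and geo: "\<And>x. x \<in> \<Omega> \<Longrightarrow> x \<noteq> 0 \<Longrightarrow> \<exists>w\<in>W. \<forall>t\<in>{0..1}. \<forall>y\<in>cball w s.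
       x + t *\<^sub>R y \<in> \<Omega> \<and> c * norm x \<le> norm (x + t *\<^sub>R y) \<and> c * t \<le> norm (x + t *\<^sub>R y)"
    and h: "\<And>i. h i \<in> borel_measurable borel" "\<And>K i. compact K \<Longrightarrow> 0 \<notin> K \<Longrightarrow> integrable lborel (\<lambda>x. indicator K x * h i x)"
    and weak: "\<And>\<phi> i. test_fun \<Omega> \<phi> \<Longrightarrow> (\<integral>x. h None x * pd i \<phi> x \<partial>lborel) = - (\<integral>x. h (Some i) x * \<phi> x \<partial>lborel)"
    and zero: "\<And>x. x \<notin> \<Omega> \<Longrightarrow> h None x = 0"
  shows "AE x in lborel. ennreal \<bar>h None x\<bar> \<le> ennreal (1 / measure lborel (cball (0::real^'n) s)) * cone_potential c (\<lambda>z. \<Sum>i\<in>UNIV. ennreal \<bar>h i z\<bar>) x"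
proof -
  let ?I = "\<lambda>w x. \<integral>\<^sup>+\<omega>. ennreal (cone_weight w s \<omega> * (\<bar>h None (x + cone_point \<omega>)\<bar> + (\<Sum>i\<in>UNIV. \<bar>h (Some i) (x + cone_point \<omega>)\<bar>))) \<partial>(lborel \<Otimes>\<^sub>M lborel)"
  have "AE x in lborel. (\<forall>v\<in>cone_hull w s. x + v \<in> \<Omega> - {0}) \<longrightarrow> ennreal \<bar>h None x\<bar> \<le> ?I w x" if "w \<in> W" for w
  proof (rule cone_estimate)
    show "open (\<Omega> - {0})" using assms(1) by (rule open_delete)
    show "integrable lborel (\<lambda>x. indicator K x * h None x)" "integrable lborel (\<lambda>x. indicator K x * h (Some i) x)"
      if "compact K" "K \<subseteq> \<Omega> - {0}" for K i using that by (auto intro!: h)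
    show "(\<integral>x. h None x * pd i \<phi> x \<partial>lborel) = - (\<integral>x. h (Some i) x * \<phi> x \<partial>lborel)" if "test_fun (\<Omega> - {0}) \<phi>" for \<phi> i
      using test_fun_mono[OF that, of \<Omega>] by (intro weak) auto
  qed (use assms that in auto)
  then have "AE x in lborel. \<forall>w\<in>W. (\<forall>v\<in>cone_hull w s. x + v \<in> \<Omega> - {0}) \<longrightarrow> ennreal \<bar>h None x\<bar> \<le> ?I w x"
    using \<open>finite W\<close> by (intro AE_finite_allI)
  then show ?thesis
    using AE_lborel_singleton[of 0]
  proof eventually_elim
    case (elim x)
    show ?case
    proof (cases "x \<in> \<Omega>")
      case True
      then obtain w where w: "w \<in> W" and wg: "\<And>t y. t \<in> {0..1} \<Longrightarrow> y \<in> cball w s \<Longrightarrow>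
         x + t *\<^sub>R y \<in> \<Omega> \<and> c * norm x \<le> norm (x + t *\<^sub>R y) \<and> c * t \<le> norm (x + t *\<^sub>R y)"
        using geo[OF True] elim(2) by blast
      have "x + v \<in> \<Omega> - {0}" if "v \<in> cone_hull w s" for v
      proof -
        obtain t y where v: "v = t *\<^sub>R y" "t \<in> {0..1}" "y \<in> cball w s" using \<open>v \<in> cone_hull w s\<close> by (auto simp: cone_hull_def)
        have "0 < c * norm x" using \<open>0 < c\<close> elim(2) by simp
        then show ?thesis using wg[OF v(2,3)] v(1) by auto
      qed
      then have "ennreal \<bar>h None x\<bar> \<le> ?I w x" using elim(1) w by blast
      also have "\<dots> \<le> ennreal (1 / measure lborel (cball (0::real^'n) s)) * cone_potential c (\<lambda>z. \<Sum>i\<in>UNIV. ennreal \<bar>h i z\<bar>) x"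
        using wg w assms by (intro cone_integral_le_cone_potential) auto
      finally show ?thesis .
    qed (simp add: zero)
  qed
qed

text \<open>If the right side is infinite there is nothing to prove. Otherwise all norms on single
  annuli are finite, which supplies the integrability away from 0 that the cone representation
  needs.\<close>

lemma sobolev_seq_norm_borel:
  fixes \<Omega> :: "(real^'n) set" and p q \<sigma> \<alpha>\<^sub>1 \<alpha>\<^sub>2 :: real
  assumes \<Omega>: "open \<Omega>" "cone_condition \<Omega>" "0 \<in> \<Omega>"
    and p: "1 < p" and \<sigma>: "0 < \<sigma>" "\<sigma> \<le> 1" and q: "0 < q" "CARD('n) / q = CARD('n) / p - \<sigma>"
    and \<alpha>: "\<alpha>\<^sub>2 = \<alpha>\<^sub>1 + 1 - \<sigma>" "0 < \<alpha>\<^sub>1 + CARD('n) / q" and r: "1 \<le> r"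
  shows "\<exists>C>0. \<forall>h :: 'n option \<Rightarrow> real^'n \<Rightarrow> real. (\<forall>i. h i \<in> borel_measurable borel) \<longrightarrow>
     (\<forall>\<phi> i. test_fun \<Omega> \<phi> \<longrightarrow> (\<integral>x. h None x * pd i \<phi> x \<partial>lborel) = - (\<integral>x. h (Some i) x * \<phi> x \<partial>lborel)) \<longrightarrow>
     (\<forall>x. x \<notin> \<Omega> \<longrightarrow> h None x = 0) \<longrightarrow>
     seq_norm r (\<lambda>k. ennreal (2 powr (real_of_int k * \<alpha>\<^sub>1)) * lnorm q (\<lambda>x. ennreal \<bar>h None x\<bar> * indicator (annulus k) x))
     \<le> ennreal C * (\<Sum>i\<in>UNIV. seq_norm r (\<lambda>k. ennreal (2 powr (real_of_int k * \<alpha>\<^sub>2)) * lnorm p (\<lambda>x. ennreal \<bar>h i x\<bar> * indicator (annulus k) x)))"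
proof -
  obtain W s c where W: "finite W" "0 < s" "0 < c" "\<And>w. w \<in> W \<Longrightarrow> cball w s \<subseteq> cball (0::real^'n) 1"
    "\<And>x. x \<in> \<Omega> \<Longrightarrow> x \<noteq> 0 \<Longrightarrow> \<exists>w\<in>W. \<forall>t\<in>{0..1}. \<forall>y\<in>cball w s.
       x + t *\<^sub>R y \<in> \<Omega> \<and> c * norm x \<le> norm (x + t *\<^sub>R y) \<and> c * t \<le> norm (x + t *\<^sub>R y)"
    using cone_condition_segments[OF \<Omega>] by (smt (verit))
  define b where "b = 1 / measure lborel (cball (0::real^'n) s)"
  have b: "0 \<le> b" by (simp add: b_def)
  obtain C1 where C1: "0 \<le> C1" "\<And>G :: real^'n \<Rightarrow> ennreal. G \<in> borel_measurable borel \<Longrightarrow>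
    seq_norm r (\<lambda>k. ennreal (2 powr (k * \<alpha>\<^sub>1)) * lnorm q (\<lambda>x. cone_potential c G x * indicator (annulus k) x))
     \<le> ennreal C1 * seq_norm r (\<lambda>j. ennreal (2 powr (real_of_int j * \<alpha>\<^sub>2)) * lnorm p (\<lambda>z. G z * indicator (annulus j) z))"
    using cone_potential_seq_norm_le[OF p \<sigma> q \<alpha> \<open>0 < c\<close> r] by blast
  define K where "K = real CARD('n option) * real CARD('n option) powr (1 / p)"
  have K: "0 \<le> K" by (simp add: K_def)
  obtain C2 where C2: "0 \<le> C2" "\<And>a :: 'n option \<Rightarrow> int \<Rightarrow> ennreal. seq_norm r (\<lambda>k. \<Sum>i\<in>UNIV. a i k) \<le> ennreal C2 * (\<Sum>i\<in>UNIV. seq_norm r (a i))"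
    using seq_norm_sum_le[OF r, of "UNIV :: 'n option set"] by auto
  \<comment> \<open>The summand 1 keeps C positive, so that its product with an infinite sum is
    infinite.\<close>
  define C where "C = b * (C1 * (K * C2)) + 1"
  have C: "0 < C" using b C1 K C2 by (simp add: C_def add_nonneg_pos)
  have "seq_norm r (\<lambda>k. ennreal (2 powr (real_of_int k * \<alpha>\<^sub>1)) * lnorm q (\<lambda>x. ennreal \<bar>h None x\<bar> * indicator (annulus k) x))
     \<le> ennreal C * (\<Sum>i\<in>UNIV. seq_norm r (\<lambda>k. ennreal (2 powr (real_of_int k * \<alpha>\<^sub>2)) * lnorm p (\<lambda>x. ennreal \<bar>h i x\<bar> * indicator (annulus k) x)))"
    (is "?L \<le> _ * (\<Sum>i\<in>UNIV. ?N i)")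
    if hm: "\<And>i. h i \<in> borel_measurable borel"
      and weak: "\<And>\<phi> i. test_fun \<Omega> \<phi> \<Longrightarrow> (\<integral>x. h None x * pd i \<phi> x \<partial>lborel) = - (\<integral>x. h (Some i) x * \<phi> x \<partial>lborel)"
      and zero: "\<And>x. x \<notin> \<Omega> \<Longrightarrow> h None x = 0" for h :: "'n option \<Rightarrow> real^'n \<Rightarrow> real"
  proof (cases "(\<Sum>i\<in>UNIV. ?N i) < top")
    case False
    then have "(\<Sum>i\<in>UNIV. ?N i) = top" by (simp add: less_top[symmetric])
    then show ?thesis using C by (simp only: ennreal_mult_top) (simp add: not_le)
  next
    case True
    note [measurable] = hm
    define G where "G z = (\<Sum>i\<in>UNIV. ennreal \<bar>h i z\<bar>)" for z
    have [measurable]: "G \<in> borel_measurable borel" unfolding G_def by measurable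
    have fin: "lnorm p (\<lambda>x. ennreal \<bar>h i x\<bar> * indicator (annulus k) x) < top" for i k
    proof -
      have "?N i < top" using True by simp
      then have "ennreal (2 powr (real_of_int k * \<alpha>\<^sub>2)) * lnorm p (\<lambda>x. ennreal \<bar>h i x\<bar> * indicator (annulus k) x) < top"
        using le_seq_norm[OF r, of "\<lambda>k. ennreal (2 powr (real_of_int k * \<alpha>\<^sub>2)) * lnorm p (\<lambda>x. ennreal \<bar>h i x\<bar> * indicator (annulus k) x)" k]
        by (rule le_less_trans[rotated])
      then show ?thesis by (auto simp: ennreal_mult_less_top)
    qed
    have ae: "AE x in lborel. ennreal \<bar>h None x\<bar> \<le> ennreal b * cone_potential c G x"
      unfolding b_def G_def
    proof (rule sobolev_pointwise_le_cone_potential[OF \<Omega>(1) W hm _ weak zero])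
      show "integrable lborel (\<lambda>x. indicator K x * h i x)" if "compact K" "0 \<notin> K" for K i
        using integrable_on_compact_of_annuli[OF hm _ fin that] p by simp
    qed
    have 1: "lnorm q (\<lambda>x. ennreal \<bar>h None x\<bar> * indicator (annulus k) x) \<le> ennreal b * lnorm q (\<lambda>x. cone_potential c G x * indicator (annulus k) x)" for k
    proof -
      have "lnorm q (\<lambda>x. ennreal \<bar>h None x\<bar> * indicator (annulus k) x) \<le> lnorm q (\<lambda>x. ennreal b * (cone_potential c G x * indicator (annulus k) x))"
        using ae by (intro lnorm_mono_AE q(1), elim eventually_mono) (auto simp: indicator_def)
      then show ?thesis using q(1) by (simp add: lnorm_cmult)
    qed
    have 2: "lnorm p (\<lambda>z. G z * indicator (annulus j) z) \<le> ennreal K * (\<Sum>i\<in>UNIV. lnorm p (\<lambda>x. ennreal \<bar>h i x\<bar> * indicator (annulus j) x))" for j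
      unfolding G_def sum_distrib_right K_def using p by (intro lnorm_sum_le) (simp, simp, measurable)
    have "?L \<le> seq_norm r (\<lambda>k. ennreal b * (ennreal (2 powr (real_of_int k * \<alpha>\<^sub>1)) * lnorm q (\<lambda>x. cone_potential c G x * indicator (annulus k) x)))"
      by (intro seq_norm_mono r) (subst mult.left_commute, intro mult_left_mono 1, simp)
    also have "\<dots> \<le> ennreal b * (ennreal C1 * seq_norm r (\<lambda>j. ennreal (2 powr (real_of_int j * \<alpha>\<^sub>2)) * lnorm p (\<lambda>z. G z * indicator (annulus j) z)))"
      unfolding seq_norm_cmult[OF r] by (intro mult_left_mono C1) auto
    also have "\<dots> \<le> ennreal b * (ennreal C1 * seq_norm r (\<lambda>j. ennreal K * (\<Sum>i\<in>UNIV. ennreal (2 powr (real_of_int j * \<alpha>\<^sub>2)) * lnorm p (\<lambda>x. ennreal \<bar>h i x\<bar> * indicator (annulus j) x))))"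
      unfolding sum_distrib_left[symmetric]
      by (intro mult_left_mono seq_norm_mono r) (subst mult.left_commute, intro mult_left_mono 2, simp_all)
    also have "\<dots> \<le> ennreal b * (ennreal C1 * (ennreal K * (ennreal C2 * (\<Sum>i\<in>UNIV. ?N i))))"
      unfolding seq_norm_cmult[OF r] by (intro mult_left_mono C2) auto
    also have "\<dots> = ennreal (b * (C1 * (K * C2))) * (\<Sum>i\<in>UNIV. ?N i)"
      using b C1 K C2 by (simp add: ennreal_mult mult.assoc)
    also have "\<dots> \<le> ennreal C * (\<Sum>i\<in>UNIV. ?N i)"
      by (intro mult_right_mono ennreal_leI) (auto simp: C_def)
    finally show ?thesis .
  qed
  then show ?thesis using C by (intro exI[of _ C]) blast
qed

text \<open>The transfer from Borel to Lebesgue measurable functions. The hypothesis is the bare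
  integration by parts identity, so the family may consist of a weak derivative of some function
  together with its next derivatives.\<close>

lemma sobolev_herz_first_order:
  fixes \<Omega> :: "(real^'n) set" and p q \<sigma> \<alpha>\<^sub>1 \<alpha>\<^sub>2 :: real
  assumes \<Omega>: "open \<Omega>" "cone_condition \<Omega>" "0 \<in> \<Omega>"
    and p: "1 < p" and \<sigma>: "0 < \<sigma>" "\<sigma> \<le> 1" and q: "0 < q" "CARD('n) / q = CARD('n) / p - \<sigma>"
    and \<alpha>: "\<alpha>\<^sub>2 = \<alpha>\<^sub>1 + 1 - \<sigma>" "0 < \<alpha>\<^sub>1 + CARD('n) / q" and r: "1 \<le> r"
  shows "\<exists>C>0. \<forall>h :: 'n option \<Rightarrow> real^'n \<Rightarrow> real. (\<forall>i. set_borel_measurable lebesgue \<Omega> (h i)) \<longrightarrow>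
     (\<forall>\<phi> i. test_fun \<Omega> \<phi> \<longrightarrow> (\<integral>x\<in>\<Omega>. h None x * pd i \<phi> x \<partial>lebesgue) = - (\<integral>x\<in>\<Omega>. h (Some i) x * \<phi> x \<partial>lebesgue)) \<longrightarrow>
     herz_norm \<alpha>\<^sub>1 (ennreal q) r \<Omega> (h None) \<le> ennreal C * (\<Sum>i\<in>UNIV. herz_norm \<alpha>\<^sub>2 (ennreal p) r \<Omega> (h i))"
proof -
  obtain C where C: "0 < C" and bound: "\<And>h :: 'n option \<Rightarrow> real^'n \<Rightarrow> real. (\<And>i. h i \<in> borel_measurable borel) \<Longrightarrow>
     (\<And>\<phi> i. test_fun \<Omega> \<phi> \<Longrightarrow> (\<integral>x. h None x * pd i \<phi> x \<partial>lborel) = - (\<integral>x. h (Some i) x * \<phi> x \<partial>lborel)) \<Longrightarrow>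
     (\<And>x. x \<notin> \<Omega> \<Longrightarrow> h None x = 0) \<Longrightarrow>
     seq_norm r (\<lambda>k. ennreal (2 powr (real_of_int k * \<alpha>\<^sub>1)) * lnorm q (\<lambda>x. ennreal \<bar>h None x\<bar> * indicator (annulus k) x))
     \<le> ennreal C * (\<Sum>i\<in>UNIV. seq_norm r (\<lambda>k. ennreal (2 powr (real_of_int k * \<alpha>\<^sub>2)) * lnorm p (\<lambda>x. ennreal \<bar>h i x\<bar> * indicator (annulus k) x)))"
    using sobolev_seq_norm_borel[OF assms] by blast
  have "herz_norm \<alpha>\<^sub>1 (ennreal q) r \<Omega> (h None) \<le> ennreal C * (\<Sum>i\<in>UNIV. herz_norm \<alpha>\<^sub>2 (ennreal p) r \<Omega> (h i))"
    if hm: "\<And>i. set_borel_measurable lebesgue \<Omega> (h i)"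
      and weak: "\<And>\<phi> i. test_fun \<Omega> \<phi> \<Longrightarrow> (\<integral>x\<in>\<Omega>. h None x * pd i \<phi> x \<partial>lebesgue) = - (\<integral>x\<in>\<Omega>. h (Some i) x * \<phi> x \<partial>lebesgue)"
    for h :: "'n option \<Rightarrow> real^'n \<Rightarrow> real"
  proof -
    have "\<forall>i. \<exists>f'. f' \<in> borel_measurable borel \<and> (AE x in lebesgue. f' x = indicator \<Omega> x * h i x) \<and> (\<forall>x. x \<notin> \<Omega> \<longrightarrow> f' x = 0)"
      using borel_representative[OF \<Omega>(1) hm] by blast
    then obtain k where k: "\<And>i. k i \<in> borel_measurable borel" "\<And>i. AE x in lebesgue. k i x = indicator \<Omega> x * h i x" "\<And>i x. x \<notin> \<Omega> \<Longrightarrow> k i x = 0"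
      by metis
    have int: "(\<integral>x\<in>\<Omega>. h i x * \<psi> x \<partial>lebesgue) = (\<integral>x. k i x * \<psi> x \<partial>lborel)" if "\<psi> \<in> borel_measurable borel" for i \<psi>
    proof -
      note [measurable] = k(1) that
      have "(\<integral>x. k i x * \<psi> x \<partial>lborel) = (\<integral>x. k i x * \<psi> x \<partial>lebesgue)"
        by (rule integral_completion[symmetric]) measurable
      also have "\<dots> = (\<integral>x\<in>\<Omega>. h i x * \<psi> x \<partial>lebesgue)"
      proof -
        have "open \<Omega>" by (rule \<Omega>)
        then have "(\<lambda>x. indicator \<Omega> x *\<^sub>R (h i x * \<psi> x)) \<in> borel_measurable lebesgue"
          using hm[of i] that borel_measurable_times[of "\<lambda>x. indicator \<Omega> x *\<^sub>R h i x" lebesgue \<psi>]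
          by (simp add: set_borel_measurable_def measurable_completion mult.assoc)
        moreover have "(\<lambda>x. k i x * \<psi> x) \<in> borel_measurable lebesgue" by (intro measurable_completion) measurable
        ultimately show ?thesis
          unfolding set_lebesgue_integral_def using k(2)[of i]
          by (intro integral_cong_AE) (auto elim!: eventually_mono)
      qed
      finally show ?thesis ..
    qed
    have w: "(\<integral>x. k None x * pd i \<phi> x \<partial>lborel) = - (\<integral>x. k (Some i) x * \<phi> x \<partial>lborel)" if "test_fun \<Omega> \<phi>" for \<phi> i
      using weak[OF that, of i] int[OF smooth_fun_borel_measurable[OF test_fun_smooth[OF that]]]
        int[OF smooth_fun_borel_measurable[OF test_fun_smooth[OF test_fun_pd[OF that]]]] by simp
    have p0: "0 < p" using p by simp
    show ?thesis
      unfolding herz_norm_eq_seq_norm[OF q(1) k(1,2)] herz_norm_eq_seq_norm[OF p0 k(1,2)]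
      by (rule bound[OF k(1) w k(3)])
  qed
  then show ?thesis using C by (intro exI[of _ C]) blast
qed

section \<open>Iteration\<close>

text \<open>\<open>weak_deriv\<close> quantifies over lists with prescribed multiplicities; this
  provides a list at which to instantiate it.\<close>

lemma ex_list_count: "\<exists>ds. \<forall>i. count_list ds i = (\<beta> :: 'n::finite \<Rightarrow> nat) i"
proof (induction "mi_abs \<beta>" arbitrary: \<beta>)
  case 0
  then show ?case by (intro exI[of _ "[]"]) (simp add: mi_abs_def)
next
  case (Suc n)
  then have "mi_abs \<beta> \<noteq> 0" by simp
  then obtain i where i: "\<beta> i \<noteq> 0" by (auto simp: mi_abs_def)
  define \<gamma> where "\<gamma> = \<beta>(i := \<beta> i - 1)"
  have "\<beta> = \<gamma>(i := Suc (\<gamma> i))" using i by (auto simp: \<gamma>_def)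
  then have "mi_abs \<beta> = Suc (mi_abs \<gamma>)"
    by (simp add: mi_abs_def sum.remove[of UNIV i])
  then obtain ds where "\<forall>j. count_list ds j = \<gamma> j" using Suc by auto
  then show ?case using i by (intro exI[of _ "i # ds"]) (auto simp: \<gamma>_def)
qed

lemma mi_abs_upd: "mi_abs (\<beta>(i := Suc (\<beta> i))) = Suc (mi_abs \<beta>)"
  by (simp add: mi_abs_def sum.remove[of UNIV i])

lemma finite_mi_abs_le: "finite {\<beta> :: 'n::finite \<Rightarrow> nat. mi_abs \<beta> \<le> m}"
proof (rule finite_subset)
  show "{\<beta> :: 'n \<Rightarrow> nat. mi_abs \<beta> \<le> m} \<subseteq> {f. \<forall>x. (x \<in> UNIV \<longrightarrow> f x \<in> {..m}) \<and> (x \<notin> UNIV \<longrightarrow> f x = 0)}"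
    using member_le_sum[of _ "UNIV :: 'n set"] by (auto simp: mi_abs_def intro: order_trans)
  show "finite {f :: 'n \<Rightarrow> nat. \<forall>x. (x \<in> UNIV \<longrightarrow> f x \<in> {..m}) \<and> (x \<notin> UNIV \<longrightarrow> f x = 0)}"
    by (intro finite_set_of_finite_funs) auto
qed

text \<open>Only products of g with test functions are known to be integrable. On an open box whose
  closure lies in \<Omega>, division by a positive bump recovers g, and by Lindelof countably many
  such boxes cover \<Omega>.\<close>

lemma weak_deriv_measurable:
  fixes \<Omega> :: "(real^'n) set"
  assumes "open \<Omega>" "weak_deriv \<Omega> \<beta> f g"
  shows "set_borel_measurable lebesgue \<Omega> g"
proof -
  obtain ds where ds: "\<forall>i. count_list ds i = \<beta> i" using ex_list_count by blast
  define \<F> where "\<F> = {X. \<exists>a b. X = box a b \<and> cbox a b \<subseteq> \<Omega>}"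
  have "\<And>X. X \<in> \<F> \<Longrightarrow> open X" by (auto simp: \<F>_def)
  then obtain \<D> where \<D>: "\<D> \<subseteq> \<F>" "countable \<D>" "\<Union>\<D> = \<Union>\<F>" by (rule Lindelof)
  have cover: "\<Omega> \<subseteq> \<Union>\<D>"
  proof
    fix x assume "x \<in> \<Omega>"
    then obtain a b where "cbox a b \<subseteq> \<Omega>" "x \<in> box a b" using open_contains_cbox[OF assms(1)] by metis
    then show "x \<in> \<Union>\<D>" unfolding \<D>(3) \<F>_def by blast
  qed
  have "open \<Omega>" by fact
  then have [measurable]: "\<Omega> \<in> sets borel" by simp
  have "(\<lambda>x. indicator \<Omega> x * g x) \<in> borel_measurable lebesgue"
  proof (rule measurable_piecewise_restrict)
    show "countable (insert (- \<Omega>) \<D>)" using \<D> by simp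
    show "space lebesgue \<subseteq> \<Union>(insert (- \<Omega>) \<D>)" using cover by auto
    fix X assume X: "X \<in> insert (- \<Omega>) \<D>"
    then have "X \<in> sets borel" using \<D>(1) by (auto simp: \<F>_def)
    then show "X \<inter> space lebesgue \<in> sets lebesgue" by simp
    show "(\<lambda>x. indicator \<Omega> x * g x) \<in> borel_measurable (restrict_space lebesgue X)"
    proof (cases "X = - \<Omega>")
      case True
      have "(\<lambda>x. 0) \<in> borel_measurable (restrict_space lebesgue X)" by simp
      then show ?thesis
        by (rule measurable_cong[THEN iffD1, rotated]) (auto simp: True space_restrict_space)
    next
      case False
      then have "X \<in> \<F>" using X \<D>(1) by blast
      then obtain a b where ab: "X = box a b" "cbox a b \<subseteq> \<Omega>" unfolding \<F>_def by blast
      have \<phi>: "test_fun \<Omega> (box_bump 1 a b)" using ab by (intro test_fun_box_bump) auto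
      then have "set_integrable lebesgue \<Omega> (\<lambda>x. g x * box_bump 1 a b x)"
        using assms(2) ds unfolding weak_deriv_def by blast
      then have "(\<lambda>x. indicator \<Omega> x *\<^sub>R (g x * box_bump 1 a b x)) \<in> borel_measurable lebesgue"
        unfolding set_integrable_def by (rule borel_measurable_integrable)
      moreover have "box_bump 1 a b \<in> borel_measurable lebesgue"
        using smooth_fun_borel_measurable[OF test_fun_smooth[OF \<phi>]] by (intro measurable_completion) simp
      ultimately have "(\<lambda>x. (indicator \<Omega> x *\<^sub>R (g x * box_bump 1 a b x)) / box_bump 1 a b x) \<in> borel_measurable lebesgue"
        by (rule borel_measurable_divide)
      then have "(\<lambda>x. (indicator \<Omega> x *\<^sub>R (g x * box_bump 1 a b x)) / box_bump 1 a b x) \<in> borel_measurable (restrict_space lebesgue X)"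
        by (rule measurable_restrict_space1)
      then show ?thesis
        by (rule measurable_cong[THEN iffD1, rotated]) (use box_bump_nonzero_iff[of 1 a b] in \<open>auto simp: ab(1) space_restrict_space\<close>)
    qed
  qed
  then show ?thesis by (simp add: set_borel_measurable_def)
qed

text \<open>The identity for f is used twice: in order \<beta> with the test function
  \<open>pd i \<phi>\<close>, and in one order more with \<phi>. A list applies its last entry
  first, so appending i makes the two left sides agree. The disjunction admits order 0, where f is
  its own derivative.\<close>

lemma weak_deriv_Suc:
  assumes f: "\<beta> = (\<lambda>_. 0) \<and> g = f \<or> weak_deriv \<Omega> \<beta> f g" and h: "weak_deriv \<Omega> (\<beta>(i := Suc (\<beta> i))) f h" and \<phi>: "test_fun \<Omega> \<phi>"
  shows "(\<integral>x\<in>\<Omega>. g x * pd i \<phi> x \<partial>lebesgue) = - (\<integral>x\<in>\<Omega>. h x * \<phi> x \<partial>lebesgue)"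
proof -
  obtain ds where ds: "\<forall>i. count_list ds i = \<beta> i" using ex_list_count by blast
  have "(\<integral>x\<in>\<Omega>. f x * iter_pd ds (pd i \<phi>) x \<partial>lebesgue) = (-1) ^ mi_abs \<beta> * (\<integral>x\<in>\<Omega>. g x * pd i \<phi> x \<partial>lebesgue)"
    using f
  proof
    assume 0: "\<beta> = (\<lambda>_. 0) \<and> g = f"
    then have "ds = []" using ds by (cases ds) (auto dest: spec[of _ "hd ds"])
    then show ?thesis using 0 by (simp add: mi_abs_def)
  next
    assume "weak_deriv \<Omega> \<beta> f g"
    then show ?thesis using ds test_fun_pd[OF \<phi>] unfolding weak_deriv_def by blast
  qed
  moreover have "(\<integral>x\<in>\<Omega>. f x * iter_pd (ds @ [i]) \<phi> x \<partial>lebesgue) = (-1) ^ mi_abs (\<beta>(i := Suc (\<beta> i))) * (\<integral>x\<in>\<Omega>. h x * \<phi> x \<partial>lebesgue)"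
  proof -
    have "\<forall>j. count_list (ds @ [i]) j = (\<beta>(i := Suc (\<beta> i))) j" using ds by simp
    then show ?thesis using h \<phi> unfolding weak_deriv_def by blast
  qed
  ultimately have "(-1) ^ mi_abs \<beta> * (\<integral>x\<in>\<Omega>. g x * pd i \<phi> x \<partial>lebesgue) = (-1) ^ mi_abs \<beta> * - (\<integral>x\<in>\<Omega>. h x * \<phi> x \<partial>lebesgue)"
    by (simp add: iter_pd_append mi_abs_upd)
  then show ?thesis unfolding mult_cancel_left by simp
qed

text \<open>The induction runs over the number of derivatives spent, for all \<beta> with enough
  derivatives left. D is an arbitrary choice of weak derivatives, since two different choices are
  needed for the embedding.\<close>

lemma sobolev_herz_iterate:
  fixes \<Omega> :: "(real^'n) set" and m :: nat and p \<alpha> \<delta> :: real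
  assumes \<Omega>: "open \<Omega>" "cone_condition \<Omega>" "0 \<in> \<Omega>" and p: "1 < p" and r: "1 \<le> r"
    and \<delta>: "0 \<le> \<delta>" "\<delta> < m" and \<alpha>: "m - CARD('n) / p < \<alpha>" and pos: "0 < CARD('n) / p - m + \<delta>"
  defines "s \<equiv> \<lambda>j. CARD('n) / (CARD('n) / p - real j * ((m - \<delta>) / m))"
  assumes "j \<le> m"
  shows "\<exists>C>0. \<forall>D :: ('n \<Rightarrow> nat) \<Rightarrow> real^'n \<Rightarrow> real. set_borel_measurable lebesgue \<Omega> (D (\<lambda>_. 0)) \<longrightarrow>
     (\<forall>\<beta>. mi_abs \<beta> \<le> m \<longrightarrow> \<beta> \<noteq> (\<lambda>_. 0) \<longrightarrow> weak_deriv \<Omega> \<beta> (D (\<lambda>_. 0)) (D \<beta>)) \<longrightarrow>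
     (\<forall>\<beta>. mi_abs \<beta> + j \<le> m \<longrightarrow> herz_norm (\<alpha> - real j * (\<delta> / m)) (ennreal (s j)) r \<Omega> (D \<beta>)
        \<le> ennreal C * (\<Sum>\<gamma> | mi_abs \<gamma> \<le> m. herz_norm \<alpha> (ennreal p) r \<Omega> (D \<gamma>)))"
  using \<open>j \<le> m\<close>
proof (induction j)
  case 0
  have "s 0 = p" using p by (simp add: s_def)
  then show ?case
    by (intro exI[of _ 1]) (auto intro!: member_le_sum finite_mi_abs_le)
next
  case (Suc j)
  define \<sigma> where "\<sigma> = (m - \<delta>) / m"
  have m: "0 < real m" using \<delta> by linarith
  have \<sigma>: "0 < \<sigma>" "\<sigma> \<le> 1" using \<delta> m by (auto simp: \<sigma>_def)
  have \<sigma>m: "\<sigma> * m = m - \<delta>" "\<delta> / m = 1 - \<sigma>" using m by (auto simp: \<sigma>_def field_simps)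
  define d where "d i = CARD('n) / p - real i * \<sigma>" for i
  have d: "0 < d i" if "i \<le> m" for i
  proof -
    have "real i * \<sigma> \<le> real m * \<sigma>" using that \<sigma> by (intro mult_right_mono) auto
    then show ?thesis using pos \<sigma>m(1) by (simp add: d_def mult.commute)
  qed
  have s: "s i = CARD('n) / d i" for i by (simp add: s_def d_def \<sigma>_def)
  have sd: "CARD('n) / s i = d i" if "i \<le> m" for i using d[OF that] by (simp add: s)
  define A where "A i = \<alpha> - real i * (\<delta> / m)" for i
  have "\<exists>C>0. \<forall>h :: 'n option \<Rightarrow> real^'n \<Rightarrow> real. (\<forall>i. set_borel_measurable lebesgue \<Omega> (h i)) \<longrightarrow>
     (\<forall>\<phi> i. test_fun \<Omega> \<phi> \<longrightarrow> (\<integral>x\<in>\<Omega>. h None x * pd i \<phi> x \<partial>lebesgue) = - (\<integral>x\<in>\<Omega>. h (Some i) x * \<phi> x \<partial>lebesgue)) \<longrightarrow>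
     herz_norm (A (Suc j)) (ennreal (s (Suc j))) r \<Omega> (h None) \<le> ennreal C * (\<Sum>i\<in>UNIV. herz_norm (A j) (ennreal (s j)) r \<Omega> (h i))"
  proof (rule sobolev_herz_first_order[OF \<Omega> _ \<sigma>])
    have "d j \<le> CARD('n) / p" using \<sigma> by (simp add: d_def)
    then have "CARD('n) / p * p \<ge> d j * p" using p by (intro mult_right_mono) auto
    then have "d j * p \<le> CARD('n)" using p by simp
    then have "p \<le> s j" using d[of j] Suc by (simp add: s le_divide_eq mult.commute)
    then show "1 < s j" using p by simp
    show "0 < s (Suc j)" using d[of "Suc j"] Suc by (simp add: s)
    show "CARD('n) / s (Suc j) = CARD('n) / s j - \<sigma>"
      using Suc sd[of j] sd[of "Suc j"] by (simp add: d_def algebra_simps)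
    show "A j = A (Suc j) + 1 - \<sigma>" by (simp add: A_def \<sigma>m(2) algebra_simps)
    have "A (Suc j) + CARD('n) / s (Suc j) = \<alpha> + CARD('n) / p - real (Suc j)"
      using sd[of "Suc j"] Suc by (simp add: A_def d_def \<sigma>m(2) algebra_simps)
    also have "\<dots> > 0" using \<alpha> Suc(2) by linarith
    finally show "0 < A (Suc j) + CARD('n) / s (Suc j)" .
    show "1 \<le> r" by (rule r)
  qed
  then obtain C where C: "0 < C" and step: "\<And>h :: 'n option \<Rightarrow> real^'n \<Rightarrow> real. (\<And>i. set_borel_measurable lebesgue \<Omega> (h i)) \<Longrightarrow>
     (\<And>\<phi> i. test_fun \<Omega> \<phi> \<Longrightarrow> (\<integral>x\<in>\<Omega>. h None x * pd i \<phi> x \<partial>lebesgue) = - (\<integral>x\<in>\<Omega>. h (Some i) x * \<phi> x \<partial>lebesgue)) \<Longrightarrow>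
     herz_norm (A (Suc j)) (ennreal (s (Suc j))) r \<Omega> (h None) \<le> ennreal C * (\<Sum>i\<in>UNIV. herz_norm (A j) (ennreal (s j)) r \<Omega> (h i))"
    by blast
  obtain E where E: "0 < E" and IH: "\<And>(D :: ('n \<Rightarrow> nat) \<Rightarrow> real^'n \<Rightarrow> real) \<beta>. set_borel_measurable lebesgue \<Omega> (D (\<lambda>_. 0)) \<Longrightarrow>
     (\<And>\<beta>. mi_abs \<beta> \<le> m \<Longrightarrow> \<beta> \<noteq> (\<lambda>_. 0) \<Longrightarrow> weak_deriv \<Omega> \<beta> (D (\<lambda>_. 0)) (D \<beta>)) \<Longrightarrow> mi_abs \<beta> + j \<le> m \<Longrightarrow>
     herz_norm (A j) (ennreal (s j)) r \<Omega> (D \<beta>) \<le> ennreal E * (\<Sum>\<gamma> | mi_abs \<gamma> \<le> m. herz_norm \<alpha> (ennreal p) r \<Omega> (D \<gamma>))"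
    using Suc.IH Suc.prems unfolding A_def by (metis Suc_leD)
  have "herz_norm (A (Suc j)) (ennreal (s (Suc j))) r \<Omega> (D \<beta>)
        \<le> ennreal (C * (CARD('n option) * E)) * (\<Sum>\<gamma> | mi_abs \<gamma> \<le> m. herz_norm \<alpha> (ennreal p) r \<Omega> (D \<gamma>))" (is "_ \<le> _ * ?S")
    if D0: "set_borel_measurable lebesgue \<Omega> (D (\<lambda>_. 0))"
      and Dw: "\<And>\<beta>. mi_abs \<beta> \<le> m \<Longrightarrow> \<beta> \<noteq> (\<lambda>_. 0) \<Longrightarrow> weak_deriv \<Omega> \<beta> (D (\<lambda>_. 0)) (D \<beta>)" and \<beta>: "mi_abs \<beta> + Suc j \<le> m"
    for D :: "('n \<Rightarrow> nat) \<Rightarrow> real^'n \<Rightarrow> real" and \<beta>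
  proof -
    \<comment> \<open>One order is still free, so the induction hypothesis covers \<beta> as well as
      \<beta> raised by 1 in any direction; these are the function and its gradient in the first
      order embedding.\<close>
    define e where "e i = (case i of None \<Rightarrow> \<beta> | Some i \<Rightarrow> \<beta>(i := Suc (\<beta> i)))" for i
    have e: "mi_abs (e i) + j \<le> m" for i using \<beta> by (auto simp: e_def mi_abs_upd split: option.split)
    have meas: "set_borel_measurable lebesgue \<Omega> (D \<gamma>)" if "mi_abs \<gamma> \<le> m" for \<gamma>
      using D0 weak_deriv_measurable[OF \<Omega>(1) Dw[OF that]] by (cases "\<gamma> = (\<lambda>_. 0)") auto
    have "herz_norm (A (Suc j)) (ennreal (s (Suc j))) r \<Omega> (D (e None)) \<le> ennreal C * (\<Sum>i\<in>UNIV. herz_norm (A j) (ennreal (s j)) r \<Omega> (D (e i)))"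
    proof (rule step)
      show "set_borel_measurable lebesgue \<Omega> (D (e i))" for i using e[of i] by (intro meas) simp
      fix \<phi> :: "real^'n \<Rightarrow> real" and i assume \<phi>: "test_fun \<Omega> \<phi>"
      show "(\<integral>x\<in>\<Omega>. D (e None) x * pd i \<phi> x \<partial>lebesgue) = - (\<integral>x\<in>\<Omega>. D (e (Some i)) x * \<phi> x \<partial>lebesgue)"
      proof (rule weak_deriv_Suc[OF _ _ \<phi>])
        show "e None = (\<lambda>_. 0) \<and> D (e None) = D (\<lambda>_. 0) \<or> weak_deriv \<Omega> (e None) (D (\<lambda>_. 0)) (D (e None))"
          using Dw[of "e None"] e[of None] by (cases "e None = (\<lambda>_. 0)") auto
        have "e (Some i) \<noteq> (\<lambda>_. 0)" by (auto simp: e_def fun_eq_iff intro!: exI[of _ i])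
        then have "weak_deriv \<Omega> (e (Some i)) (D (\<lambda>_. 0)) (D (e (Some i)))" using e[of "Some i"] by (intro Dw) auto
        then show "weak_deriv \<Omega> ((e None)(i := Suc (e None i))) (D (\<lambda>_. 0)) (D (e (Some i)))" by (simp add: e_def)
      qed
    qed
    also have "\<dots> \<le> ennreal C * (\<Sum>i\<in>(UNIV :: 'n option set). ennreal E * ?S)"
      by (intro mult_left_mono sum_mono IH D0 Dw e) auto
    also have "\<dots> = ennreal (C * (CARD('n option) * E)) * ?S"
      using C E by (simp add: ennreal_mult ennreal_of_nat_eq_real_of_nat mult.assoc del: card_UNIV_option)
    finally show ?thesis by (simp add: e_def)
  qed
  moreover have "0 < C * (CARD('n option) * E)" using C E by simp
  ultimately show ?case unfolding A_def by blast
qed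

text \<open>On each annulus, the contribution of \<beta> is one term of the inner sum over
  multi-indices.\<close>

lemma herz_norm_wderiv_le:
  fixes \<Omega> :: "(real^'n) set"
  assumes "1 < p" "1 \<le> r" "mi_abs \<beta> \<le> m"
  shows "herz_norm \<alpha> (ennreal p) r \<Omega> (wderiv \<Omega> \<beta> f) \<le> herz_sobolev_norm \<alpha> (ennreal p) r m \<Omega> f"
proof -
  have p: "0 < p" "0 < 1 / p" using assms by auto
  let ?nk = "\<lambda>k \<beta>. lp_norm (ennreal p) (\<lambda>x. indicator (annulus k \<inter> \<Omega>) x * wderiv \<Omega> \<beta> f x)"
  have le: "?nk k \<beta> \<le> enn_rpow (\<Sum>\<beta> | mi_abs \<beta> \<le> m. enn_rpow (?nk k \<beta>) p) (1 / p)" for k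
  proof -
    have "?nk k \<beta> = enn_rpow (enn_rpow (?nk k \<beta>) p) (1 / p)" using p by (simp only: enn_rpow_cancel)
    also have "\<dots> \<le> enn_rpow (\<Sum>\<beta> | mi_abs \<beta> \<le> m. enn_rpow (?nk k \<beta>) p) (1 / p)"
      using assms(3) by (intro enn_rpow_mono p member_le_sum finite_mi_abs_le) auto
    finally show ?thesis .
  qed
  have "herz_sobolev_norm \<alpha> (ennreal p) r m \<Omega> f = seq_norm r (\<lambda>k. ennreal (2 powr (real_of_int k * \<alpha>)) *
      enn_rpow (\<Sum>\<beta> | mi_abs \<beta> \<le> m. enn_rpow (?nk k \<beta>) p) (1 / p))"
    using p by (simp add: herz_sobolev_norm_def seq_norm_def)
  moreover have "herz_norm \<alpha> (ennreal p) r \<Omega> (wderiv \<Omega> \<beta> f) = seq_norm r (\<lambda>k. ennreal (2 powr (real_of_int k * \<alpha>)) * ?nk k \<beta>)"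
    by (simp add: herz_norm_def seq_norm_def)
  ultimately show ?thesis
    using le by (simp only:) (intro seq_norm_mono assms mult_left_mono le, simp)
qed

theorem theorem3p12:
  fixes \<Omega> :: "(real^'n) set"
    and m :: nat and p q \<alpha>\<^sub>1 \<alpha>\<^sub>2 :: real and r :: ennreal
  assumes "open \<Omega>" and "connected \<Omega>" and "cone_condition \<Omega>" and "0 \<in> \<Omega>"
    and "1 < p" and "1 \<le> r"
    and "in_V CARD('n) \<alpha>\<^sub>2 (ennreal p) r"
    and "\<alpha>\<^sub>2 \<ge> \<alpha>\<^sub>1"
    and "real m - real CARD('n) / p < \<alpha>\<^sub>2" and "\<alpha>\<^sub>2 < real CARD('n) - real CARD('n) / p"
    and "real m - \<alpha>\<^sub>2 + \<alpha>\<^sub>1 > 0"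
    and "q > 0"
    and "real CARD('n) / q = real CARD('n) / p - real m + \<alpha>\<^sub>2 - \<alpha>\<^sub>1"
    and "real CARD('n) / p - real m + \<alpha>\<^sub>2 - \<alpha>\<^sub>1 > 0"
  shows "herz_sobolev_space \<alpha>\<^sub>2 (ennreal p) r m \<Omega> \<subseteq> herz_space \<alpha>\<^sub>1 (ennreal q) r \<Omega> \<and>
         (\<exists>C::real. \<forall>f\<in>herz_sobolev_space \<alpha>\<^sub>2 (ennreal p) r m \<Omega>.
            herz_norm \<alpha>\<^sub>1 (ennreal q) r \<Omega> f \<le> ennreal C * herz_sobolev_norm \<alpha>\<^sub>2 (ennreal p) r m \<Omega> f)"
proof -
  define \<delta> where "\<delta> = \<alpha>\<^sub>2 - \<alpha>\<^sub>1"
  have \<delta>: "0 \<le> \<delta>" "\<delta> < m" using assms by (auto simp: \<delta>_def)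
  \<comment> \<open>From 0 \<le> \<delta> < m the order m is positive, so the loss can be divided
    evenly into m steps.\<close>
  have m: "0 < real m" using \<delta> by linarith
  have pos: "0 < CARD('n) / p - m + \<delta>" using assms by (simp add: \<delta>_def)
  have "CARD('n) / p - real m * ((m - \<delta>) / m) = CARD('n) / q"
    using m assms(13) by (simp add: \<delta>_def)
  then have exps: "CARD('n) / (CARD('n) / p - real m * ((m - \<delta>) / m)) = q" "\<alpha>\<^sub>2 - real m * (\<delta> / m) = \<alpha>\<^sub>1"
    using m \<open>q > 0\<close> by (auto simp: \<delta>_def)
  let ?S = "\<lambda>D. \<Sum>\<gamma> | mi_abs \<gamma> \<le> m. herz_norm \<alpha>\<^sub>2 (ennreal p) r \<Omega> (D \<gamma>)"
  obtain C where C: "0 < C" and bound: "\<And>D :: ('n \<Rightarrow> nat) \<Rightarrow> real^'n \<Rightarrow> real. set_borel_measurable lebesgue \<Omega> (D (\<lambda>_. 0)) \<Longrightarrow>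
     (\<And>\<beta>. mi_abs \<beta> \<le> m \<Longrightarrow> \<beta> \<noteq> (\<lambda>_. 0) \<Longrightarrow> weak_deriv \<Omega> \<beta> (D (\<lambda>_. 0)) (D \<beta>)) \<Longrightarrow>
     herz_norm \<alpha>\<^sub>1 (ennreal q) r \<Omega> (D (\<lambda>_. 0)) \<le> ennreal C * ?S D"
  proof -
    have "mi_abs (\<lambda>_::'n. 0) + m \<le> m" by (simp add: mi_abs_def)
    then show ?thesis
      using sobolev_herz_iterate[OF assms(1,3,4,5,6) \<delta> assms(9) pos order_refl] that
      unfolding exps by blast
  qed
  define N where "N = card {\<gamma> :: 'n \<Rightarrow> nat. mi_abs \<gamma> \<le> m}"
  have fin: "finite {\<gamma> :: 'n \<Rightarrow> nat. mi_abs \<gamma> \<le> m}" by (rule finite_mi_abs_le)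
  have norm_le: "herz_norm \<alpha>\<^sub>1 (ennreal q) r \<Omega> f \<le> ennreal (C * N) * herz_sobolev_norm \<alpha>\<^sub>2 (ennreal p) r m \<Omega> f"
    if f: "f \<in> herz_sobolev_space \<alpha>\<^sub>2 (ennreal p) r m \<Omega>" for f
  proof -
    have D0: "wderiv \<Omega> (\<lambda>_. 0) f = f" by (simp add: wderiv_def)
    have "herz_norm \<alpha>\<^sub>1 (ennreal q) r \<Omega> (wderiv \<Omega> (\<lambda>_. 0) f) \<le> ennreal C * ?S (\<lambda>\<beta>. wderiv \<Omega> \<beta> f)"
    proof (rule bound)
      show "set_borel_measurable lebesgue \<Omega> (wderiv \<Omega> (\<lambda>_. 0) f)"
        using f by (simp add: D0 herz_sobolev_space_def herz_space_def)
      fix \<beta> :: "'n \<Rightarrow> nat" assume \<beta>: "mi_abs \<beta> \<le> m" "\<beta> \<noteq> (\<lambda>_. 0)"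
      then have "\<exists>g. weak_deriv \<Omega> \<beta> f g" using f by (auto simp: herz_sobolev_space_def)
      then show "weak_deriv \<Omega> \<beta> (wderiv \<Omega> (\<lambda>_. 0) f) (wderiv \<Omega> \<beta> f)"
        using \<beta> unfolding D0 by (simp add: wderiv_def someI_ex)
    qed
    also have "\<dots> \<le> ennreal C * (\<Sum>\<gamma> | mi_abs (\<gamma> :: 'n \<Rightarrow> nat) \<le> m. herz_sobolev_norm \<alpha>\<^sub>2 (ennreal p) r m \<Omega> f)"
      using assms by (intro mult_left_mono sum_mono herz_norm_wderiv_le) auto
    also have "\<dots> = ennreal (C * N) * herz_sobolev_norm \<alpha>\<^sub>2 (ennreal p) r m \<Omega> f"
      using C by (simp add: N_def ennreal_mult ennreal_of_nat_eq_real_of_nat mult.assoc)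
    finally show ?thesis by (simp only: D0)
  qed
  \<comment> \<open>Finiteness is not read off from the Sobolev norm: \<open>wderiv\<close> picks
    some weak derivative, while the definition of the space provides a possibly different one with
    finite Herz norm. The bound is therefore applied a second time, to these witnesses.\<close>
  have "f \<in> herz_space \<alpha>\<^sub>1 (ennreal q) r \<Omega>" if f: "f \<in> herz_sobolev_space \<alpha>\<^sub>2 (ennreal p) r m \<Omega>" for f
  proof -
    have "\<exists>D. \<forall>\<beta>. (\<beta> = (\<lambda>_. 0) \<longrightarrow> D \<beta> = f) \<and>
      (mi_abs \<beta> \<le> m \<longrightarrow> \<beta> \<noteq> (\<lambda>_. 0) \<longrightarrow> weak_deriv \<Omega> \<beta> f (D \<beta>) \<and> D \<beta> \<in> herz_space \<alpha>\<^sub>2 (ennreal p) r \<Omega>)"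
      using f unfolding herz_sobolev_space_def by (intro choice) auto
    then obtain D where D: "D (\<lambda>_. 0) = f" "\<And>\<beta>. mi_abs \<beta> \<le> m \<Longrightarrow> \<beta> \<noteq> (\<lambda>_. 0) \<Longrightarrow> weak_deriv \<Omega> \<beta> f (D \<beta>) \<and> D \<beta> \<in> herz_space \<alpha>\<^sub>2 (ennreal p) r \<Omega>"
      by blast
    have f': "f \<in> herz_space \<alpha>\<^sub>2 (ennreal p) r \<Omega>" using f by (simp add: herz_sobolev_space_def)
    have "herz_norm \<alpha>\<^sub>1 (ennreal q) r \<Omega> (D (\<lambda>_. 0)) \<le> ennreal C * ?S D"
      using D f' by (intro bound) (auto simp: herz_space_def)
    also have "\<dots> < \<infinity>"
    proof -
      have "herz_norm \<alpha>\<^sub>2 (ennreal p) r \<Omega> (D \<gamma>) < top" if "mi_abs \<gamma> \<le> m" for \<gamma>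
        using D(1) D(2)[OF that] f' by (cases "\<gamma> = (\<lambda>_. 0)") (auto simp: herz_space_def)
      then show ?thesis using fin by (simp add: ennreal_mult_less_top)
    qed
    finally show ?thesis using f' D(1) by (simp add: herz_space_def)
  qed
  then show ?thesis using norm_le by blast
qed

end
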